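(* Let $H$ be a finite-dimensional pointed Hopf algebra over $\Bbbk$ of rank one, with group of grouplike elements $G=G(H)$ (not necessarily abelian), generated by $G$ and a $(g,1)$-skew-primitive element $x$ with $g\in Z(G)$. Then $H$ is Galois-theoretical if and only if the Hopf subalgebra of $H$ generated by $\{g,x\}$ is a Taft algebra.
   Context: $\Bbbk$ is an algebraically closed field of characteristic zero. A Hopf algebra $H$ acts on a $\Bbbk$-algebra $A$ if $A$ is a left $H$-module algebra, i.e. $h\cdot(ab)=\sum (h_1\cdot a)(h_2\cdot b)$ and $h\cdot 1=\varepsilon(h)1$. The action is inner faithful if $I\cdot A\neq 0$ for every nonzero Hopf ideal $I$ of $H$. $H$ is Galois-theoretical if it acts inner faithfully on some field containing $\Bbbk$. An element $x$ is $(g,g')$-skew-primitive if $\Delta(x)=g\otimes x+x\otimes g'$, with $g,g'$ grouplike. A Hopf algebra is pointed if all its simple comodules are 1-dimensional. If $\{H_n\}$ is the coradical filtration, $H_0$ is a Hopf subalgebra and $H$ is generated as an algebra by $H_1$, then the rank of $H$ is $\theta$ where $\dim(\Bbbk\otimes_{H_0}H_1)=\theta+1$. Known fact (Krop–Radford) fixing the notation $g,x$: every finite-dimensional pointed Hopf algebra of rank one is generated by $G=G(H)$ and a $(g,1)$-skew-primitive element $x$, for some $g\in Z(G)$, a character $\chi:G\to\Bbbk^\times$ and $\alpha\in\Bbbk$, subject to the relations of $G$ and $x^m=\alpha(g^m-1)$, $ax=\chi(a)xa$ for all $a\in G$, where $m$ is the order of $\chi(g)$. The Taft algebra $T(n,\zeta)$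 ($n\ge 2$, $\zeta$ a primitive $n$-th root of unity) is generated by a grouplike $g$ and a $(g,1)$-skew-primitive $x$ with $g^n=1$, $x^n=0$, $gx=\zeta xg$. *)

theory Defs
  imports
    "HOL-Library.Poly_Mapping"
    "HOL-Computational_Algebra.Polynomial"
    "HOL-Algebra.Ring"
begin

section \<open>Free vector spaces, quotients and tensor products\<close>

definition fscale :: "'k::field \<Rightarrow> ('a \<Rightarrow>\<^sub>0 'k) \<Rightarrow> ('a \<Rightarrow>\<^sub>0 'k)" where
  "fscale c f = Poly_Mapping.map ((*) c) f"

lemma lookup_fscale: "Poly_Mapping.lookup (fscale c f) a = c * Poly_Mapping.lookup f a"
  unfolding fscale_def by transfer (simp add: when_def)

lemma vector_space_fscale: "vector_space (fscale :: 'k::field \<Rightarrow> ('a \<Rightarrow>\<^sub>0 'k) \<Rightarrow> _)"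
  by unfold_locales
    (auto intro!: poly_mapping_eqI simp: lookup_fscale lookup_add algebra_simps)

interpretation fvs: vector_space "fscale :: 'k::field \<Rightarrow> ('a \<Rightarrow>\<^sub>0 'k) \<Rightarrow> _"
  by (rule vector_space_fscale)

abbreviation vs_span :: "('k::field \<Rightarrow> 'v::ab_group_add \<Rightarrow> 'v) \<Rightarrow> 'v set \<Rightarrow> 'v set" where
  "vs_span s \<equiv> module.span s"

abbreviation vs_subspace :: "('k::field \<Rightarrow> 'v::ab_group_add \<Rightarrow> 'v) \<Rightarrow> 'v set \<Rightarrow> bool" where
  "vs_subspace s \<equiv> module.subspace s"

text \<open>The quotient of the subspace \<open>V\<close> by the subspace \<open>W\<close> (with \<open>W \<subseteq> V\<close>) has
  dimension \<open>n\<close>: there are \<open>n\<close> vectors in \<open>V\<close> whose classes form a basis.\<close>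

definition quotient_dim ::
  "('k::field \<Rightarrow> 'v::ab_group_add \<Rightarrow> 'v) \<Rightarrow> 'v set \<Rightarrow> 'v set \<Rightarrow> nat \<Rightarrow> bool" where
  "quotient_dim s V W n \<longleftrightarrow>
     (\<exists>B \<subseteq> V. finite B \<and> card B = n \<and> V \<subseteq> vs_span s (B \<union> W) \<and>
        (\<forall>u. (\<Sum>b\<in>B. s (u b) b) \<in> W \<longrightarrow> (\<forall>b\<in>B. u b = 0)))"

text \<open>For subspaces \<open>V\<close>, \<open>W\<close> of vector spaces with scalar multiplications \<open>s\<close>, \<open>t\<close>, the tensor
  product of \<open>V\<close> and \<open>W\<close> is the free vector space on \<open>V \<times> W\<close> modulo the span of
  \<open>bilinear_rels s V t W\<close>. Every element of it is a finite sum of pure tensors, so an element is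
  written as a list of pairs (as in Sweedler notation), and two lists are compared
  by \<open>tensor_eq\<close>. Threefold tensors are treated in the same way.\<close>

definition bilinear_rels ::
  "('k::field \<Rightarrow> 'v::ab_group_add \<Rightarrow> 'v) \<Rightarrow> 'v set \<Rightarrow>
   ('k \<Rightarrow> 'w::ab_group_add \<Rightarrow> 'w) \<Rightarrow> 'w set \<Rightarrow> ('v \<times> 'w \<Rightarrow>\<^sub>0 'k) set" where
  "bilinear_rels s V t W =
     {Poly_Mapping.single (v + v', w) 1 - Poly_Mapping.single (v, w) 1
        - Poly_Mapping.single (v', w) 1 | v v' w. v \<in> V \<and> v' \<in> V \<and> w \<in> W} \<union>
     {Poly_Mapping.single (v, w + w') 1 - Poly_Mapping.single (v, w) 1
        - Poly_Mapping.single (v, w') 1 | v w w'. v \<in> V \<and> w \<in> W \<and> w' \<in> W} \<union>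
     {Poly_Mapping.single (s c v, w) 1 - Poly_Mapping.single (v, w) c | c v w. v \<in> V \<and> w \<in> W} \<union>
     {Poly_Mapping.single (v, t c w) 1 - Poly_Mapping.single (v, w) c | c v w. v \<in> V \<and> w \<in> W}"

definition trilinear_rels ::
  "('k::field \<Rightarrow> 'v::ab_group_add \<Rightarrow> 'v) \<Rightarrow> 'v set \<Rightarrow>
   ('k \<Rightarrow> 'w::ab_group_add \<Rightarrow> 'w) \<Rightarrow> 'w set \<Rightarrow>
   ('k \<Rightarrow> 'z::ab_group_add \<Rightarrow> 'z) \<Rightarrow> 'z set \<Rightarrow> ('v \<times> 'w \<times> 'z \<Rightarrow>\<^sub>0 'k) set" where
  "trilinear_rels s V t W r Z =
     {Poly_Mapping.single (v + v', w, z) 1 - Poly_Mapping.single (v, w, z) 1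
        - Poly_Mapping.single (v', w, z) 1 | v v' w z. v \<in> V \<and> v' \<in> V \<and> w \<in> W \<and> z \<in> Z} \<union>
     {Poly_Mapping.single (v, w + w', z) 1 - Poly_Mapping.single (v, w, z) 1
        - Poly_Mapping.single (v, w', z) 1 | v w w' z. v \<in> V \<and> w \<in> W \<and> w' \<in> W \<and> z \<in> Z} \<union>
     {Poly_Mapping.single (v, w, z + z') 1 - Poly_Mapping.single (v, w, z) 1
        - Poly_Mapping.single (v, w, z') 1 | v w z z'. v \<in> V \<and> w \<in> W \<and> z \<in> Z \<and> z' \<in> Z} \<union>
     {Poly_Mapping.single (s c v, w, z) 1 - Poly_Mapping.single (v, w, z) c
        | c v w z. v \<in> V \<and> w \<in> W \<and> z \<in> Z} \<union>
     {Poly_Mapping.single (v, t c w, z) 1 - Poly_Mapping.single (v, w, z) c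
        | c v w z. v \<in> V \<and> w \<in> W \<and> z \<in> Z} \<union>
     {Poly_Mapping.single (v, w, r c z) 1 - Poly_Mapping.single (v, w, z) c
        | c v w z. v \<in> V \<and> w \<in> W \<and> z \<in> Z}"

definition formal_sum :: "'a list \<Rightarrow> ('a \<Rightarrow>\<^sub>0 'k::field)" where
  "formal_sum ps = (\<Sum>p\<leftarrow>ps. Poly_Mapping.single p 1)"

definition tensor_eq ::
  "('k::field \<Rightarrow> 'v::ab_group_add \<Rightarrow> 'v) \<Rightarrow> 'v set \<Rightarrow>
   ('k \<Rightarrow> 'w::ab_group_add \<Rightarrow> 'w) \<Rightarrow> 'w set \<Rightarrow> ('v \<times> 'w) list \<Rightarrow> ('v \<times> 'w) list \<Rightarrow> bool" where
  "tensor_eq s V t W ps qs \<longleftrightarrow>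
     formal_sum ps - formal_sum qs \<in> vs_span fscale (bilinear_rels s V t W)"

definition tensor3_eq ::
  "('k::field \<Rightarrow> 'v::ab_group_add \<Rightarrow> 'v) \<Rightarrow> 'v set \<Rightarrow>
   ('k \<Rightarrow> 'w::ab_group_add \<Rightarrow> 'w) \<Rightarrow> 'w set \<Rightarrow>
   ('k \<Rightarrow> 'z::ab_group_add \<Rightarrow> 'z) \<Rightarrow> 'z set \<Rightarrow>
   ('v \<times> 'w \<times> 'z) list \<Rightarrow> ('v \<times> 'w \<times> 'z) list \<Rightarrow> bool" where
  "tensor3_eq s V t W r Z ps qs \<longleftrightarrow>
     formal_sum ps - formal_sum qs \<in> vs_span fscale (trilinear_rels s V t W r Z)"


section \<open>Hopf algebras\<close>

text \<open>The underlying ring is the type \<open>'h\<close>; \<open>comult H h\<close> is a list representing the tensor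
  \<open>\<Delta> h\<close>, so laws about it are stated up to \<open>heq H\<close>, equality in the tensor square.\<close>

record ('k, 'h) hopf =
  scl :: "'k \<Rightarrow> 'h \<Rightarrow> 'h"
  comult :: "'h \<Rightarrow> ('h \<times> 'h) list"
  counit :: "'h \<Rightarrow> 'k"
  antipode :: "'h \<Rightarrow> 'h"

abbreviation heq :: "('k::field, 'h::ring_1) hopf \<Rightarrow> ('h \<times> 'h) list \<Rightarrow> ('h \<times> 'h) list \<Rightarrow> bool" where
  "heq H \<equiv> tensor_eq (scl H) UNIV (scl H) UNIV"

abbreviation heq3 ::
  "('k::field, 'h::ring_1) hopf \<Rightarrow> ('h \<times> 'h \<times> 'h) list \<Rightarrow> ('h \<times> 'h \<times> 'h) list \<Rightarrow> bool" where
  "heq3 H \<equiv> tensor3_eq (scl H) UNIV (scl H) UNIV (scl H) UNIV"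

locale hopf_algebra =
  fixes H :: "('k::field, 'h::ring_1) hopf"
  assumes vs: "vector_space (scl H)"
    and scl_mult_left: "scl H c a * b = scl H c (a * b)"
    and scl_mult_right: "a * scl H c b = scl H c (a * b)"
    and comult_add: "heq H (comult H (a + b)) (comult H a @ comult H b)"
    and comult_scl: "heq H (comult H (scl H c a)) [(scl H c a1, a2). (a1, a2) \<leftarrow> comult H a]"
    and coassoc: "heq3 H [(a11, a12, a2). (a1, a2) \<leftarrow> comult H a, (a11, a12) \<leftarrow> comult H a1]
                         [(a1, a21, a22). (a1, a2) \<leftarrow> comult H a, (a21, a22) \<leftarrow> comult H a2]"
    and counit_add: "counit H (a + b) = counit H a + counit H b"
    and counit_scl: "counit H (scl H c a) = c * counit H a"
    and counit_left: "(\<Sum>(a1, a2)\<leftarrow>comult H a. scl H (counit H a1) a2) = a"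
    and counit_right: "(\<Sum>(a1, a2)\<leftarrow>comult H a. scl H (counit H a2) a1) = a"
    and comult_one: "heq H (comult H 1) [(1, 1)]"
    and comult_mult: "heq H (comult H (a * b))
           [(a1 * b1, a2 * b2). (a1, a2) \<leftarrow> comult H a, (b1, b2) \<leftarrow> comult H b]"
    and counit_one: "counit H 1 = 1"
    and counit_mult: "counit H (a * b) = counit H a * counit H b"
    and antipode_add: "antipode H (a + b) = antipode H a + antipode H b"
    and antipode_scl: "antipode H (scl H c a) = scl H c (antipode H a)"
    and antipode_left: "(\<Sum>(a1, a2)\<leftarrow>comult H a. antipode H a1 * a2) = scl H (counit H a) 1"
    and antipode_right: "(\<Sum>(a1, a2)\<leftarrow>comult H a. a1 * antipode H a2) = scl H (counit H a) 1"

definition finite_dim :: "('k::field, 'h::ring_1) hopf \<Rightarrow> bool" where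
  "finite_dim H \<longleftrightarrow> (\<exists>B. finite B \<and> vs_span (scl H) B = UNIV)"

definition grouplikes :: "('k::field, 'h::ring_1) hopf \<Rightarrow> 'h set" where
  "grouplikes H = {a. a \<noteq> 0 \<and> heq H (comult H a) [(a, a)]}"

definition grouplike_center :: "('k::field, 'h::ring_1) hopf \<Rightarrow> 'h set" where
  "grouplike_center H = {g \<in> grouplikes H. \<forall>a\<in>grouplikes H. g * a = a * g}"

definition skew_primitive :: "('k::field, 'h::ring_1) hopf \<Rightarrow> 'h \<Rightarrow> 'h \<Rightarrow> 'h \<Rightarrow> bool" where
  "skew_primitive H g g' x \<longleftrightarrow>
     g \<in> grouplikes H \<and> g' \<in> grouplikes H \<and> heq H (comult H x) [(g, x), (x, g')]"

definition is_subalgebra :: "('k::field, 'h::ring_1) hopf \<Rightarrow> 'h set \<Rightarrow> bool" where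
  "is_subalgebra H K \<longleftrightarrow> vs_subspace (scl H) K \<and> 1 \<in> K \<and> (\<forall>a\<in>K. \<forall>b\<in>K. a * b \<in> K)"

definition generated_subalgebra :: "('k::field, 'h::ring_1) hopf \<Rightarrow> 'h set \<Rightarrow> 'h set" where
  "generated_subalgebra H X = \<Inter>{K. is_subalgebra H K \<and> X \<subseteq> K}"

definition subcoalgebra :: "('k::field, 'h::ring_1) hopf \<Rightarrow> 'h set \<Rightarrow> bool" where
  "subcoalgebra H C \<longleftrightarrow> vs_subspace (scl H) C \<and>
     (\<forall>a\<in>C. \<exists>ps. set ps \<subseteq> C \<times> C \<and> heq H (comult H a) ps)"

definition hopf_subalgebra :: "('k::field, 'h::ring_1) hopf \<Rightarrow> 'h set \<Rightarrow> bool" where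
  "hopf_subalgebra H K \<longleftrightarrow> is_subalgebra H K \<and> subcoalgebra H K \<and> antipode H ` K \<subseteq> K"

definition generated_hopf_subalgebra :: "('k::field, 'h::ring_1) hopf \<Rightarrow> 'h set \<Rightarrow> 'h set" where
  "generated_hopf_subalgebra H X = \<Inter>{K. hopf_subalgebra H K \<and> X \<subseteq> K}"

definition hopf_ideal :: "('k::field, 'h::ring_1) hopf \<Rightarrow> 'h set \<Rightarrow> bool" where
  "hopf_ideal H I \<longleftrightarrow> vs_subspace (scl H) I \<and> (\<forall>a\<in>I. \<forall>h. h * a \<in> I \<and> a * h \<in> I) \<and>
     (\<forall>a\<in>I. \<exists>ps. set ps \<subseteq> (I \<times> UNIV) \<union> (UNIV \<times> I) \<and> heq H (comult H a) ps) \<and>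
     (\<forall>a\<in>I. counit H a = 0) \<and> antipode H ` I \<subseteq> I"


section \<open>Comodules and pointedness\<close>

definition right_comodule ::
  "('k::field, 'h::ring_1) hopf \<Rightarrow> ('k \<Rightarrow> 'v::ab_group_add \<Rightarrow> 'v) \<Rightarrow> 'v set \<Rightarrow>
   ('v \<Rightarrow> ('v \<times> 'h) list) \<Rightarrow> bool" where
  "right_comodule H s V \<rho> \<longleftrightarrow> vs_subspace s V \<and>
     (\<forall>v\<in>V. set (\<rho> v) \<subseteq> V \<times> UNIV) \<and>
     (\<forall>v\<in>V. \<forall>w\<in>V. tensor_eq s V (scl H) UNIV (\<rho> (v + w)) (\<rho> v @ \<rho> w)) \<and>
     (\<forall>c. \<forall>v\<in>V. tensor_eq s V (scl H) UNIV (\<rho> (s c v)) [(s c v0, v1). (v0, v1) \<leftarrow> \<rho> v]) \<and>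
     (\<forall>v\<in>V. tensor3_eq s V (scl H) UNIV (scl H) UNIV
        [(v00, v01, v1). (v0, v1) \<leftarrow> \<rho> v, (v00, v01) \<leftarrow> \<rho> v0]
        [(v0, v11, v12). (v0, v1) \<leftarrow> \<rho> v, (v11, v12) \<leftarrow> comult H v1]) \<and>
     (\<forall>v\<in>V. (\<Sum>(v0, v1)\<leftarrow>\<rho> v. s (counit H v1) v0) = v)"

definition subcomodule ::
  "('k::field, 'h::ring_1) hopf \<Rightarrow> ('k \<Rightarrow> 'v::ab_group_add \<Rightarrow> 'v) \<Rightarrow> 'v set \<Rightarrow>
   ('v \<Rightarrow> ('v \<times> 'h) list) \<Rightarrow> 'v set \<Rightarrow> bool" where
  "subcomodule H s V \<rho> W \<longleftrightarrow> vs_subspace s W \<and> W \<subseteq> V \<and>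
     (\<forall>w\<in>W. \<exists>ps. set ps \<subseteq> W \<times> UNIV \<and> tensor_eq s V (scl H) UNIV (\<rho> w) ps)"

definition simple_comodule ::
  "('k::field, 'h::ring_1) hopf \<Rightarrow> ('k \<Rightarrow> 'v::ab_group_add \<Rightarrow> 'v) \<Rightarrow> 'v set \<Rightarrow>
   ('v \<Rightarrow> ('v \<times> 'h) list) \<Rightarrow> bool" where
  "simple_comodule H s V \<rho> \<longleftrightarrow> right_comodule H s V \<rho> \<and> V \<noteq> {0} \<and>
     (\<forall>W. subcomodule H s V \<rho> W \<longrightarrow> W = {0} \<or> W = V)"

text \<open>A quantifier over all simple comodules needs a fixed type for their elements. Every simple
  right comodule embeds into \<open>H\<close> (as a comodule, with coaction \<open>\<Delta>\<close>), so up to isomorphism all of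
  them have as underlying vector space a subspace of \<open>H\<close>.\<close>

definition pointed :: "('k::field, 'h::ring_1) hopf \<Rightarrow> bool" where
  "pointed H \<longleftrightarrow>
     (\<forall>(V :: 'h set) \<rho>. simple_comodule H (scl H) V \<rho> \<longrightarrow> vector_space.dim (scl H) V = 1)"


section \<open>Coradical filtration and rank\<close>

definition simple_subcoalgebra :: "('k::field, 'h::ring_1) hopf \<Rightarrow> 'h set \<Rightarrow> bool" where
  "simple_subcoalgebra H C \<longleftrightarrow> subcoalgebra H C \<and> C \<noteq> {0} \<and>
     (\<forall>D. subcoalgebra H D \<and> D \<subseteq> C \<longrightarrow> D = {0} \<or> D = C)"

definition coradical :: "('k::field, 'h::ring_1) hopf \<Rightarrow> 'h set" where
  "coradical H = vs_span (scl H) (\<Union>{C. simple_subcoalgebra H C})"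

fun coradical_filtration :: "('k::field, 'h::ring_1) hopf \<Rightarrow> nat \<Rightarrow> 'h set" where
  "coradical_filtration H 0 = coradical H"
| "coradical_filtration H (Suc n) =
     {a. \<exists>ps. set ps \<subseteq> (UNIV \<times> coradical_filtration H n) \<union> (coradical H \<times> UNIV) \<and>
              heq H (comult H a) ps}"

text \<open>The tensor product over \<open>H\<^sub>0\<close> of the trivial right module \<open>\<k>\<close> (on which \<open>a\<close> acts as
  \<open>\<epsilon> a\<close>) and the left module \<open>H\<^sub>1\<close> is the free vector space on \<open>\<k> \<times> H\<^sub>1\<close> modulo the bilinear
  relations and the relations that make it balanced.\<close>

definition balanced_rels :: "('k::field, 'h::ring_1) hopf \<Rightarrow> ('k \<times> 'h \<Rightarrow>\<^sub>0 'k) set" where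
  "balanced_rels H =
     bilinear_rels (*) UNIV (scl H) (coradical_filtration H 1) \<union>
     {Poly_Mapping.single (c * counit H a, y) 1 - Poly_Mapping.single (c, a * y) 1 | c a y.
        a \<in> coradical_filtration H 0 \<and> y \<in> coradical_filtration H 1}"

definition has_rank :: "('k::field, 'h::ring_1) hopf \<Rightarrow> nat \<Rightarrow> bool" where
  "has_rank H \<theta> \<longleftrightarrow>
     hopf_subalgebra H (coradical_filtration H 0) \<and>
     generated_subalgebra H (coradical_filtration H 1) = UNIV \<and>
     quotient_dim fscale
       {f. Poly_Mapping.keys f \<subseteq> UNIV \<times> coradical_filtration H 1}
       (vs_span fscale (balanced_rels H)) (\<theta> + 1)"


section \<open>Actions\<close>

text \<open>A \<open>\<k>\<close>-algebra is a ring \<open>A\<close> with a central ring homomorphism \<open>\<iota>\<close> from \<open>\<k>\<close>.\<close>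

definition k_algebra :: "('l, 'm) ring_scheme \<Rightarrow> ('k::field \<Rightarrow> 'l) \<Rightarrow> bool" where
  "k_algebra A \<iota> \<longleftrightarrow> ring A \<and> range \<iota> \<subseteq> carrier A \<and> \<iota> 1 = \<one>\<^bsub>A\<^esub> \<and>
     (\<forall>c d. \<iota> (c + d) = \<iota> c \<oplus>\<^bsub>A\<^esub> \<iota> d) \<and> (\<forall>c d. \<iota> (c * d) = \<iota> c \<otimes>\<^bsub>A\<^esub> \<iota> d) \<and>
     (\<forall>c. \<forall>u\<in>carrier A. \<iota> c \<otimes>\<^bsub>A\<^esub> u = u \<otimes>\<^bsub>A\<^esub> \<iota> c)"

definition module_algebra ::
  "('k::field, 'h::ring_1) hopf \<Rightarrow> ('l, 'm) ring_scheme \<Rightarrow> ('k \<Rightarrow> 'l) \<Rightarrow> ('h \<Rightarrow> 'l \<Rightarrow> 'l) \<Rightarrow> bool" where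
  "module_algebra H A \<iota> act \<longleftrightarrow> k_algebra A \<iota> \<and>
     (\<forall>h. \<forall>u\<in>carrier A. act h u \<in> carrier A) \<and>
     (\<forall>h h'. \<forall>u\<in>carrier A. act (h + h') u = act h u \<oplus>\<^bsub>A\<^esub> act h' u) \<and>
     (\<forall>c h. \<forall>u\<in>carrier A. act (scl H c h) u = \<iota> c \<otimes>\<^bsub>A\<^esub> act h u) \<and>
     (\<forall>h. \<forall>u\<in>carrier A. \<forall>v\<in>carrier A. act h (u \<oplus>\<^bsub>A\<^esub> v) = act h u \<oplus>\<^bsub>A\<^esub> act h v) \<and>
     (\<forall>c h. \<forall>u\<in>carrier A. act h (\<iota> c \<otimes>\<^bsub>A\<^esub> u) = \<iota> c \<otimes>\<^bsub>A\<^esub> act h u) \<and>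
     (\<forall>u\<in>carrier A. act 1 u = u) \<and>
     (\<forall>h h'. \<forall>u\<in>carrier A. act (h * h') u = act h (act h' u)) \<and>
     (\<forall>h. \<forall>u\<in>carrier A. \<forall>v\<in>carrier A. act h (u \<otimes>\<^bsub>A\<^esub> v) =
        foldr (\<lambda>(h1, h2) r. (act h1 u \<otimes>\<^bsub>A\<^esub> act h2 v) \<oplus>\<^bsub>A\<^esub> r) (comult H h) \<zero>\<^bsub>A\<^esub>) \<and>
     (\<forall>h. act h \<one>\<^bsub>A\<^esub> = \<iota> (counit H h))"

definition inner_faithful ::
  "('k::field, 'h::ring_1) hopf \<Rightarrow> ('l, 'm) ring_scheme \<Rightarrow> ('h \<Rightarrow> 'l \<Rightarrow> 'l) \<Rightarrow> bool" where
  "inner_faithful H A act \<longleftrightarrow>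
     (\<forall>I. hopf_ideal H I \<and> I \<noteq> {0} \<longrightarrow> (\<exists>h\<in>I. \<exists>u\<in>carrier A. act h u \<noteq> \<zero>\<^bsub>A\<^esub>))"

text \<open>The existential over fields needs a type for their elements. It is \<open>'l\<close>; a field that is a
  \<open>\<k>\<close>-algebra is, up to isomorphism, the same as a field containing \<open>\<k>\<close>. A field
  containing \<open>\<k>\<close> fits into \<open>'l\<close> only if \<open>'l\<close> is at least as large as \<open>\<k>\<close>, so the definition is
  meant to be used with \<open>'k + 'l'\<close> for an arbitrary \<open>'l'\<close>: these types are never too small
  for \<open>\<k>\<close>, and any field whatsoever is a subset of such a type.\<close>

definition galois_theoretical :: "'l itself \<Rightarrow> ('k::field, 'h::ring_1) hopf \<Rightarrow> bool" where
  "galois_theoretical _ H \<longleftrightarrow>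
     (\<exists>(L :: 'l ring) \<iota> act. field L \<and> module_algebra H L \<iota> act \<and> inner_faithful H L act)"


section \<open>Taft algebras\<close>

text \<open>The free algebra on a set of generators is the free vector space on the words in the
  generators, with concatenation as multiplication of words. The elements
  \<open>translate u r v\<close> below are the products of \<open>r\<close> with words \<open>u\<close> (on the left) and \<open>v\<close> (on the
  right); for a set \<open>R\<close> of relations they span the two-sided ideal generated by \<open>R\<close>.\<close>

definition translate ::
  "'a list \<Rightarrow> ('a list \<Rightarrow>\<^sub>0 'k::field) \<Rightarrow> 'a list \<Rightarrow> ('a list \<Rightarrow>\<^sub>0 'k)" where
  "translate u r v =
     (\<Sum>w\<in>Poly_Mapping.keys r. Poly_Mapping.single (u @ w @ v) (Poly_Mapping.lookup r w))"

definition free_ideal :: "('a list \<Rightarrow>\<^sub>0 'k::field) set \<Rightarrow> ('a list \<Rightarrow>\<^sub>0 'k) set" where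
  "free_ideal R = vs_span fscale {translate u r v | u r v. r \<in> R}"

definition free_eval ::
  "('k::field, 'h::ring_1) hopf \<Rightarrow> ('a \<Rightarrow> 'h) \<Rightarrow> ('a list \<Rightarrow>\<^sub>0 'k) \<Rightarrow> 'h" where
  "free_eval H \<phi> f =
     (\<Sum>w\<in>Poly_Mapping.keys f. scl H (Poly_Mapping.lookup f w) (prod_list (map \<phi> w)))"

text \<open>The subalgebra \<open>K\<close> is generated by the elements \<open>\<phi> a\<close> subject to the relations \<open>R\<close>.\<close>

definition presented_by ::
  "('k::field, 'h::ring_1) hopf \<Rightarrow> 'h set \<Rightarrow> ('a \<Rightarrow> 'h) \<Rightarrow> ('a list \<Rightarrow>\<^sub>0 'k) set \<Rightarrow> bool" where
  "presented_by H K \<phi> R \<longleftrightarrow> range (free_eval H \<phi>) = K \<and> {f. free_eval H \<phi> f = 0} = free_ideal R"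

datatype taft_gen = Gen_g | Gen_x

definition taft_rels :: "nat \<Rightarrow> 'k::field \<Rightarrow> (taft_gen list \<Rightarrow>\<^sub>0 'k) set" where
  "taft_rels n \<zeta> =
     {Poly_Mapping.single (replicate n Gen_g) 1 - Poly_Mapping.single [] 1,
      Poly_Mapping.single (replicate n Gen_x) 1,
      Poly_Mapping.single [Gen_g, Gen_x] 1 - Poly_Mapping.single [Gen_x, Gen_g] \<zeta>}"

definition primitive_root_of_unity :: "nat \<Rightarrow> 'k::field \<Rightarrow> bool" where
  "primitive_root_of_unity n \<zeta> \<longleftrightarrow> \<zeta> ^ n = 1 \<and> (\<forall>j. 0 < j \<and> j < n \<longrightarrow> \<zeta> ^ j \<noteq> 1)"

text \<open>A Hopf subalgebra \<open>K\<close> of \<open>H\<close> is a Taft algebra. The coalgebra structure and the antipode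
  of a Taft algebra are determined by their values on the generators.\<close>

definition is_taft_algebra :: "('k::field, 'h::ring_1) hopf \<Rightarrow> 'h set \<Rightarrow> bool" where
  "is_taft_algebra H K \<longleftrightarrow> hopf_subalgebra H K \<and>
     (\<exists>n \<zeta> g x. n \<ge> 2 \<and> primitive_root_of_unity n \<zeta> \<and> g \<in> grouplikes H \<and> skew_primitive H g 1 x \<and>
        presented_by H K (case_taft_gen g x) (taft_rels n \<zeta>))"

end

theory Submission
  imports Defs
    "HOL-Computational_Algebra.Fraction_Field"
    "HOL-Algebra.Free_Abelian_Groups"
begin

text \<open>
  After a change of \<open>x\<close> by a multiple of \<open>g - 1\<close>, which does not change the Hopf subalgebra
  generated by \<open>g\<close> and \<open>x\<close>, one has \<open>a x = \<chi>(a) x a\<close> for all grouplike \<open>a\<close>, the scalar \<open>q = \<chi>(g)\<close> is a primitive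
  \<open>m\<close>-th root of unity with \<open>m \<ge> 2\<close>, \<open>x\<^sup>m = \<alpha> (g\<^sup>m - 1)\<close>, and the elements \<open>x\<^sup>j a\<close> with \<open>j < m\<close> form a
  basis. Both conditions of the theorem are equivalent to \<open>g\<^sup>m = 1\<close>.

  For the Taft condition this is a comparison of generators: the skew-primitive elements of \<open>H\<close> that
  do not lie in the group algebra \<open>kG\<close> are known, so that a presentation of the Hopf subalgebra as a Taft algebra must
  use \<open>g\<close>, a multiple of \<open>x\<close> modulo \<open>g - 1\<close>, and \<open>q\<close> (\<open>taft_imp_order\<close>, \<open>order_imp_taft\<close>).

  Suppose that \<open>H\<close> acts inner faithfully on a field. Commutativity of the field and
  \<open>x (u v) = (g u) (x v) + (x u) v\<close> force \<open>x\<close> to act as \<open>w (g - 1)\<close> for an element \<open>w\<close> with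
  \<open>g w = q w\<close>. Then \<open>x\<^sup>m\<close> acts as a nonzero multiple of \<open>w\<^sup>m (g\<^sup>m - 1)\<close>. Were \<open>g\<^sup>m \<noteq> 1\<close>, comparison with \<open>\<alpha> (g\<^sup>m - 1)\<close>
  would make \<open>w\<^sup>m\<close>, and hence \<open>w\<close>, a scalar, so that \<open>q w = w\<close> and \<open>x\<close> would act by zero
  (\<open>inner_faithful_imp_order\<close>).

  Suppose conversely that \<open>g\<^sup>m = 1\<close>, so that \<open>x\<^sup>m = 0\<close>. Let \<open>G\<close> act on the rational functions in variables \<open>w\<close> and
  \<open>t\<^sub>a\<close>, for \<open>a\<close> in \<open>G\<close>, by \<open>a w = \<chi>(a) w\<close> and \<open>a t\<^sub>b = t\<^sub>a\<^sub>b\<close>, and let \<open>x\<close> act as \<open>w (g - 1)\<close>. The kernel of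
  this action contains no nonzero Hopf ideal (\<open>inner_faithful_act\<close>).

  The structure of \<open>H\<close> is derived from the definition of the rank. By pointedness the coradical is
  \<open>kG\<close> (\<open>coradical_pointed\<close>). The left coaction of \<open>kG\<close> on \<open>H\<^sub>1 / H\<^sub>0\<close> turns functionals on \<open>H\<close> into functionals on
  \<open>k \<otimes>\<^sub>H\<^sub>0 H\<^sub>1\<close>, a space of dimension two. Hence there is only one skew-primitive element up
  to translation and modulo \<open>kG\<close> (\<open>rank_one_skew_primitives_dependent\<close>). Independence of the \<open>x\<^sup>j a\<close> comes from the
  quantum binomial formula for \<open>\<Delta> (x\<^sup>j a)\<close> (\<open>powers_independent\<close>).

  Tensors are handled through bilinear maps: in finite dimension two tensors are
  equal if all products of two functionals agree on them (\<open>tensor_eqI\<close>). In this way statements about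
  the comultiplication become statements about the convolution of functionals.
\<close>

section \<open>Linear extensions and tensors\<close>

definition lin_ext :: "('k \<Rightarrow> 'v \<Rightarrow> 'v) \<Rightarrow> ('a \<Rightarrow> 'v) \<Rightarrow> ('a \<Rightarrow>\<^sub>0 'k::field) \<Rightarrow> 'v::ab_group_add" where
  "lin_ext s \<phi> f = (\<Sum>p\<in>Poly_Mapping.keys f. s (Poly_Mapping.lookup f p) (\<phi> p))"

lemma fscale_single: "fscale c (Poly_Mapping.single a d) = Poly_Mapping.single a (c * d)"
  by (auto intro!: poly_mapping_eqI simp: lookup_fscale lookup_single when_def)

context vector_space
begin

lemma lin_ext_superset:
  assumes "finite S" "Poly_Mapping.keys f \<subseteq> S"
  shows "lin_ext scale \<phi> f = (\<Sum>p\<in>S. scale (Poly_Mapping.lookup f p) (\<phi> p))"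
  unfolding lin_ext_def
  by (rule sum.mono_neutral_left) (use assms in \<open>auto simp: in_keys_iff\<close>)

lemma lin_ext_add: "lin_ext scale \<phi> (f + h) = lin_ext scale \<phi> f + lin_ext scale \<phi> h"
proof -
  let ?S = "Poly_Mapping.keys f \<union> Poly_Mapping.keys h"
  have "Poly_Mapping.keys (f + h) \<subseteq> ?S"
    by (rule keys_add)
  then show ?thesis
    by (simp add: lin_ext_superset[where S = ?S] lookup_add scale_left_distrib sum.distrib)
qed

lemma lin_ext_scale: "lin_ext scale \<phi> (fscale c f) = scale c (lin_ext scale \<phi> f)"
proof -
  have "Poly_Mapping.keys (fscale c f) \<subseteq> Poly_Mapping.keys f"
    by (auto simp: in_keys_iff lookup_fscale)
  then show ?thesis
    by (simp add: lin_ext_superset[where S = "Poly_Mapping.keys f"] lookup_fscale scale_sum_right)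
qed

lemma lin_ext_single [simp]: "lin_ext scale \<phi> (Poly_Mapping.single a c) = scale c (\<phi> a)"
  by (subst lin_ext_superset[where S = "{a}"]) (auto simp: in_keys_iff lookup_single when_def)

lemma linear_lin_ext: "Vector_Spaces.linear fscale scale (lin_ext scale \<phi>)"
  by (auto simp: Vector_Spaces.linear_iff lin_ext_add lin_ext_scale vector_space_axioms vector_space_fscale)

lemma lin_ext_zero [simp]: "lin_ext scale \<phi> 0 = 0"
  by (simp add: lin_ext_def)

lemma lin_ext_diff: "lin_ext scale \<phi> (f - h) = lin_ext scale \<phi> f - lin_ext scale \<phi> h"
  using lin_ext_add[of \<phi> "f - h" h] by (simp add: algebra_simps)

lemma lin_ext_formal_sum [simp]: "lin_ext scale \<phi> (formal_sum ps) = (\<Sum>p\<leftarrow>ps. \<phi> p)"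
  by (induction ps) (auto simp: formal_sum_def lin_ext_add)

lemma lin_ext_vanishes_on_span:
  assumes "\<And>r. r \<in> R \<Longrightarrow> lin_ext scale \<phi> r = 0" "f \<in> vs_span fscale R"
  shows "lin_ext scale \<phi> f = 0"
  using assms(2)
proof (induction rule: fvs.span_induct_alt)
  case (step c x y)
  then show ?case
    by (simp add: lin_ext_add lin_ext_scale assms(1))
qed simp

text \<open>A bilinear map extends linearly to the free vector space on pairs and kills the bilinear
  relations, so that its value on a tensor does not depend on the representing list.\<close>

lemma tensor_eq_imp_bilinear_eq:
  assumes eq: "tensor_eq s V t W ps qs"
    and "\<And>v v' w. v \<in> V \<Longrightarrow> v' \<in> V \<Longrightarrow> w \<in> W \<Longrightarrow> \<beta> (v + v', w) = \<beta> (v, w) + \<beta> (v', w)"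
    and "\<And>v w w'. v \<in> V \<Longrightarrow> w \<in> W \<Longrightarrow> w' \<in> W \<Longrightarrow> \<beta> (v, w + w') = \<beta> (v, w) + \<beta> (v, w')"
    and "\<And>c v w. v \<in> V \<Longrightarrow> w \<in> W \<Longrightarrow> \<beta> (s c v, w) = scale c (\<beta> (v, w))"
    and "\<And>c v w. v \<in> V \<Longrightarrow> w \<in> W \<Longrightarrow> \<beta> (v, t c w) = scale c (\<beta> (v, w))"
  shows "(\<Sum>p\<leftarrow>ps. \<beta> p) = (\<Sum>p\<leftarrow>qs. \<beta> p)"
proof -
  have "lin_ext scale \<beta> (formal_sum ps - formal_sum qs) = 0"
    using _ eq[unfolded tensor_eq_def]
    by (rule lin_ext_vanishes_on_span)
      (auto simp: bilinear_rels_def lin_ext_diff assms)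
  then show ?thesis
    by (simp add: lin_ext_diff)
qed

lemma tensor3_eq_imp_trilinear_eq:
  assumes eq: "tensor3_eq s V t W r Z ps qs"
    and "\<And>v v' w z. v \<in> V \<Longrightarrow> v' \<in> V \<Longrightarrow> w \<in> W \<Longrightarrow> z \<in> Z \<Longrightarrow> \<beta> (v + v', w, z) = \<beta> (v, w, z) + \<beta> (v', w, z)"
    and "\<And>v w w' z. v \<in> V \<Longrightarrow> w \<in> W \<Longrightarrow> w' \<in> W \<Longrightarrow> z \<in> Z \<Longrightarrow> \<beta> (v, w + w', z) = \<beta> (v, w, z) + \<beta> (v, w', z)"
    and "\<And>v w z z'. v \<in> V \<Longrightarrow> w \<in> W \<Longrightarrow> z \<in> Z \<Longrightarrow> z' \<in> Z \<Longrightarrow> \<beta> (v, w, z + z') = \<beta> (v, w, z) + \<beta> (v, w, z')"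
    and "\<And>c v w z. v \<in> V \<Longrightarrow> w \<in> W \<Longrightarrow> z \<in> Z \<Longrightarrow> \<beta> (s c v, w, z) = scale c (\<beta> (v, w, z))"
    and "\<And>c v w z. v \<in> V \<Longrightarrow> w \<in> W \<Longrightarrow> z \<in> Z \<Longrightarrow> \<beta> (v, t c w, z) = scale c (\<beta> (v, w, z))"
    and "\<And>c v w z. v \<in> V \<Longrightarrow> w \<in> W \<Longrightarrow> z \<in> Z \<Longrightarrow> \<beta> (v, w, r c z) = scale c (\<beta> (v, w, z))"
  shows "(\<Sum>p\<leftarrow>ps. \<beta> p) = (\<Sum>p\<leftarrow>qs. \<beta> p)"
proof -
  have "lin_ext scale \<beta> (formal_sum ps - formal_sum qs) = 0"
    using _ eq[unfolded tensor3_eq_def]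
    by (rule lin_ext_vanishes_on_span)
      (auto simp: trilinear_rels_def lin_ext_diff assms)
  then show ?thesis
    by (simp add: lin_ext_diff)
qed

end

lemma vector_space_times: "vector_space ((*) :: 'k::field \<Rightarrow> 'k \<Rightarrow> 'k)"
  by unfold_locales (auto simp: algebra_simps)

interpretation scalars: vector_space "(*) :: 'k::field \<Rightarrow> 'k \<Rightarrow> 'k"
  by (rule vector_space_times)

declare scalars.scale_scale [simp del]

abbreviation functional :: "('k::field \<Rightarrow> 'v::ab_group_add \<Rightarrow> 'v) \<Rightarrow> ('v \<Rightarrow> 'k) \<Rightarrow> bool" where
  "functional s f \<equiv> Vector_Spaces.linear s (*) f"

lemma sum_list_concat_map:
  "(\<Sum>p\<leftarrow>concat (map f xs). g p) = (\<Sum>x\<leftarrow>xs. \<Sum>p\<leftarrow>f x. g (p :: 'p) :: 'q::monoid_add)"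
  by (induction xs) auto

lemma sum_list_swap_sum:
  "(\<Sum>x\<leftarrow>xs. \<Sum>i\<in>I. f x i) = (\<Sum>i\<in>I. \<Sum>x\<leftarrow>xs. f x i :: 'a::comm_monoid_add)"
  by (induction xs) (auto simp: sum.distrib)

context vector_space
begin

lemma functionalD:
  assumes "functional scale f"
  shows "f (a + b) = f a + f b" "f (scale c a) = c * f a" "f 0 = 0" "f (a - b) = f a - f b"
    "f (- a) = - f a" "f (sum h A) = (\<Sum>i\<in>A. f (h i))" "f (sum_list xs) = (\<Sum>x\<leftarrow>xs. f x)"
proof -
  interpret Vector_Spaces.linear scale "(*)" f
    by (rule assms)
  show "f (a + b) = f a + f b" "f (scale c a) = c * f a" "f 0 = 0" "f (a - b) = f a - f b"
    "f (- a) = - f a" "f (sum h A) = (\<Sum>i\<in>A. f (h i))"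
    by (simp_all add: add scale diff neg sum zero)
  show "f (sum_list xs) = (\<Sum>x\<leftarrow>xs. f x)"
    by (induction xs) (simp_all add: add zero)
qed

lemma functionalI:
  assumes "\<And>a b. f (a + b) = f a + f b" "\<And>c a. f (scale c a) = c * f a"
  shows "functional scale f"
  using assms by (auto simp: Vector_Spaces.linear_iff vector_space_axioms vector_space_times)

lemma functional_extend:
  assumes "independent B"
  shows "\<exists>f. functional scale f \<and> (\<forall>b\<in>B. f b = h b)"
proof -
  interpret vector_space_pair scale "(*)"
    by unfold_locales
  show ?thesis
    using linear_independent_extend[OF assms] by blast
qed

lemma separating_functional:
  assumes "y \<notin> span S"
  shows "\<exists>f. functional scale f \<and> (\<forall>b\<in>span S. f b = 0) \<and> f y = 1"
proof -
  obtain B where B: "B \<subseteq> span S" "independent B" "span S \<subseteq> span B"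
    using maximal_independent_subset[of "span S"] by blast
  have sp: "span B = span S"
    using B by (metis span_minimal subspace_span subset_antisym)
  have "independent (insert y B)"
    using assms B(2) sp by (simp add: independent_insertI)
  then obtain f where f: "functional scale f" "\<forall>b\<in>insert y B. f b = (if b = y then 1 else 0)"
    using functional_extend[where h = "\<lambda>b. if b = y then 1 else 0"] by blast
  have "f b = 0" if "b \<in> span B" for b
    using that
  proof (induction rule: span_induct_alt)
    case (step c x z)
    moreover have "x \<noteq> y"
      using step(1) B(1) assms by auto
    ultimately show ?case
      using f by (simp add: functionalD)
  qed (simp add: functionalD f)
  then show ?thesis
    using f sp by auto
qed

lemma functionals_separate: "(\<And>f. functional scale f \<Longrightarrow> f a = f b) \<Longrightarrow> a = b"
proof (rule ccontr)
  assume eq: "\<And>f. functional scale f \<Longrightarrow> f a = f b" and "a \<noteq> b"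
  then have "a - b \<notin> span {}"
    by simp
  from separating_functional[OF this] obtain f where "functional scale f" "f (a - b) = 1"
    by blast
  then show False
    using eq[of f] by (simp add: functionalD)
qed

lemma dual_family:
  assumes "finite I" and ind: "\<And>c. (\<Sum>i\<in>I. scale (c i) (v i)) = 0 \<Longrightarrow> \<forall>i\<in>I. c i = 0" and "i \<in> I"
  shows "\<exists>f. functional scale f \<and> (\<forall>j\<in>I. f (v j) = (if j = i then 1 else 0))"
proof -
  have fin: "finite (v ` (I - {i}))"
    using assms(1) by simp
  have "v i \<notin> span (v ` (I - {i}))"
  proof
    assume "v i \<in> span (v ` (I - {i}))"
    then obtain r where r: "v i = (\<Sum>a\<in>v ` (I - {i}). scale (r a) a)"
      unfolding span_finite[OF fin] by blast
    obtain T where T: "T \<subseteq> I - {i}" "inj_on v T" "v ` (I - {i}) = v ` T"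
      using subset_image_inj[of "v ` (I - {i})" v "I - {i}"] by auto
    from r T have "v i = (\<Sum>j\<in>T. scale (r (v j)) (v j))"
      by (simp add: sum.reindex)
    also have "\<dots> = (\<Sum>j\<in>I - {i}. scale (if j \<in> T then r (v j) else 0) (v j))"
      using T(1) assms(1) by (intro sum.mono_neutral_cong_left) auto
    finally have "(\<Sum>j\<in>I. scale (if j = i then - 1 else if j \<in> T then r (v j) else 0) (v j)) = 0"
      using assms(1,3) by (simp add: sum.remove[of I i])
    then show False
      using ind[of "\<lambda>j. if j = i then - 1 else if j \<in> T then r (v j) else 0"] assms(3) by auto
  qed
  from separating_functional[OF this] obtain f where f: "functional scale f"
      "\<And>b. b \<in> span (v ` (I - {i})) \<Longrightarrow> f b = 0" "f (v i) = 1"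
    by blast
  have "f (v j) = (if j = i then 1 else 0)" if "j \<in> I" for j
    using f(2)[OF span_base] f(3) that by auto
  with f(1) show ?thesis
    by blast
qed

lemma finite_basis_coordinates:
  assumes "subspace V" "finite C" "span C = UNIV"
  obtains B e where "finite B" "B \<subseteq> V" "\<And>b. functional scale (e b)"
    "\<And>v. v \<in> V \<Longrightarrow> v = (\<Sum>b\<in>B. scale (e b v) b)"
proof -
  obtain B where B: "B \<subseteq> V" "independent B" "V \<subseteq> span B"
    using maximal_independent_subset[of V] by blast
  have fin: "finite B"
    using independent_span_bound[OF assms(2) B(2)] assms(3) by simp
  have "\<forall>b. \<exists>f. functional scale f \<and> (\<forall>a\<in>B. f a = (if a = b then 1 else 0))"
    by (intro allI functional_extend B(2))
  then obtain e where e: "\<And>b. functional scale (e b)" "\<And>a b. a \<in> B \<Longrightarrow> e b a = (if a = b then 1 else 0)"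
    by metis
  have "v = (\<Sum>b\<in>B. scale (e b v) b)" if "v \<in> V" for v
  proof -
    have "v \<in> span B"
      using that B by auto
    then show ?thesis
    proof (induction rule: span_induct_alt)
      case base
      then show ?case by (simp add: functionalD e)
    next
      case (step c x y)
      have "(\<Sum>b\<in>B. scale (e b (scale c x + y)) b) = scale c (\<Sum>b\<in>B. scale (e b x) b) + (\<Sum>b\<in>B. scale (e b y) b)"
        by (simp add: functionalD[OF e(1)] scale_left_distrib sum.distrib scale_sum_right)
      also have "(\<Sum>b\<in>B. scale (e b x) b) = (\<Sum>b\<in>B. if b = x then x else 0)"
        using step(1) by (intro sum.cong) (auto simp: e)
      also have "\<dots> = x"
        using step(1) fin by simp
      finally show ?case
        using step.IH by simp
    qed
  qed
  then show ?thesis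
    using that fin B(1) e(1) by blast
qed

end

text \<open>For fixed \<open>w\<close> the map \<open>v \<mapsto> (v, w)\<close> into the free vector space on pairs is linear only modulo the
  bilinear relations. This suffices to expand a pure tensor along bases, one factor at a time.\<close>

lemma linear_modulo_sum:
  fixes s :: "'k::field \<Rightarrow> 'v::ab_group_add \<Rightarrow> 'v" and \<phi> :: "'v \<Rightarrow> ('a \<Rightarrow>\<^sub>0 'k)"
  assumes "vector_space s" "vs_subspace s V" "vs_subspace fscale U"
    and add: "\<And>v w. v \<in> V \<Longrightarrow> w \<in> V \<Longrightarrow> \<phi> (v + w) - \<phi> v - \<phi> w \<in> U"
    and scl: "\<And>c v. v \<in> V \<Longrightarrow> \<phi> (s c v) - fscale c (\<phi> v) \<in> U"
    and B: "finite B" "B \<subseteq> V"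
  shows "\<phi> (\<Sum>b\<in>B. s (c b) b) - (\<Sum>b\<in>B. fscale (c b) (\<phi> b)) \<in> U"
proof -
  interpret v: vector_space s by fact
  show ?thesis
    using B
  proof (induction B rule: finite_induct)
    case empty
    have "0 \<in> V"
      using assms(2) by (rule v.subspace_0)
    from add[OF this this] have "- \<phi> 0 \<in> U"
      by simp
    then show ?case
      using fvs.subspace_neg[OF assms(3)] by fastforce
  next
    case (insert b B)
    let ?v = "\<Sum>b\<in>B. s (c b) b"
    have "?v \<in> V" "s (c b) b \<in> V"
      using insert(4) assms(2) by (auto intro!: v.subspace_sum v.subspace_scale)
    then have "(\<phi> (s (c b) b + ?v) - \<phi> (s (c b) b) - \<phi> ?v) + (\<phi> (s (c b) b) - fscale (c b) (\<phi> b))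
        + (\<phi> ?v - (\<Sum>b\<in>B. fscale (c b) (\<phi> b))) \<in> U"
      using insert add scl by (intro fvs.subspace_add[OF assms(3)]) auto
    then show ?case
      using insert(1,2) by (simp add: algebra_simps)
  qed
qed

text \<open>Here \<open>E i\<close> stands for a basis of the quotient by \<open>U\<close> and \<open>c p i\<close> for the coordinates of
  the generator \<open>p\<close> of the free vector space.\<close>

lemma congruent_formal_sums:
  assumes U: "vs_subspace fscale U"
    and red: "\<And>p. p \<in> set ps \<union> set qs \<Longrightarrow> Poly_Mapping.single p 1 - (\<Sum>i\<in>I. fscale (c p i) (E i)) \<in> U"
    and eq: "\<And>i. i \<in> I \<Longrightarrow> (\<Sum>p\<leftarrow>ps. c p i) = (\<Sum>p\<leftarrow>qs. c p i)"
  shows "formal_sum ps - formal_sum qs \<in> (U :: ('a \<Rightarrow>\<^sub>0 'k::field) set)"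
proof -
  have *: "formal_sum rs - (\<Sum>i\<in>I. fscale (\<Sum>p\<leftarrow>rs. c p i) (E i)) \<in> U" if "set rs \<subseteq> set ps \<union> set qs" for rs
    using that
  proof (induction rs)
    case Nil
    then show ?case
      using fvs.subspace_0[OF U] by (simp add: formal_sum_def)
  next
    case (Cons p rs)
    then have "(Poly_Mapping.single p 1 - (\<Sum>i\<in>I. fscale (c p i) (E i))) +
        (formal_sum rs - (\<Sum>i\<in>I. fscale (\<Sum>p\<leftarrow>rs. c p i) (E i))) \<in> U"
      using red by (intro fvs.subspace_add[OF U]) auto
    then show ?case
      by (simp add: formal_sum_def fvs.scale_left_distrib sum.distrib algebra_simps)
  qed
  have "(formal_sum ps - (\<Sum>i\<in>I. fscale (\<Sum>p\<leftarrow>ps. c p i) (E i))) -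
      (formal_sum qs - (\<Sum>i\<in>I. fscale (\<Sum>p\<leftarrow>qs. c p i) (E i))) \<in> U"
    by (intro fvs.subspace_diff[OF U] *) auto
  then show ?thesis
    using eq by simp
qed

lemma mem_cong_trans: "vs_subspace fscale U \<Longrightarrow> a - b \<in> U \<Longrightarrow> b - c \<in> U \<Longrightarrow> a - c \<in> (U :: ('a \<Rightarrow>\<^sub>0 'k::field) set)"
  using fvs.subspace_add[of U "a - b" "b - c"] by simp

lemma mem_cong_sum:
  assumes "vs_subspace fscale U" "\<And>i. i \<in> I \<Longrightarrow> a i - b i \<in> U"
  shows "(\<Sum>i\<in>I. fscale (c i) (a i)) - (\<Sum>i\<in>I. fscale (c i) (b i)) \<in> (U :: ('a \<Rightarrow>\<^sub>0 'k::field) set)"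
proof -
  have "(\<Sum>i\<in>I. fscale (c i) (a i - b i)) \<in> U"
    using assms by (intro fvs.subspace_sum fvs.subspace_scale) auto
  then show ?thesis
    by (simp add: fvs.scale_right_diff_distrib sum_subtractf)
qed

lemma bilinear_relsI:
  shows "v \<in> V \<Longrightarrow> v' \<in> V \<Longrightarrow> w \<in> W \<Longrightarrow> Poly_Mapping.single (v + v', w) 1 - Poly_Mapping.single (v, w) 1
        - Poly_Mapping.single (v', w) 1 \<in> bilinear_rels s V t W"
    and "v \<in> V \<Longrightarrow> w \<in> W \<Longrightarrow> w' \<in> W \<Longrightarrow> Poly_Mapping.single (v, w + w') 1 - Poly_Mapping.single (v, w) 1
        - Poly_Mapping.single (v, w') 1 \<in> bilinear_rels s V t W"
    and "v \<in> V \<Longrightarrow> w \<in> W \<Longrightarrow> Poly_Mapping.single (s c v, w) 1 - Poly_Mapping.single (v, w) c \<in> bilinear_rels s V t W"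
    and "v \<in> V \<Longrightarrow> w \<in> W \<Longrightarrow> Poly_Mapping.single (v, t c w) 1 - Poly_Mapping.single (v, w) c \<in> bilinear_rels s V t W"
  unfolding bilinear_rels_def by blast+

lemma trilinear_relsI:
  shows "v \<in> V \<Longrightarrow> v' \<in> V \<Longrightarrow> w \<in> W \<Longrightarrow> z \<in> Z \<Longrightarrow> Poly_Mapping.single (v + v', w, z) 1
        - Poly_Mapping.single (v, w, z) 1 - Poly_Mapping.single (v', w, z) 1 \<in> trilinear_rels s V t W r Z"
    and "v \<in> V \<Longrightarrow> w \<in> W \<Longrightarrow> w' \<in> W \<Longrightarrow> z \<in> Z \<Longrightarrow> Poly_Mapping.single (v, w + w', z) 1
        - Poly_Mapping.single (v, w, z) 1 - Poly_Mapping.single (v, w', z) 1 \<in> trilinear_rels s V t W r Z"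
    and "v \<in> V \<Longrightarrow> w \<in> W \<Longrightarrow> z \<in> Z \<Longrightarrow> z' \<in> Z \<Longrightarrow> Poly_Mapping.single (v, w, z + z') 1
        - Poly_Mapping.single (v, w, z) 1 - Poly_Mapping.single (v, w, z') 1 \<in> trilinear_rels s V t W r Z"
    and "v \<in> V \<Longrightarrow> w \<in> W \<Longrightarrow> z \<in> Z \<Longrightarrow> Poly_Mapping.single (s c v, w, z) 1
        - Poly_Mapping.single (v, w, z) c \<in> trilinear_rels s V t W r Z"
    and "v \<in> V \<Longrightarrow> w \<in> W \<Longrightarrow> z \<in> Z \<Longrightarrow> Poly_Mapping.single (v, t c w, z) 1
        - Poly_Mapping.single (v, w, z) c \<in> trilinear_rels s V t W r Z"
    and "v \<in> V \<Longrightarrow> w \<in> W \<Longrightarrow> z \<in> Z \<Longrightarrow> Poly_Mapping.single (v, w, r c z) 1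
        - Poly_Mapping.single (v, w, z) c \<in> trilinear_rels s V t W r Z"
  unfolding trilinear_rels_def
       apply (rule UnI1, rule UnI1, rule UnI1, rule UnI1, rule UnI1, blast)
       apply (rule UnI1, rule UnI1, rule UnI1, rule UnI1, rule UnI2, blast)
       apply (rule UnI1, rule UnI1, rule UnI1, rule UnI2, blast)
       apply (rule UnI1, rule UnI1, rule UnI2, blast)
       apply (rule UnI1, rule UnI2, blast)
       apply (rule UnI2, blast)
  done

text \<open>After expansion along bases a tensor is given by its coordinates, which are values of products
  of two functionals. The first factor is allowed to range over a subspace because the
  comodules in question are subspaces of the Hopf algebra.\<close>

lemma tensor_eqI:
  fixes s :: "'k::field \<Rightarrow> 'v::ab_group_add \<Rightarrow> 'v" and t :: "'k \<Rightarrow> 'w::ab_group_add \<Rightarrow> 'w"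
  assumes "vector_space s" "finite C" "vs_span s C = UNIV"
    and "vector_space t" "finite D" "vs_span t D = UNIV"
    and V: "vs_subspace s V"
    and mem: "set ps \<subseteq> V \<times> UNIV" "set qs \<subseteq> V \<times> UNIV"
    and eq: "\<And>f h. functional s f \<Longrightarrow> functional t h \<Longrightarrow>
      (\<Sum>(v, w)\<leftarrow>ps. f v * h w) = (\<Sum>(v, w)\<leftarrow>qs. f v * h w)"
  shows "tensor_eq s V t UNIV ps qs"
proof -
  interpret v: vector_space s by fact
  interpret w: vector_space t by fact
  obtain B e where B: "finite B" "B \<subseteq> V" "\<And>b. functional s (e b)"
      "\<And>v. v \<in> V \<Longrightarrow> v = (\<Sum>b\<in>B. s (e b v) b)"
    using v.finite_basis_coordinates[OF V assms(2,3)] by blast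
  obtain B' e' where B': "finite B'" "\<And>b. functional t (e' b)" "\<And>w. w = (\<Sum>b\<in>B'. t (e' b w) b)"
    using w.finite_basis_coordinates[OF w.subspace_UNIV assms(5,6)] by (metis UNIV_I)
  let ?U = "vs_span fscale (bilinear_rels s V t UNIV)"
  let ?S = "\<lambda>p. Poly_Mapping.single p (1::'k)"
  have U: "vs_subspace fscale ?U"
    by (rule fvs.subspace_span)
  show ?thesis
    unfolding tensor_eq_def
  proof (rule congruent_formal_sums[OF U, where I = "B \<times> B'"
        and c = "\<lambda>(v, w) (b, b'). e b v * e' b' w" and E = ?S])
    fix p assume "p \<in> set ps \<union> set qs"
    then obtain v w where p: "p = (v, w)" and v: "v \<in> V"
      using mem by fastforce
    have "?S (\<Sum>b\<in>B. s (e b v) b, w) - (\<Sum>b\<in>B. fscale (e b v) (?S (b, w))) \<in> ?U"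
      by (rule linear_modulo_sum[where \<phi> = "\<lambda>v. ?S (v, w)" and V = V])
        (use assms(1) V U B(1,2) in \<open>auto simp: fscale_single intro!: fvs.span_base bilinear_relsI\<close>)
    then have 1: "?S (v, w) - (\<Sum>b\<in>B. fscale (e b v) (?S (b, w))) \<in> ?U"
      using B(4)[OF v] by simp
    have 2: "?S (b, w) - (\<Sum>b'\<in>B'. fscale (e' b' w) (?S (b, b'))) \<in> ?U" if "b \<in> B" for b
    proof -
      have "?S (b, \<Sum>b'\<in>B'. t (e' b' w) b') - (\<Sum>b'\<in>B'. fscale (e' b' w) (?S (b, b'))) \<in> ?U"
        by (rule linear_modulo_sum[where \<phi> = "\<lambda>w. ?S (b, w)" and V = UNIV])
          (use assms(4) U B'(1) B(2) that in \<open>auto simp: fscale_single intro!: fvs.span_base bilinear_relsI\<close>)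
      then show ?thesis
        using B'(3)[of w] by simp
    qed
    have "?S (v, w) - (\<Sum>b\<in>B. fscale (e b v) (\<Sum>b'\<in>B'. fscale (e' b' w) (?S (b, b')))) \<in> ?U"
      by (rule mem_cong_trans[OF U 1 mem_cong_sum[OF U 2]])
    then show "?S p - (\<Sum>i\<in>B \<times> B'. fscale ((case p of (v, w) \<Rightarrow> \<lambda>(b, b'). e b v * e' b' w) i) (?S i)) \<in> ?U"
      by (simp add: p sum.cartesian_product fvs.scale_sum_right case_prod_unfold)
  next
    fix i assume "i \<in> B \<times> B'"
    then show "(\<Sum>p\<leftarrow>ps. (case p of (v, w) \<Rightarrow> \<lambda>(b, b'). e b v * e' b' w) i) =
        (\<Sum>p\<leftarrow>qs. (case p of (v, w) \<Rightarrow> \<lambda>(b, b'). e b v * e' b' w) i)"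
      using eq[OF B(3)[of "fst i"] B'(2)[of "snd i"]] by (simp add: case_prod_unfold)
  qed
qed

lemma tensor3_eqI:
  fixes s :: "'k::field \<Rightarrow> 'v::ab_group_add \<Rightarrow> 'v" and t :: "'k \<Rightarrow> 'w::ab_group_add \<Rightarrow> 'w"
    and r :: "'k \<Rightarrow> 'z::ab_group_add \<Rightarrow> 'z"
  assumes "vector_space s" "finite C" "vs_span s C = UNIV"
    and "vector_space t" "finite D" "vs_span t D = UNIV"
    and "vector_space r" "finite F" "vs_span r F = UNIV"
    and V: "vs_subspace s V"
    and mem: "set ps \<subseteq> V \<times> UNIV" "set qs \<subseteq> V \<times> UNIV"
    and eq: "\<And>f h l. functional s f \<Longrightarrow> functional t h \<Longrightarrow> functional r l \<Longrightarrow>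
      (\<Sum>(v, w, z)\<leftarrow>ps. f v * (h w * l z)) = (\<Sum>(v, w, z)\<leftarrow>qs. f v * (h w * l z))"
  shows "tensor3_eq s V t UNIV r UNIV ps qs"
proof -
  interpret v: vector_space s by fact
  interpret w: vector_space t by fact
  interpret z: vector_space r by fact
  obtain B e where B: "finite B" "B \<subseteq> V" "\<And>b. functional s (e b)"
      "\<And>v. v \<in> V \<Longrightarrow> v = (\<Sum>b\<in>B. s (e b v) b)"
    using v.finite_basis_coordinates[OF V assms(2,3)] by blast
  obtain B' e' where B': "finite B'" "\<And>b. functional t (e' b)" "\<And>w. w = (\<Sum>b\<in>B'. t (e' b w) b)"
    using w.finite_basis_coordinates[OF w.subspace_UNIV assms(5,6)] by (metis UNIV_I)
  obtain B2 e2 where B2: "finite B2" "\<And>b. functional r (e2 b)" "\<And>w. w = (\<Sum>b\<in>B2. r (e2 b w) b)"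
    using z.finite_basis_coordinates[OF z.subspace_UNIV assms(8,9)] by (metis UNIV_I)
  let ?U = "vs_span fscale (trilinear_rels s V t UNIV r UNIV)"
  let ?S = "\<lambda>p. Poly_Mapping.single p (1::'k)"
  have U: "vs_subspace fscale ?U"
    by (rule fvs.subspace_span)
  show ?thesis
    unfolding tensor3_eq_def
  proof (rule congruent_formal_sums[OF U, where I = "B \<times> B' \<times> B2"
        and c = "\<lambda>(v, w, z) (b, b', b2). e b v * (e' b' w * e2 b2 z)" and E = ?S])
    fix p assume "p \<in> set ps \<union> set qs"
    then obtain v w z where p: "p = (v, w, z)" and v: "v \<in> V"
      using mem by fastforce
    have "?S (\<Sum>b\<in>B. s (e b v) b, w, z) - (\<Sum>b\<in>B. fscale (e b v) (?S (b, w, z))) \<in> ?U"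
      by (rule linear_modulo_sum[where \<phi> = "\<lambda>v. ?S (v, w, z)" and V = V])
        (use assms(1) V U B(1,2) in \<open>auto simp: fscale_single intro!: fvs.span_base trilinear_relsI\<close>)
    then have 1: "?S (v, w, z) - (\<Sum>b\<in>B. fscale (e b v) (?S (b, w, z))) \<in> ?U"
      using B(4)[OF v] by simp
    have 2: "?S (b, w, z) - (\<Sum>b'\<in>B'. fscale (e' b' w) (?S (b, b', z))) \<in> ?U" if "b \<in> B" for b
    proof -
      have "?S (b, \<Sum>b'\<in>B'. t (e' b' w) b', z) - (\<Sum>b'\<in>B'. fscale (e' b' w) (?S (b, b', z))) \<in> ?U"
        by (rule linear_modulo_sum[where \<phi> = "\<lambda>w. ?S (b, w, z)" and V = UNIV])
          (use assms(4) U B'(1) B(2) that in \<open>auto simp: fscale_single intro!: fvs.span_base trilinear_relsI\<close>)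
      then show ?thesis
        using B'(3)[of w] by simp
    qed
    have 3: "?S (b, b', z) - (\<Sum>b2\<in>B2. fscale (e2 b2 z) (?S (b, b', b2))) \<in> ?U" if "b \<in> B" for b b'
    proof -
      have "?S (b, b', \<Sum>b2\<in>B2. r (e2 b2 z) b2) - (\<Sum>b2\<in>B2. fscale (e2 b2 z) (?S (b, b', b2))) \<in> ?U"
        by (rule linear_modulo_sum[where \<phi> = "\<lambda>z. ?S (b, b', z)" and V = UNIV])
          (use assms(7) U B2(1) B(2) that in \<open>auto simp: fscale_single intro!: fvs.span_base trilinear_relsI\<close>)
      then show ?thesis
        using B2(3)[of z] by simp
    qed
    have "?S (b, w, z) - (\<Sum>b'\<in>B'. fscale (e' b' w) (\<Sum>b2\<in>B2. fscale (e2 b2 z) (?S (b, b', b2)))) \<in> ?U"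
      if "b \<in> B" for b
      by (rule mem_cong_trans[OF U 2[OF that] mem_cong_sum[OF U 3[OF that]]])
    note 4 = this
    have "?S (v, w, z) - (\<Sum>b\<in>B. fscale (e b v)
        (\<Sum>b'\<in>B'. fscale (e' b' w) (\<Sum>b2\<in>B2. fscale (e2 b2 z) (?S (b, b', b2))))) \<in> ?U"
      by (rule mem_cong_trans[OF U 1 mem_cong_sum[OF U 4]])
    then show "?S p - (\<Sum>i\<in>B \<times> B' \<times> B2.
        fscale ((case p of (v, w, z) \<Rightarrow> \<lambda>(b, b', b2). e b v * (e' b' w * e2 b2 z)) i) (?S i)) \<in> ?U"
      by (simp add: p sum.cartesian_product fvs.scale_sum_right case_prod_unfold)
  next
    fix i assume "i \<in> B \<times> B' \<times> B2"
    then show "(\<Sum>p\<leftarrow>ps. (case p of (v, w, z) \<Rightarrow> \<lambda>(b, b', b2). e b v * (e' b' w * e2 b2 z)) i) =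
        (\<Sum>p\<leftarrow>qs. (case p of (v, w, z) \<Rightarrow> \<lambda>(b, b', b2). e b v * (e' b' w * e2 b2 z)) i)"
      using eq[OF B(3)[of "fst i"] B'(2)[of "fst (snd i)"] B2(2)[of "snd (snd i)"]] by (simp add: case_prod_unfold)
  qed
qed

section \<open>Comultiplication through bilinear maps\<close>

definition bilinear_on_pairs ::
  "('k::field \<Rightarrow> 'h::ab_group_add \<Rightarrow> 'h) \<Rightarrow> ('k \<Rightarrow> 'u::ab_group_add \<Rightarrow> 'u) \<Rightarrow> ('h \<Rightarrow> 'h \<Rightarrow> 'u) \<Rightarrow> bool" where
  "bilinear_on_pairs s t \<beta> \<longleftrightarrow>
     (\<forall>u v w. \<beta> (u + v) w = \<beta> u w + \<beta> v w) \<and> (\<forall>u v w. \<beta> u (v + w) = \<beta> u v + \<beta> u w) \<and>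
     (\<forall>c u v. \<beta> (s c u) v = t c (\<beta> u v)) \<and> (\<forall>c u v. \<beta> u (s c v) = t c (\<beta> u v))"

definition trilinear_on_triples ::
  "('k::field \<Rightarrow> 'h::ab_group_add \<Rightarrow> 'h) \<Rightarrow> ('k \<Rightarrow> 'u::ab_group_add \<Rightarrow> 'u) \<Rightarrow> ('h \<Rightarrow> 'h \<Rightarrow> 'h \<Rightarrow> 'u) \<Rightarrow> bool" where
  "trilinear_on_triples s t \<tau> \<longleftrightarrow>
     (\<forall>w. bilinear_on_pairs s t (\<lambda>u v. \<tau> u v w)) \<and> (\<forall>u. bilinear_on_pairs s t (\<tau> u))"

lemma sum_list_swap:
  "(\<Sum>x\<leftarrow>xs. \<Sum>y\<leftarrow>ys. f x y) = (\<Sum>y\<leftarrow>ys. \<Sum>x\<leftarrow>xs. f x y :: 'a::comm_monoid_add)"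
  by (induction xs) (simp_all add: sum_list_addf)

sublocale hopf_algebra \<subseteq> hv: vector_space "scl H"
  by (rule vs)

context hopf_algebra
begin

abbreviation hopf_scale (infixr "\<cdot>" 75) where
  "c \<cdot> a \<equiv> scl H c a"

abbreviation counit_map ("\<epsilon>") where
  "\<epsilon> \<equiv> counit H"

abbreviation antipode_map ("\<S>") where
  "\<S> \<equiv> antipode H"

abbreviation functional_on where
  "functional_on f \<equiv> functional (scl H) f"

abbreviation G where
  "G \<equiv> grouplikes H"

text \<open>The value of the bilinear map \<open>\<beta>\<close> on the tensor \<open>\<Delta> a\<close>.\<close>

definition comult_sum :: "('h \<Rightarrow> 'h \<Rightarrow> 'u) \<Rightarrow> 'h \<Rightarrow> 'u::ab_group_add" where
  "comult_sum \<beta> a = (\<Sum>(a1, a2)\<leftarrow>comult H a. \<beta> a1 a2)"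

abbreviation bilin where
  "bilin t \<beta> \<equiv> bilinear_on_pairs (scl H) t \<beta>"

abbreviation trilin where
  "trilin t \<tau> \<equiv> trilinear_on_triples (scl H) t \<tau>"

lemma heq_imp_bilin_eq:
  assumes "vector_space t" "bilin t \<beta>" "heq H ps qs"
  shows "(\<Sum>(a, b)\<leftarrow>ps. \<beta> a b) = (\<Sum>(a, b)\<leftarrow>qs. \<beta> a b)"
proof -
  interpret t: vector_space t by fact
  show ?thesis
    by (rule t.tensor_eq_imp_bilinear_eq[OF assms(3)])
      (use assms(2) in \<open>auto simp: bilinear_on_pairs_def\<close>)
qed

lemma comult_sum_heq:
  assumes "vector_space t" "bilin t \<beta>" "heq H (comult H a) ps"
  shows "comult_sum \<beta> a = (\<Sum>(a1, a2)\<leftarrow>ps. \<beta> a1 a2)"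
  unfolding comult_sum_def by (rule heq_imp_bilin_eq[OF assms])

lemma comult_sum_add:
  assumes "vector_space t" "bilin t \<beta>"
  shows "comult_sum \<beta> (a + b) = comult_sum \<beta> a + comult_sum \<beta> b"
  using comult_sum_heq[OF assms comult_add] by (simp add: comult_sum_def)

lemma comult_sum_scl:
  assumes "vector_space t" "bilin t \<beta>"
  shows "comult_sum \<beta> (c \<cdot> a) = t c (comult_sum \<beta> a)"
proof -
  interpret t: vector_space t by fact
  have "comult_sum \<beta> (c \<cdot> a) = (\<Sum>(a1, a2)\<leftarrow>comult H a. \<beta> (c \<cdot> a1) a2)"
    using comult_sum_heq[OF assms comult_scl] by (simp add: case_prod_unfold o_def)
  also have "\<dots> = t c (comult_sum \<beta> a)"
  proof -
    have "(\<Sum>(a1, a2)\<leftarrow>ps. \<beta> (c \<cdot> a1) a2) = t c (\<Sum>(a1, a2)\<leftarrow>ps. \<beta> a1 a2)" for ps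
      using assms(2) by (induction ps) (auto simp: bilinear_on_pairs_def t.scale_right_distrib)
    then show ?thesis
      by (simp add: comult_sum_def)
  qed
  finally show ?thesis .
qed

lemma comult_sum_one:
  assumes "vector_space t" "bilin t \<beta>"
  shows "comult_sum \<beta> 1 = \<beta> 1 1"
  using comult_sum_heq[OF assms comult_one] by simp

lemma comult_sum_mult:
  assumes "vector_space t" "bilin t \<beta>"
  shows "comult_sum \<beta> (a * b) = comult_sum (\<lambda>a1 a2. comult_sum (\<lambda>b1 b2. \<beta> (a1 * b1) (a2 * b2)) b) a"
  using comult_sum_heq[OF assms comult_mult[of a b]]
  by (simp add: comult_sum_def sum_list_concat_map case_prod_unfold o_def)

lemma comult_sum_grouplike:
  assumes "vector_space t" "bilin t \<beta>" "a \<in> G"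
  shows "comult_sum \<beta> a = \<beta> a a"
  using comult_sum_heq[OF assms(1,2), of a "[(a, a)]"] assms(3) by (simp add: grouplikes_def)

lemma comult_sum_skew_primitive:
  assumes "vector_space t" "bilin t \<beta>" "skew_primitive H a b y"
  shows "comult_sum \<beta> y = \<beta> a y + \<beta> y b"
  using comult_sum_heq[OF assms(1,2), of y "[(a, y), (y, b)]"] assms(3) by (simp add: skew_primitive_def)

lemma linear_comult_sum:
  assumes "vector_space t" "bilin t \<beta>"
  shows "Vector_Spaces.linear (scl H) t (comult_sum \<beta>)"
  using assms by (simp add: Vector_Spaces.linear_iff vs comult_sum_add comult_sum_scl)

lemma comult_sum_coassoc:
  assumes "vector_space t" "trilin t \<tau>"
  shows "comult_sum (\<lambda>a1 a2. comult_sum (\<lambda>a11 a12. \<tau> a11 a12 a2) a1) a =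
         comult_sum (\<lambda>a1 a2. comult_sum (\<lambda>a21 a22. \<tau> a1 a21 a22) a2) a"
proof -
  interpret t: vector_space t by fact
  show ?thesis
    using t.tensor3_eq_imp_trilinear_eq[OF coassoc[of a], where \<beta> = "\<lambda>(u, v, w). \<tau> u v w"] assms(2)
    by (simp add: comult_sum_def sum_list_concat_map case_prod_unfold o_def trilinear_on_triples_def
        bilinear_on_pairs_def)
qed

lemma comult_sum_add_fun: "comult_sum (\<lambda>u v. \<beta> u v + \<gamma> u v) a = comult_sum \<beta> a + comult_sum \<gamma> a"
  by (simp add: comult_sum_def case_prod_unfold sum_list_addf)

lemma comult_sum_scale_fun:
  assumes "vector_space t"
  shows "comult_sum (\<lambda>u v. t c (\<beta> u v)) a = t c (comult_sum \<beta> a)"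
proof -
  interpret t: vector_space t by fact
  have "(\<Sum>(u, v)\<leftarrow>ps. t c (\<beta> u v)) = t c (\<Sum>(u, v)\<leftarrow>ps. \<beta> u v)" for ps
    by (induction ps) (auto simp: t.scale_right_distrib)
  then show ?thesis
    by (simp add: comult_sum_def)
qed

lemma bilin_functionals:
  assumes "functional_on f" "functional_on h"
  shows "bilin (*) (\<lambda>u v. f u * h v)"
  unfolding bilinear_on_pairs_def
  by (auto simp only: hv.functionalD(1,2)[OF assms(1)] hv.functionalD(1,2)[OF assms(2)]
      distrib_left distrib_right mult.assoc mult.left_commute)

lemma functional_convolution:
  assumes "functional_on f" "functional_on h"
  shows "functional_on (comult_sum (\<lambda>u v. f u * h v))"
  by (rule linear_comult_sum[OF vector_space_times bilin_functionals[OF assms]])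

lemma functional_counit: "functional_on \<epsilon>"
  by (rule hv.functionalI) (auto simp: counit_add counit_scl)

lemma comult_sum_functionals_grouplike:
  "functional_on f \<Longrightarrow> functional_on h \<Longrightarrow> a \<in> G \<Longrightarrow> comult_sum (\<lambda>u v. f u * h v) a = f a * h a"
  by (rule comult_sum_grouplike[OF vector_space_times bilin_functionals])

lemma convolution_counit_left: "functional_on f \<Longrightarrow> comult_sum (\<lambda>u v. \<epsilon> u * f v) a = f a"
proof -
  assume f: "functional_on f"
  have "f a = f (\<Sum>(a1, a2)\<leftarrow>comult H a. \<epsilon> a1 \<cdot> a2)"
    by (simp add: counit_left)
  also have "\<dots> = comult_sum (\<lambda>u v. \<epsilon> u * f v) a"
    by (simp add: hv.functionalD[OF f] comult_sum_def case_prod_unfold o_def)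
  finally show ?thesis by simp
qed

lemma comult_sum_counit_right: "comult_sum (\<lambda>u v. \<epsilon> v \<cdot> u) a = a"
  by (simp add: comult_sum_def counit_right)

lemma comult_sum_counit_left: "comult_sum (\<lambda>u v. \<epsilon> u \<cdot> v) a = a"
  by (simp add: comult_sum_def counit_left)

lemma comult_sum_antipode_left: "comult_sum (\<lambda>u v. \<S> u * v) a = \<epsilon> a \<cdot> 1"
  by (simp add: comult_sum_def antipode_left)

lemma comult_sum_antipode_right: "comult_sum (\<lambda>u v. u * \<S> v) a = \<epsilon> a \<cdot> 1"
  by (simp add: comult_sum_def antipode_right)

lemma comult_sum_cong: "(\<And>u v. \<beta> u v = \<gamma> u v) \<Longrightarrow> comult_sum \<beta> a = comult_sum \<gamma> a"
  by (simp add: comult_sum_def)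

lemma comult_sum_swap:
  "comult_sum (\<lambda>u v. comult_sum (\<lambda>w z. \<beta> u v w z) b) a = comult_sum (\<lambda>w z. comult_sum (\<lambda>u v. \<beta> u v w z) a) b"
  unfolding comult_sum_def case_prod_unfold by (rule sum_list_swap)

lemma comult_sum_additive:
  assumes "\<And>u v. f (u + v) = f u + f v" "f 0 = 0"
  shows "f (comult_sum \<beta> a) = comult_sum (\<lambda>u v. f (\<beta> u v)) a"
proof -
  have "f (\<Sum>(u, v)\<leftarrow>ps. \<beta> u v) = (\<Sum>(u, v)\<leftarrow>ps. f (\<beta> u v))" for ps
    by (induction ps) (auto simp: assms)
  then show ?thesis
    by (simp add: comult_sum_def)
qed

lemma comult_sum_mult_left:
  fixes z :: "'u::ring"
  shows "comult_sum (\<lambda>u v. z * \<beta> u v) a = z * comult_sum \<beta> a"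
  by (rule comult_sum_additive[symmetric]) (simp_all add: distrib_left)

lemma comult_sum_mult_right:
  fixes z :: "'u::ring"
  shows "comult_sum (\<lambda>u v. \<beta> u v * z) a = comult_sum \<beta> a * z"
  by (rule comult_sum_additive[where f = "\<lambda>y. y * z", symmetric]) (simp_all add: distrib_right)

subsection \<open>The antipode\<close>

lemma antipode_zero [simp]: "\<S> 0 = 0"
  using antipode_add[of 0 0] by simp

text \<open>Both sides are convolution inverses of the multiplication \<open>H \<otimes> H \<rightarrow> H\<close>. The element evaluated in
  two ways in the proof is the convolution product of \<open>\<S> (a b)\<close>, \<open>a b\<close> and \<open>\<S> b \<S> a\<close>, written with
  threefold comultiplications of \<open>a\<close> and \<open>b\<close>.\<close>

lemma antipode_mult: "\<S> (a * b) = \<S> b * \<S> a"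
proof -
  let ?T = "\<lambda>a1 b1 a2 b2 a3 b3. \<S> (a1 * b1) * (a2 * (b2 * (\<S> b3 * \<S> a3)))"
  note lin = distrib_left distrib_right antipode_add antipode_scl scl_mult_left scl_mult_right
  have vsH: "vector_space (scl H)" by (rule vs)
  have trib: "trilin (scl H) (\<lambda>b1 b2 b3. ?T a1 b1 a2 b2 a3 b3)" for a1 a2 a3
    by (simp add: trilinear_on_triples_def bilinear_on_pairs_def lin)
  have tria: "trilin (scl H) (\<lambda>a1 a2 a3. comult_sum (\<lambda>b1 b2. comult_sum (\<lambda>b11 b12. ?T a1 b11 a2 b12 a3 b2) b1) b)"
    by (simp add: trilinear_on_triples_def bilinear_on_pairs_def lin comult_sum_add_fun
        comult_sum_scale_fun[OF vsH])
  let ?E = "comult_sum (\<lambda>a1 a2. comult_sum (\<lambda>a21 a22. comult_sum (\<lambda>b1 b2. comult_sum (\<lambda>b21 b22.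
      ?T a1 b1 a21 b21 a22 b22) b2) b) a2) a"
  have "comult_sum (\<lambda>b21 b22. ?T a1 b1 a21 b21 a22 b22) b2 = \<S> (a1 * (\<epsilon> b2 \<cdot> b1)) * (a21 * \<S> a22)"
    for a1 b1 a21 a22 b2
  proof -
    have "comult_sum (\<lambda>b21 b22. ?T a1 b1 a21 b21 a22 b22) b2
        = comult_sum (\<lambda>b21 b22. \<S> (a1 * b1) * a21 * (b21 * \<S> b22) * \<S> a22) b2"
      by (simp add: mult.assoc)
    also have "\<dots> = \<S> (a1 * b1) * a21 * (\<epsilon> b2 \<cdot> 1) * \<S> a22"
      by (simp only: comult_sum_mult_left comult_sum_mult_right comult_sum_antipode_right)
    finally show ?thesis
      by (simp add: lin mult.assoc)
  qed
  moreover have "comult_sum (\<lambda>b1 b2. \<S> (a1 * (\<epsilon> b2 \<cdot> b1)) * z) b = \<S> (a1 * b) * z" for a1 z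
    using comult_sum_additive[of "\<lambda>y. \<S> (a1 * y) * z" "\<lambda>b1 b2. \<epsilon> b2 \<cdot> b1" b]
    by (simp add: lin[of _ _] comult_sum_counit_right del: scl_mult_right)
  moreover have "comult_sum (\<lambda>a21 a22. \<S> (a1 * b) * (a21 * \<S> a22)) a2 = \<S> ((\<epsilon> a2 \<cdot> a1) * b)" for a1 a2
    by (simp add: comult_sum_mult_left comult_sum_antipode_right lin)
  moreover have "comult_sum (\<lambda>a1 a2. \<S> ((\<epsilon> a2 \<cdot> a1) * b)) a = \<S> (a * b)"
    using comult_sum_additive[of "\<lambda>y. \<S> (y * b)" "\<lambda>b1 b2. \<epsilon> b2 \<cdot> b1" a]
    by (simp add: distrib_right antipode_add comult_sum_counit_right)
  ultimately have 1: "?E = \<S> (a * b)"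
    by simp
  have "?E = comult_sum (\<lambda>a1 a2. comult_sum (\<lambda>a21 a22. comult_sum (\<lambda>b1 b2. comult_sum (\<lambda>b11 b12.
      ?T a1 b11 a21 b12 a22 b2) b1) b) a2) a"
    by (simp only: comult_sum_coassoc[OF vsH trib])
  also have "\<dots> = comult_sum (\<lambda>a1 a2. comult_sum (\<lambda>a11 a12. comult_sum (\<lambda>b1 b2. comult_sum (\<lambda>b11 b12.
      ?T a11 b11 a12 b12 a2 b2) b1) b) a1) a"
    by (rule comult_sum_coassoc[OF vsH tria, symmetric])
  also have "\<dots> = comult_sum (\<lambda>a1 a2. comult_sum (\<lambda>b1 b2. comult_sum (\<lambda>a11 a12. comult_sum (\<lambda>b11 b12.
      ?T a11 b11 a12 b12 a2 b2) b1) a1) b) a"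
    by (subst comult_sum_swap) (rule refl)
  also have "\<dots> = comult_sum (\<lambda>a1 a2. comult_sum (\<lambda>b1 b2. \<S> (\<epsilon> b1 \<cdot> b2) * \<S> (\<epsilon> a1 \<cdot> a2)) b) a"
  proof (intro comult_sum_cong)
    fix a1 a2 b1 b2
    have "comult_sum (\<lambda>a11 a12. comult_sum (\<lambda>b11 b12. ?T a11 b11 a12 b12 a2 b2) b1) a1
        = comult_sum (\<lambda>a11 a12. comult_sum (\<lambda>b11 b12. \<S> (a11 * b11) * (a12 * b12)) b1) a1 * (\<S> b2 * \<S> a2)"
      by (simp only: comult_sum_mult_right[symmetric] mult.assoc)
    also have "comult_sum (\<lambda>a11 a12. comult_sum (\<lambda>b11 b12. \<S> (a11 * b11) * (a12 * b12)) b1) a1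
        = comult_sum (\<lambda>u v. \<S> u * v) (a1 * b1)"
      by (rule comult_sum_mult[OF vsH, symmetric]) (simp add: bilinear_on_pairs_def lin)
    finally show "comult_sum (\<lambda>a11 a12. comult_sum (\<lambda>b11 b12. ?T a11 b11 a12 b12 a2 b2) b1) a1
        = \<S> (\<epsilon> b1 \<cdot> b2) * \<S> (\<epsilon> a1 \<cdot> a2)"
      by (simp add: comult_sum_antipode_left counit_mult lin mult.commute)
  qed
  also have "\<dots> = comult_sum (\<lambda>a1 a2. \<S> b * \<S> (\<epsilon> a1 \<cdot> a2)) a"
    using comult_sum_additive[of \<S> "\<lambda>b1 b2. \<epsilon> b1 \<cdot> b2" b]
    by (simp only: comult_sum_mult_right antipode_add antipode_zero comult_sum_counit_left)
  also have "\<dots> = \<S> b * \<S> a"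
    using comult_sum_additive[of \<S> "\<lambda>b1 b2. \<epsilon> b1 \<cdot> b2" a]
    by (simp only: comult_sum_mult_left antipode_add antipode_zero comult_sum_counit_left)
  finally show ?thesis
    using 1 by simp
qed

lemma antipode_one [simp]: "\<S> 1 = 1"
  using comult_sum_antipode_left[of 1]
    comult_sum_one[OF vs, of "\<lambda>u v. \<S> u * v"]
  by (simp add: bilinear_on_pairs_def distrib_left distrib_right antipode_add antipode_scl
      scl_mult_left scl_mult_right counit_one)

subsection \<open>Grouplike elements\<close>

lemma counit_grouplike: "a \<in> G \<Longrightarrow> \<epsilon> a = 1"
proof -
  assume a: "a \<in> G"
  have "comult_sum (\<lambda>u v. \<epsilon> u \<cdot> v) a = \<epsilon> a \<cdot> a"
    by (rule comult_sum_grouplike[OF vs _ a])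
      (simp add: bilinear_on_pairs_def counit_add counit_scl hv.scale_left_distrib hv.scale_right_distrib
        mult.commute)
  then have "(\<epsilon> a - 1) \<cdot> a = 0"
    by (simp add: comult_sum_counit_left hv.scale_left_diff_distrib)
  then show "\<epsilon> a = 1"
    using a by (auto simp: grouplikes_def)
qed

lemma bilin_antipode: "bilin (scl H) (\<lambda>u v. \<S> u * v)" "bilin (scl H) (\<lambda>u v. u * \<S> v)"
  by (simp_all add: bilinear_on_pairs_def distrib_left distrib_right antipode_add antipode_scl
      scl_mult_left scl_mult_right)

lemma grouplike_antipode:
  assumes "a \<in> G"
  shows "\<S> a * a = 1" "a * \<S> a = 1"
  using comult_sum_grouplike[OF vs bilin_antipode(1) assms] comult_sum_grouplike[OF vs bilin_antipode(2) assms]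
  by (simp_all add: comult_sum_antipode_left comult_sum_antipode_right counit_grouplike[OF assms])

lemma grouplike_cancel:
  "a \<in> G \<Longrightarrow> a * u = a * v \<longleftrightarrow> u = v" "a \<in> G \<Longrightarrow> u * a = v * a \<longleftrightarrow> u = v"
  by (metis grouplike_antipode mult.assoc mult_1_left mult_1_right)+

lemma one_grouplike: "1 \<in> G"
  using comult_one by (simp add: grouplikes_def)

lemma skew_primitive_counit_antipode:
  assumes "skew_primitive H a b y"
  shows "\<epsilon> y = 0" "\<S> y = - (\<S> a * y * \<S> b)"
proof -
  have ab: "a \<in> G" "b \<in> G"
    using assms by (auto simp: skew_primitive_def)
  have "comult_sum (\<lambda>u v. \<epsilon> u * \<epsilon> v) y = \<epsilon> y + \<epsilon> y"
    using comult_sum_skew_primitive[OF vector_space_times bilin_functionals[OF functional_counit functional_counit] assms]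
    by (simp add: counit_grouplike ab)
  then show 0: "\<epsilon> y = 0"
    unfolding convolution_counit_left[OF functional_counit] by (metis add_cancel_right_right)
  have "\<S> a * y + \<S> y * b = 0"
    using comult_sum_skew_primitive[OF vs bilin_antipode(1) assms] 0
    by (simp add: comult_sum_antipode_left)
  then have "\<S> y * b * \<S> b = - (\<S> a * y) * \<S> b"
    by (simp add: add_eq_0_iff)
  then show "\<S> y = - (\<S> a * y * \<S> b)"
    using ab by (simp add: mult.assoc grouplike_antipode)
qed

text \<open>In a dependence \<open>b = \<Sum> d\<^sub>a a\<close> of \<open>b\<close> on independent grouplike elements, comparing \<open>b \<otimes> b\<close> with
  \<open>\<Sum> d\<^sub>a a \<otimes> a\<close> shows that the \<open>d\<^sub>a\<close> are orthogonal idempotents of the field. So exactly one of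
  them is \<open>1\<close> and \<open>b\<close> is one of the other elements.\<close>

lemma grouplikes_family_independent:
  assumes "finite A" "A \<subseteq> G" "(\<Sum>a\<in>A. c a \<cdot> a) = 0"
  shows "\<forall>a\<in>A. c a = 0"
  using assms
proof (induction A arbitrary: c rule: finite_induct)
  case empty
  then show ?case by simp
next
  case (insert b A)
  have bG: "b \<in> G" and AG: "A \<subseteq> G"
    using insert by auto
  show ?case
  proof (cases "c b = 0")
    case True
    then show ?thesis
      using insert by simp
  next
    case False
    define d where "d a = - c a / c b" for a
    have "c b \<cdot> b = - (\<Sum>a\<in>A. c a \<cdot> a)"
      using insert by (simp add: add_eq_0_iff)
    then have "(1 / c b) \<cdot> c b \<cdot> b = (1 / c b) \<cdot> (- (\<Sum>a\<in>A. c a \<cdot> a))"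
      by simp
    then have b: "b = (\<Sum>a\<in>A. d a \<cdot> a)"
      using False by (simp add: d_def hv.scale_sum_right sum_negf[symmetric] del: sum_negf)
    have ind: "\<And>c. (\<Sum>a\<in>A. c a \<cdot> a) = 0 \<Longrightarrow> \<forall>a\<in>A. c a = 0"
      using insert.IH AG by blast
    have "\<exists>f. functional_on f \<and> (\<forall>j\<in>A. f j = (if j = i then 1 else 0))" if "i \<in> A" for i
      by (rule hv.dual_family[where v = "\<lambda>x. x", OF insert(1) ind that])
    then obtain e where e: "\<And>i. i \<in> A \<Longrightarrow> functional_on (e i)"
        "\<And>i j. i \<in> A \<Longrightarrow> j \<in> A \<Longrightarrow> e i j = (if j = i then 1 else 0)"
      by metis
    \<comment> \<open>The functionals \<open>e i\<close> are the coordinates on the span of \<open>A\<close>.\<close>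
    have eb: "e i b = d i" if "i \<in> A" for i
    proof -
      have "e i b = (\<Sum>a\<in>A. d a * e i a)"
        by (subst b) (simp add: hv.functionalD[OF e(1)[OF that]])
      also have "\<dots> = (\<Sum>a\<in>A. if a = i then d a else 0)"
        using that by (intro sum.cong) (auto simp: e)
      finally show ?thesis
        using that insert(1) by simp
    qed
    have dd: "d i * d j = (if i = j then d i else 0)" if ij: "i \<in> A" "j \<in> A" for i j
    proof -
      let ?f = "comult_sum (\<lambda>u v. e i u * e j v)"
      have "d i * d j = ?f b"
        using ij by (simp add: comult_sum_functionals_grouplike e(1) bG eb)
      also have "\<dots> = (\<Sum>a\<in>A. d a * ?f a)"
        by (subst b) (simp add: hv.functionalD[OF functional_convolution[OF e(1)[OF ij(1)] e(1)[OF ij(2)]]])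
      also have "\<dots> = (\<Sum>a\<in>A. if a = i then if i = j then d i else 0 else 0)"
        using ij AG by (intro sum.cong) (auto simp: comult_sum_functionals_grouplike e subset_iff)
      finally show ?thesis
        using ij insert(1) by simp
    qed
    have "b \<noteq> 0"
      using bG by (auto simp: grouplikes_def)
    then obtain i where i: "i \<in> A" "d i \<noteq> 0"
      using b by (metis (mono_tags, lifting) hv.scale_zero_left sum.neutral)
    then have "d i = 1"
      using dd[of i i] by simp
    moreover have "d j = 0" if "j \<in> A" "j \<noteq> i" for j
      using dd[of i j] that i by simp
    ultimately have "(\<Sum>a\<in>A. d a \<cdot> a) = (\<Sum>a\<in>A. if a = i then a else 0)"
      by (intro sum.cong) auto
    then have "b = i"
      using b i insert(1) by simp
    then show ?thesis
      using insert(2) i by simp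
  qed
qed

lemma span_mult: "a \<in> hv.span A \<Longrightarrow> b \<in> hv.span B \<Longrightarrow> (\<And>u v. u \<in> A \<Longrightarrow> v \<in> B \<Longrightarrow> u * v \<in> hv.span C)
  \<Longrightarrow> a * b \<in> hv.span C"
proof -
  assume a: "a \<in> hv.span A" and b: "b \<in> hv.span B" and uv: "\<And>u v. u \<in> A \<Longrightarrow> v \<in> B \<Longrightarrow> u * v \<in> hv.span C"
  have *: "u * b \<in> hv.span C" if "u \<in> A" for u
    using b
  proof (induction rule: hv.span_induct_alt)
    case (step c x y)
    then show ?case
      using uv[OF that] by (simp add: distrib_left scl_mult_right hv.span_add hv.span_scale)
  qed (simp add: hv.span_zero)
  show ?thesis
    using a
  proof (induction rule: hv.span_induct_alt)
    case (step c x y)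
    then show ?case
      using * by (simp add: distrib_right scl_mult_left hv.span_add hv.span_scale)
  qed (simp add: hv.span_zero)
qed

end


subsection \<open>Finite dimension\<close>

locale finite_dim_hopf_algebra = hopf_algebra H for H :: "('k::field, 'h::ring_1) hopf" +
  assumes fin_dim: "finite_dim H"
begin

lemma heqI:
  assumes "\<And>f h. functional_on f \<Longrightarrow> functional_on h \<Longrightarrow>
      (\<Sum>(u, v)\<leftarrow>ps. f u * h v) = (\<Sum>(u, v)\<leftarrow>qs. f u * h v)"
  shows "heq H ps qs"
proof -
  obtain B where "finite B" "vs_span (scl H) B = UNIV"
    using fin_dim by (auto simp: finite_dim_def)
  then show ?thesis
    by (intro tensor_eqI[OF vs _ _ vs] assms) (auto simp: hv.subspace_UNIV)
qed

lemma heq_comultI: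
  assumes "\<And>f h. functional_on f \<Longrightarrow> functional_on h \<Longrightarrow>
      comult_sum (\<lambda>u v. f u * h v) a = (\<Sum>(u, v)\<leftarrow>ps. f u * h v)"
  shows "heq H (comult H a) ps"
  by (rule heqI) (use assms in \<open>simp add: comult_sum_def\<close>)

lemma comult_sum_functionals_heq:
  assumes "functional_on f" "functional_on h" "heq H (comult H a) ps"
  shows "comult_sum (\<lambda>u v. f u * h v) a = (\<Sum>(u, v)\<leftarrow>ps. f u * h v)"
  by (rule comult_sum_heq[OF vector_space_times bilin_functionals[OF assms(1,2)] assms(3)])

lemma grouplikeI:
  assumes "a \<noteq> 0" "\<And>f h. functional_on f \<Longrightarrow> functional_on h \<Longrightarrow> comult_sum (\<lambda>u v. f u * h v) a = f a * h a"
  shows "a \<in> G"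
  using assms by (auto simp: grouplikes_def intro!: heq_comultI)

lemma skew_primitiveI:
  assumes "a \<in> G" "b \<in> G" "\<And>f h. functional_on f \<Longrightarrow> functional_on h \<Longrightarrow>
    comult_sum (\<lambda>u v. f u * h v) y = f a * h y + f y * h b"
  shows "skew_primitive H a b y"
  using assms by (auto simp: skew_primitive_def intro!: heq_comultI)

lemma comult_sum_functionals_skew_primitive:
  "functional_on f \<Longrightarrow> functional_on h \<Longrightarrow> skew_primitive H a b y \<Longrightarrow>
    comult_sum (\<lambda>u v. f u * h v) y = f a * h y + f y * h b"
  by (rule comult_sum_skew_primitive[OF vector_space_times bilin_functionals])

lemma functional_mult:
  assumes "functional_on f"
  shows "functional_on (\<lambda>u. f (a * u))" "functional_on (\<lambda>u. f (u * a))"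
  by (rule hv.functionalI; simp add: hv.functionalD[OF assms] distrib_left distrib_right scl_mult_left scl_mult_right)+

lemma comult_sum_functionals_mult:
  assumes "functional_on f" "functional_on h"
  shows "comult_sum (\<lambda>u v. f u * h v) (a * b) =
    comult_sum (\<lambda>a1 a2. comult_sum (\<lambda>b1 b2. f (a1 * b1) * h (a2 * b2)) b) a"
  by (rule comult_sum_mult[OF vector_space_times bilin_functionals[OF assms]])

lemma bilin_comult_sum_mult:
  assumes "functional_on f" "functional_on h"
  shows "bilin (*) (\<lambda>a1 a2. comult_sum (\<lambda>b1 b2. f (a1 * b1) * h (a2 * b2)) b)"
  unfolding bilinear_on_pairs_def
proof (intro conjI allI)
  note f = hv.functionalD(1,2)[OF assms(1)] and h = hv.functionalD(1,2)[OF assms(2)]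
  show "comult_sum (\<lambda>b1 b2. f ((u + v) * b1) * h (w * b2)) b =
      comult_sum (\<lambda>b1 b2. f (u * b1) * h (w * b2)) b + comult_sum (\<lambda>b1 b2. f (v * b1) * h (w * b2)) b"
    "comult_sum (\<lambda>b1 b2. f (u * b1) * h ((v + w) * b2)) b =
      comult_sum (\<lambda>b1 b2. f (u * b1) * h (v * b2)) b + comult_sum (\<lambda>b1 b2. f (u * b1) * h (w * b2)) b" for u v w
    by (simp_all only: distrib_right distrib_left f h comult_sum_add_fun)
  show "comult_sum (\<lambda>b1 b2. f (c \<cdot> u * b1) * h (v * b2)) b = c * comult_sum (\<lambda>b1 b2. f (u * b1) * h (v * b2)) b" for c u v
    by (simp only: scl_mult_left f mult.assoc comult_sum_mult_left)
  show "comult_sum (\<lambda>b1 b2. f (u * b1) * h (c \<cdot> v * b2)) b = c * comult_sum (\<lambda>b1 b2. f (u * b1) * h (v * b2)) b" for c u v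
    by (simp only: scl_mult_left h mult.left_commute[of _ c] comult_sum_mult_left)
qed

lemma comult_sum_grouplike_mult:
  assumes "functional_on f" "functional_on h" "a \<in> G"
  shows "comult_sum (\<lambda>u v. f u * h v) (a * b) = comult_sum (\<lambda>b1 b2. f (a * b1) * h (a * b2)) b"
  unfolding comult_sum_functionals_mult[OF assms(1,2)]
  by (rule comult_sum_grouplike[OF vector_space_times bilin_comult_sum_mult[OF assms(1,2)] assms(3)])

lemma comult_sum_skew_primitive_mult:
  assumes "functional_on f" "functional_on h" "skew_primitive H a 1 y"
  shows "comult_sum (\<lambda>u v. f u * h v) (y * b) =
    comult_sum (\<lambda>b1 b2. f (a * b1) * h (y * b2)) b + comult_sum (\<lambda>b1 b2. f (y * b1) * h b2) b"
  unfolding comult_sum_functionals_mult[OF assms(1,2)]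
    comult_sum_skew_primitive[OF vector_space_times bilin_comult_sum_mult[OF assms(1,2)] assms(3)]
  by simp

lemma grouplike_mult:
  assumes "a \<in> G" "b \<in> G"
  shows "a * b \<in> G"
proof (rule grouplikeI)
  show "a * b \<noteq> 0"
    using counit_mult[of a b] functional_counit counit_grouplike assms hv.functionalD(3) by fastforce
  show "comult_sum (\<lambda>u v. f u * h v) (a * b) = f (a * b) * h (a * b)"
    if "functional_on f" "functional_on h" for f h
    using that assms by (simp add: comult_sum_grouplike_mult comult_sum_functionals_grouplike[of "\<lambda>u. f (a * u)"] functional_mult)
qed

lemma grouplike_power: "a \<in> G \<Longrightarrow> a ^ n \<in> G"
  by (induction n) (auto intro: grouplike_mult one_grouplike)

lemma independent_finite:
  assumes "hv.independent A"
  shows "finite A"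
proof -
  obtain B where "finite B" "vs_span (scl H) B = UNIV"
    using fin_dim by (auto simp: finite_dim_def)
  then show ?thesis
    using hv.independent_span_bound[of B A] assms by simp
qed

lemma finite_grouplikes: "finite G"
proof (rule independent_finite)
  show "hv.independent G"
    unfolding hv.independent_explicit_finite_subsets
    using grouplikes_family_independent by blast
qed

text \<open>There are only finitely many grouplike elements because they are independent.\<close>

lemma grouplike_finite_order:
  assumes "a \<in> G"
  shows "\<exists>n>0. a ^ n = 1"
proof -
  have "\<not> inj (\<lambda>n. a ^ n)"
    using finite_subset[OF _ finite_grouplikes] grouplike_power[OF assms]
    by (metis finite_imageD image_subsetI infinite_UNIV_nat)
  then obtain i j where ij: "i < j" "a ^ i = a ^ j"
    by (metis (no_types, lifting) injI linorder_neqE_nat)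
  then have "a ^ i * a ^ (j - i) = a ^ i * 1"
    by (metis le_add_diff_inverse less_imp_le mult_1_right power_add)
  then show ?thesis
    using ij grouplike_cancel(1)[OF grouplike_power[OF assms]] by (metis zero_less_diff)
qed

lemma antipode_grouplike_power:
  assumes "a \<in> G"
  shows "\<exists>n. \<S> a = a ^ n"
proof -
  obtain n where n: "n > 0" "a ^ n = 1"
    using grouplike_finite_order[OF assms] by blast
  have "\<S> a = \<S> a * (a * a ^ (n - 1))"
    using n by (metis mult_1_right power_eq_if not_gr_zero)
  also have "\<dots> = a ^ (n - 1)"
    using grouplike_antipode(1)[OF assms] by (simp add: mult.assoc[symmetric])
  finally show ?thesis ..
qed

lemma antipode_grouplike: "a \<in> G \<Longrightarrow> \<S> a \<in> G"
  using antipode_grouplike_power grouplike_power by metis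

lemma grouplike_functional:
  assumes "a \<in> G"
  shows "\<exists>f. functional_on f \<and> (\<forall>b\<in>G. f b = (if b = a then 1 else 0))"
  by (rule hv.dual_family[where v = "\<lambda>x. x", OF finite_grouplikes _ assms])
    (rule grouplikes_family_independent[OF finite_grouplikes subset_refl])

subsection \<open>Elements whose comultiplication lies in a given space of tensors\<close>

text \<open>Subcoalgebras, Hopf ideals and the coradical filtration are all defined by such conditions. By
  \<open>subspace_legs_in\<close> and \<open>legs_in_mult\<close> it is enough to look at generators.\<close>

definition legs_in :: "('h \<times> 'h) set \<Rightarrow> 'h set" where
  "legs_in P = {a. \<exists>ps. set ps \<subseteq> P \<and> heq H (comult H a) ps}"

lemma subspace_legs_in:
  assumes "\<And>c u v. (u, v) \<in> P \<Longrightarrow> (c \<cdot> u, v) \<in> P"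
  shows "hv.subspace (legs_in P)"
proof (rule hv.subspaceI)
  show "0 \<in> legs_in P"
    unfolding legs_in_def mem_Collect_eq
    by (rule exI[of _ "[]"]) (auto intro!: heq_comultI simp: hv.functionalD[OF functional_convolution])
next
  fix a b assume "a \<in> legs_in P" "b \<in> legs_in P"
  then obtain ps qs where *: "set ps \<subseteq> P" "heq H (comult H a) ps" "set qs \<subseteq> P" "heq H (comult H b) qs"
    by (auto simp: legs_in_def)
  then have "heq H (comult H (a + b)) (ps @ qs)"
    by (intro heq_comultI)
      (simp add: hv.functionalD[OF functional_convolution] comult_sum_functionals_heq)
  then show "a + b \<in> legs_in P"
    using * unfolding legs_in_def by (metis (mono_tags, lifting) Un_least mem_Collect_eq set_append)
next
  fix c a assume "a \<in> legs_in P"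
  then obtain ps where *: "set ps \<subseteq> P" "heq H (comult H a) ps"
    by (auto simp: legs_in_def)
  have "heq H (comult H (c \<cdot> a)) (map (\<lambda>(u, v). (c \<cdot> u, v)) ps)"
  proof (rule heq_comultI)
    fix f h assume fh: "functional_on f" "functional_on h"
    have "(\<Sum>(u, v)\<leftarrow>map (\<lambda>(u, v). (c \<cdot> u, v)) ps. f u * h v) = c * (\<Sum>(u, v)\<leftarrow>ps. f u * h v)"
      by (induction ps) (auto simp: hv.functionalD[OF fh(1)] algebra_simps)
    then show "comult_sum (\<lambda>u v. f u * h v) (c \<cdot> a) = (\<Sum>(u, v)\<leftarrow>map (\<lambda>(u, v). (c \<cdot> u, v)) ps. f u * h v)"
      using fh * by (simp add: hv.functionalD[OF functional_convolution] comult_sum_functionals_heq)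
  qed
  moreover have "set (map (\<lambda>(u, v). (c \<cdot> u, v)) ps) \<subseteq> P"
    using *(1) assms by auto
  ultimately show "c \<cdot> a \<in> legs_in P"
    unfolding legs_in_def by blast
qed

lemma legs_in_mult:
  assumes "a \<in> legs_in P" "b \<in> legs_in Q"
    and "\<And>u v u' v'. (u, v) \<in> P \<Longrightarrow> (u', v') \<in> Q \<Longrightarrow> (u * u', v * v') \<in> R"
  shows "a * b \<in> legs_in R"
proof -
  obtain ps qs where *: "set ps \<subseteq> P" "heq H (comult H a) ps" "set qs \<subseteq> Q" "heq H (comult H b) qs"
    using assms(1,2) by (auto simp: legs_in_def)
  let ?rs = "[(u * u', v * v'). (u, v) \<leftarrow> ps, (u', v') \<leftarrow> qs]"
  have "heq H (comult H (a * b)) ?rs"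
  proof (rule heq_comultI)
    fix f h assume fh: "functional_on f" "functional_on h"
    have "comult_sum (\<lambda>u v. f u * h v) (a * b) = (\<Sum>(u, v)\<leftarrow>ps. comult_sum (\<lambda>b1 b2. f (u * b1) * h (v * b2)) b)"
      unfolding comult_sum_functionals_mult[OF fh]
      by (rule comult_sum_heq[OF vector_space_times bilin_comult_sum_mult[OF fh] *(2)])
    also have "\<dots> = (\<Sum>(u, v)\<leftarrow>ps. \<Sum>(u', v')\<leftarrow>qs. f (u * u') * h (v * v'))"
      by (simp add: comult_sum_functionals_heq[OF functional_mult(1)[OF fh(1)] functional_mult(1)[OF fh(2)] *(4)])
    also have "\<dots> = (\<Sum>(u, v)\<leftarrow>?rs. f u * h v)"
      by (simp add: sum_list_concat_map case_prod_unfold o_def)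
    finally show "comult_sum (\<lambda>u v. f u * h v) (a * b) = (\<Sum>(u, v)\<leftarrow>?rs. f u * h v)" .
  qed
  moreover have "set ?rs \<subseteq> R"
    using *(1,3) assms(3) by fastforce
  ultimately show ?thesis
    unfolding legs_in_def by blast
qed

lemma grouplike_legs_in: "a \<in> G \<Longrightarrow> (a, a) \<in> P \<Longrightarrow> a \<in> legs_in P"
  unfolding legs_in_def grouplikes_def by (intro CollectI exI[of _ "[(a, a)]"]) auto

lemma skew_primitive_legs_in: "skew_primitive H a b y \<Longrightarrow> (a, y) \<in> P \<Longrightarrow> (y, b) \<in> P \<Longrightarrow> y \<in> legs_in P"
  unfolding legs_in_def skew_primitive_def by (intro CollectI exI[of _ "[(a, y), (y, b)]"]) auto

lemma legs_in_UNIV: "a \<in> legs_in UNIV"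
  unfolding legs_in_def tensor_eq_def by (auto intro!: exI[of _ "comult H a"] simp: fvs.span_zero)

lemma subcoalgebra_iff: "subcoalgebra H C \<longleftrightarrow> hv.subspace C \<and> C \<subseteq> legs_in (C \<times> C)"
  by (auto simp: subcoalgebra_def legs_in_def)

end

section \<open>The coradical of a pointed Hopf algebra\<close>

context finite_dim_hopf_algebra
begin

definition right_translate :: "('h \<Rightarrow> 'k) \<Rightarrow> 'h \<Rightarrow> 'h" where
  "right_translate f = comult_sum (\<lambda>u v. f v \<cdot> u)"

text \<open>Stability under right translations means \<open>\<Delta> V \<subseteq> V \<otimes> H\<close>, see \<open>right_coideal_representation\<close>, but
  avoids a choice of representing lists.\<close>

definition right_coideal :: "'h set \<Rightarrow> bool" where
  "right_coideal V \<longleftrightarrow> hv.subspace V \<and> (\<forall>f. functional_on f \<longrightarrow> (\<forall>a\<in>V. right_translate f a \<in> V))"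

lemma functional_right_translate:
  assumes "functional_on h"
  shows "h (right_translate f a) = comult_sum (\<lambda>u v. h u * f v) a"
  unfolding right_translate_def
  by (subst comult_sum_additive[where f = h])
    (simp_all add: hv.functionalD(1,2,3)[OF assms] mult.commute)

lemma right_translate_sum_list:
  assumes f: "functional_on f"
    and eq: "\<And>f h. functional_on f \<Longrightarrow> functional_on h \<Longrightarrow> comult_sum (\<lambda>u v. f u * h v) a = (\<Sum>(u, v)\<leftarrow>ps. f u * h v)"
  shows "right_translate f a = (\<Sum>(u, v)\<leftarrow>ps. f v \<cdot> u)"
proof (rule hv.functionals_separate)
  fix h assume h: "functional_on h"
  show "h (right_translate f a) = h (\<Sum>(u, v)\<leftarrow>ps. f v \<cdot> u)"
    unfolding functional_right_translate[OF h] eq[OF h f]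
    by (induction ps) (auto simp: hv.functionalD(1,2,3)[OF h] mult.commute)
qed

lemma right_translate_mem:
  assumes "hv.subspace W" "functional_on f" "set ps \<subseteq> W \<times> UNIV"
    and eq: "\<And>f h. functional_on f \<Longrightarrow> functional_on h \<Longrightarrow> comult_sum (\<lambda>u v. f u * h v) a = (\<Sum>(u, v)\<leftarrow>ps. f u * h v)"
  shows "right_translate f a \<in> W"
proof -
  have "(\<Sum>(u, v)\<leftarrow>ps. f v \<cdot> u) \<in> W"
    using assms(3)
    by (induction ps) (auto intro!: hv.subspace_add[OF assms(1)] hv.subspace_scale[OF assms(1)] hv.subspace_0[OF assms(1)])
  then show ?thesis
    by (simp add: right_translate_sum_list[OF assms(2) eq])
qed

lemma right_coideal_representation:
  assumes "\<And>f. functional_on f \<Longrightarrow> right_translate f a \<in> V"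
  shows "\<exists>ps. set ps \<subseteq> V \<times> UNIV \<and> heq H (comult H a) ps"
proof -
  obtain C where C: "finite C" "vs_span (scl H) C = UNIV"
    using fin_dim by (auto simp: finite_dim_def)
  obtain B e where B: "finite B" "\<And>b. functional_on (e b)" "\<And>v. v = (\<Sum>b\<in>B. e b v \<cdot> b)"
    using hv.finite_basis_coordinates[OF hv.subspace_UNIV C] by (metis UNIV_I)
  obtain bs where bs: "set bs = B" "distinct bs"
    using finite_distinct_list[OF B(1)] by blast
  let ?ps = "map (\<lambda>b. (right_translate (e b) a, b)) bs"
  have "heq H (comult H a) ?ps"
  proof (rule heq_comultI)
    fix f h assume fh: "functional_on f" "functional_on h"
    have "(\<Sum>(u, v)\<leftarrow>?ps. f u * h v) = (\<Sum>b\<leftarrow>bs. comult_sum (\<lambda>u v. f u * e b v) a * h b)"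
      by (simp add: functional_right_translate fh o_def)
    also have "\<dots> = (\<Sum>b\<leftarrow>bs. comult_sum (\<lambda>u v. f u * e b v * h b) a)"
      by (simp only: comult_sum_mult_right)
    also have "\<dots> = comult_sum (\<lambda>u v. \<Sum>b\<leftarrow>bs. f u * e b v * h b) a"
      unfolding comult_sum_def case_prod_unfold by (rule sum_list_swap)
    also have "(\<lambda>u v. \<Sum>b\<leftarrow>bs. f u * e b v * h b) = (\<lambda>u v. f u * h v)"
    proof (intro ext)
      fix u v
      have "f u * h v = f u * h (\<Sum>b\<in>B. e b v \<cdot> b)"
        using B(3)[of v] by simp
      also have "\<dots> = (\<Sum>b\<in>B. f u * e b v * h b)"
        by (simp add: hv.functionalD[OF fh(2)] sum_distrib_left mult.assoc)
      finally show "(\<Sum>b\<leftarrow>bs. f u * e b v * h b) = f u * h v"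
        using bs by (simp add: sum_list_distinct_conv_sum_set)
    qed
    finally show "comult_sum (\<lambda>u v. f u * h v) a = (\<Sum>(u, v)\<leftarrow>?ps. f u * h v)"
      by simp
  qed
  moreover have "set ?ps \<subseteq> V \<times> UNIV"
    using assms B(2) by auto
  ultimately show ?thesis
    by blast
qed

lemma comult_sum_restricted_tensor:
  assumes "functional_on f" "functional_on h" "tensor_eq (scl H) V (scl H) UNIV ps qs"
  shows "(\<Sum>(u, v)\<leftarrow>ps. f u * h v) = (\<Sum>(u, v)\<leftarrow>qs. f u * h v)"
  by (rule scalars.tensor_eq_imp_bilinear_eq[OF assms(3)])
    (simp_all add: hv.functionalD(1,2)[OF assms(1)] hv.functionalD(1,2)[OF assms(2)] distrib_left distrib_right
      mult.assoc mult.left_commute)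

lemma minimal_right_coideal:
  assumes "right_coideal C" "C \<noteq> {0}"
  obtains V where "right_coideal V" "V \<subseteq> C" "V \<noteq> {0}"
    "\<And>W. right_coideal W \<Longrightarrow> W \<subseteq> V \<Longrightarrow> W = {0} \<or> W = V"
proof -
  obtain B where B: "hv.independent B" "UNIV \<subseteq> hv.span B"
    using hv.maximal_independent_subset[of UNIV] by blast
  interpret fdv: finite_dimensional_vector_space "scl H" B
    by unfold_locales (use B independent_finite in auto)
  let ?P = "\<lambda>n. \<exists>V. right_coideal V \<and> V \<subseteq> C \<and> V \<noteq> {0} \<and> hv.dim V = n"
  have "\<exists>n. ?P n"
    using assms by blast
  then obtain n where n: "?P n" "\<And>m. m < n \<Longrightarrow> \<not> ?P m"
    using exists_least_iff[of ?P] by blast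
  then obtain V where V: "right_coideal V" "V \<subseteq> C" "V \<noteq> {0}" "hv.dim V = n"
    by blast
  have "W = {0} \<or> W = V" if W: "right_coideal W" "W \<subseteq> V" for W
  proof (rule ccontr)
    assume "\<not> (W = {0} \<or> W = V)"
    then have "W \<noteq> {0}" "W \<noteq> V"
      by auto
    then have "n \<le> hv.dim W"
      using n(2)[of "hv.dim W"] V(2) W subset_trans[OF W(2) V(2)] not_le_imp_less by blast
    then have "W = V"
      using W V fdv.subspace_dim_equal[of W V] by (simp add: right_coideal_def)
    with \<open>W \<noteq> V\<close> show False ..
  qed
  then show ?thesis
    using that V by blast
qed

text \<open>The coaction is \<open>\<Delta>\<close>, represented by tensors in \<open>V \<otimes> H\<close>. Tested on functionals, the comodule
  axioms become those of the comultiplication, and a subcomodule is a right coideal.\<close>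

lemma simple_comodule_of_minimal_right_coideal:
  assumes V: "right_coideal V" "V \<noteq> {0}"
    and min: "\<And>W. right_coideal W \<Longrightarrow> W \<subseteq> V \<Longrightarrow> W = {0} \<or> W = V"
  shows "\<exists>\<rho>. simple_comodule H (scl H) V \<rho>"
proof -
  have sub: "hv.subspace V"
    using V by (simp add: right_coideal_def)
  obtain C where C: "finite C" "vs_span (scl H) C = UNIV"
    using fin_dim by (auto simp: finite_dim_def)
  have "\<forall>v. v \<in> V \<longrightarrow> (\<exists>ps. set ps \<subseteq> V \<times> UNIV \<and> heq H (comult H v) ps)"
    using V right_coideal_representation by (simp add: right_coideal_def)
  then obtain \<rho> where \<rho>: "\<And>v. v \<in> V \<Longrightarrow> set (\<rho> v) \<subseteq> V \<times> UNIV" "\<And>v. v \<in> V \<Longrightarrow> heq H (comult H v) (\<rho> v)"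
    by metis
  have \<rho>_sum: "(\<Sum>(u, v)\<leftarrow>\<rho> w. f u * h v) = comult_sum (\<lambda>u v. f u * h v) w"
    if "w \<in> V" "functional_on f" "functional_on h" for w f h
    using comult_sum_functionals_heq[OF that(2,3) \<rho>(2)[OF that(1)]] by simp
  note lin = hv.functionalD(1,2)[OF functional_convolution]
  have "right_comodule H (scl H) V \<rho>"
    unfolding right_comodule_def
  proof (intro conjI ballI allI)
    show "hv.subspace V" by (rule sub)
    show "set (\<rho> v) \<subseteq> V \<times> UNIV" if "v \<in> V" for v
      by (rule \<rho>(1)[OF that])
    show "tensor_eq (scl H) V (scl H) UNIV (\<rho> (v + w)) (\<rho> v @ \<rho> w)" if "v \<in> V" "w \<in> V" for v w
      using hv.subspace_add[OF sub that] that \<rho>(1)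
      by (intro tensor_eqI[OF vs C vs C sub]) (simp_all add: \<rho>_sum lin)
    show "tensor_eq (scl H) V (scl H) UNIV (\<rho> (c \<cdot> v)) [(c \<cdot> v0, v1). (v0, v1) \<leftarrow> \<rho> v]" if v: "v \<in> V" for c v
    proof (rule tensor_eqI[OF vs C vs C sub])
      show "set (\<rho> (c \<cdot> v)) \<subseteq> V \<times> UNIV"
        by (rule \<rho>(1)[OF hv.subspace_scale[OF sub v]])
      show "set [(c \<cdot> v0, v1). (v0, v1) \<leftarrow> \<rho> v] \<subseteq> V \<times> UNIV"
        using \<rho>(1)[OF v] hv.subspace_scale[OF sub] by auto
      fix f h assume fh: "functional_on f" "functional_on h"
      have "(\<Sum>(u, v)\<leftarrow>[(c \<cdot> v0, v1). (v0, v1) \<leftarrow> ps]. f u * h v) = c * (\<Sum>(u, v)\<leftarrow>ps. f u * h v)" for ps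
        by (induction ps) (auto simp: hv.functionalD(2)[OF fh(1)] distrib_left mult.assoc)
      then show "(\<Sum>(u, v)\<leftarrow>\<rho> (c \<cdot> v). f u * h v) = (\<Sum>(u, v)\<leftarrow>[(c \<cdot> v0, v1). (v0, v1) \<leftarrow> \<rho> v]. f u * h v)"
        using v hv.subspace_scale[OF sub v] fh by (simp only: \<rho>_sum lin)
    qed
    show "tensor3_eq (scl H) V (scl H) UNIV (scl H) UNIV
        [(v00, v01, v1). (v0, v1) \<leftarrow> \<rho> v, (v00, v01) \<leftarrow> \<rho> v0]
        [(v0, v11, v12). (v0, v1) \<leftarrow> \<rho> v, (v11, v12) \<leftarrow> comult H v1]" if v: "v \<in> V" for v
    proof (rule tensor3_eqI[OF vs C vs C vs C sub])
      show "set [(v00, v01, v1). (v0, v1) \<leftarrow> \<rho> v, (v00, v01) \<leftarrow> \<rho> v0] \<subseteq> V \<times> UNIV"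
        using \<rho>(1)[OF v] \<rho>(1) by fastforce
      show "set [(v0, v11, v12). (v0, v1) \<leftarrow> \<rho> v, (v11, v12) \<leftarrow> comult H v1] \<subseteq> V \<times> UNIV"
        using \<rho>(1)[OF v] by fastforce
      fix f h l assume fhl: "functional_on f" "functional_on h" "functional_on l"
      have "(\<Sum>(v, w, z)\<leftarrow>[(v00, v01, v1). (v0, v1) \<leftarrow> \<rho> v, (v00, v01) \<leftarrow> \<rho> v0]. f v * (h w * l z))
          = (\<Sum>(v0, v1)\<leftarrow>\<rho> v. (\<Sum>(v00, v01)\<leftarrow>\<rho> v0. f v00 * h v01) * l v1)"
        by (simp add: sum_list_concat_map case_prod_unfold o_def sum_list_mult_const[symmetric] mult.assoc)
      also have "\<dots> = (\<Sum>(v0, v1)\<leftarrow>\<rho> v. comult_sum (\<lambda>u v. f u * h v) v0 * l v1)"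
        using \<rho>(1)[OF v] by (intro arg_cong[of _ _ sum_list] map_cong) (auto simp: \<rho>_sum fhl)
      also have "\<dots> = comult_sum (\<lambda>v0 v1. comult_sum (\<lambda>u v. f u * h v) v0 * l v1) v"
        by (rule \<rho>_sum[OF v functional_convolution[OF fhl(1,2)] fhl(3)])
      also have "\<dots> = comult_sum (\<lambda>v0 v1. comult_sum (\<lambda>u w. f u * (h w * l v1)) v0) v"
        by (simp only: comult_sum_mult_right[symmetric] mult.assoc)
      also have "\<dots> = comult_sum (\<lambda>v0 v1. comult_sum (\<lambda>w z. f v0 * (h w * l z)) v1) v"
        by (rule comult_sum_coassoc[OF vector_space_times])
          (simp add: trilinear_on_triples_def bilinear_on_pairs_def hv.functionalD(1,2)[OF fhl(1)]
            hv.functionalD(1,2)[OF fhl(2)] hv.functionalD(1,2)[OF fhl(3)] distrib_left distrib_right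
            mult.assoc mult.left_commute)
      also have "\<dots> = comult_sum (\<lambda>v0 v1. f v0 * comult_sum (\<lambda>w z. h w * l z) v1) v"
        by (simp only: comult_sum_mult_left)
      also have "\<dots> = (\<Sum>(v0, v1)\<leftarrow>\<rho> v. f v0 * comult_sum (\<lambda>w z. h w * l z) v1)"
        by (rule \<rho>_sum[OF v fhl(1) functional_convolution[OF fhl(2,3)], symmetric])
      also have "\<dots> = (\<Sum>(v, w, z)\<leftarrow>[(v0, v11, v12). (v0, v1) \<leftarrow> \<rho> v, (v11, v12) \<leftarrow> comult H v1]. f v * (h w * l z))"
        by (simp add: sum_list_concat_map case_prod_unfold o_def sum_list_const_mult[symmetric] comult_sum_def)
      finally show "(\<Sum>(v, w, z)\<leftarrow>[(v00, v01, v1). (v0, v1) \<leftarrow> \<rho> v, (v00, v01) \<leftarrow> \<rho> v0]. f v * (h w * l z))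
          = (\<Sum>(v, w, z)\<leftarrow>[(v0, v11, v12). (v0, v1) \<leftarrow> \<rho> v, (v11, v12) \<leftarrow> comult H v1]. f v * (h w * l z))" .
    qed
    show "(\<Sum>(v0, v1)\<leftarrow>\<rho> v. \<epsilon> v1 \<cdot> v0) = v" if v: "v \<in> V" for v
      using right_translate_sum_list[OF functional_counit, of v "\<rho> v"] \<rho>_sum[OF v]
      by (simp add: right_translate_def comult_sum_counit_right)
  qed
  moreover have "W = {0} \<or> W = V" if W: "subcomodule H (scl H) V \<rho> W" for W
  proof (rule min)
    show WV: "W \<subseteq> V"
      using W by (simp add: subcomodule_def)
    show "right_coideal W"
      unfolding right_coideal_def
    proof (intro conjI allI impI ballI)
      show sW: "hv.subspace W"
        using W by (simp add: subcomodule_def)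
      fix f w assume f: "functional_on f" and w: "w \<in> W"
      obtain ps where ps: "set ps \<subseteq> W \<times> UNIV" "tensor_eq (scl H) V (scl H) UNIV (\<rho> w) ps"
        using W w by (auto simp: subcomodule_def)
      show "right_translate f w \<in> W"
        using w WV by (intro right_translate_mem[OF sW f ps(1)])
          (auto simp: comult_sum_restricted_tensor[OF _ _ ps(2), symmetric] \<rho>_sum)
    qed
  qed
  ultimately show ?thesis
    using V(2) by (auto simp: simple_comodule_def)
qed

lemma subcoalgebra_right_coideal:
  assumes "subcoalgebra H C"
  shows "right_coideal C"
  unfolding right_coideal_def
proof (intro conjI allI impI ballI)
  show sub: "hv.subspace C"
    using assms by (simp add: subcoalgebra_def)
  fix f a assume f: "functional_on f" and a: "a \<in> C"
  obtain ps where ps: "set ps \<subseteq> C \<times> C" "heq H (comult H a) ps"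
    using assms a by (auto simp: subcoalgebra_def)
  show "right_translate f a \<in> C"
    by (rule right_translate_mem[OF sub f]) (use ps comult_sum_functionals_heq in auto)
qed

text \<open>If every right translation multiplies \<open>v\<close> by a scalar \<open>l f\<close>, applying the counit gives
  \<open>f v = l f \<epsilon>(v)\<close>. Therefore \<open>v / \<epsilon>(v)\<close> is grouplike.\<close>

lemma one_dim_right_coideal_grouplike:
  assumes "right_coideal V" "hv.dim V = 1"
  shows "\<exists>a\<in>V. a \<in> G"
proof -
  have sub: "hv.subspace V"
    using assms by (simp add: right_coideal_def)
  obtain B where B: "B \<subseteq> V" "hv.independent B" "V \<subseteq> hv.span B" "card B = 1"
    using hv.basis_exists[of V] assms(2) by metis
  then obtain v where v: "B = {v}"
    by (auto simp: card_1_singleton_iff)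
  then have v0: "v \<noteq> 0" "v \<in> V"
    using B by auto
  have "\<exists>l. right_translate f v = l \<cdot> v" if "functional_on f" for f
  proof -
    have "right_translate f v \<in> hv.span {v}"
      using assms(1) that v0 B(3) v by (auto simp: right_coideal_def)
    then show ?thesis
      by (auto simp: hv.span_singleton)
  qed
  then obtain l where l: "\<And>f. functional_on f \<Longrightarrow> right_translate f v = l f \<cdot> v"
    by metis
  have fv: "f v = l f * \<epsilon> v" if "functional_on f" for f
    using functional_right_translate[OF functional_counit, of f v] l[OF that] convolution_counit_left[OF that]
    by (simp add: counit_scl)
  have "\<epsilon> v \<noteq> 0"
  proof
    assume "\<epsilon> v = 0"
    then have "v = 0"
      using fv by (intro hv.functionals_separate) (simp add: hv.functionalD(3))
    with v0 show False by simp
  qed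
  define a where "a = (1 / \<epsilon> v) \<cdot> v"
  have "a \<in> V"
    using v0 sub by (simp add: a_def hv.subspace_scale)
  moreover have "a \<in> G"
  proof (rule grouplikeI)
    show "a \<noteq> 0"
      using v0 \<open>\<epsilon> v \<noteq> 0\<close> by (simp add: a_def)
    fix f h assume fh: "functional_on f" "functional_on h"
    have "comult_sum (\<lambda>u v. f u * h v) a = (1 / \<epsilon> v) * f (right_translate h v)"
      by (simp add: a_def hv.functionalD(2)[OF functional_convolution[OF fh]] functional_right_translate[OF fh(1)])
    also have "\<dots> = f a * h a"
      using \<open>\<epsilon> v \<noteq> 0\<close> fv[OF fh(2)]
      by (simp add: l[OF fh(2)] a_def hv.functionalD(2)[OF fh(1)] hv.functionalD(2)[OF fh(2)])
    finally show "comult_sum (\<lambda>u v. f u * h v) a = f a * h a" .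
  qed
  ultimately show ?thesis ..
qed

lemma simple_subcoalgebra_grouplike:
  assumes "a \<in> G"
  shows "simple_subcoalgebra H (hv.span {a})"
  unfolding simple_subcoalgebra_def
proof (intro conjI allI impI)
  have "a \<noteq> 0"
    using assms by (auto simp: grouplikes_def)
  then show "hv.span {a} \<noteq> {0}"
    using hv.span_base[of a "{a}"] by auto
  have "hv.span {a} \<subseteq> legs_in (hv.span {a} \<times> hv.span {a})"
    by (rule hv.span_minimal) (auto intro!: grouplike_legs_in assms hv.span_base subspace_legs_in hv.span_scale)
  then show "subcoalgebra H (hv.span {a})"
    by (simp add: subcoalgebra_iff)
  fix D assume D: "subcoalgebra H D \<and> D \<subseteq> hv.span {a}"
  then have sub: "hv.subspace D"
    by (simp add: subcoalgebra_def)
  show "D = {0} \<or> D = hv.span {a}"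
  proof (rule disjCI)
    assume "D \<noteq> hv.span {a}"
    show "D = {0}"
    proof (rule ccontr)
      assume "D \<noteq> {0}"
      then obtain d where "d \<in> D" "d \<noteq> 0"
        using hv.subspace_0[OF sub] by auto
      moreover then obtain c where c: "d = c \<cdot> a"
        using D by (auto simp: hv.span_singleton)
      ultimately have "(1 / c) \<cdot> d = a"
        by auto
      then have "a \<in> D"
        using hv.subspace_scale[OF sub \<open>d \<in> D\<close>] by metis
      then have "hv.span {a} \<subseteq> D"
        by (intro hv.span_minimal) (auto simp: sub)
      with D \<open>D \<noteq> hv.span {a}\<close> show False by auto
    qed
  qed
qed

text \<open>A simple subcoalgebra contains a minimal right coideal. By pointedness this is a line, hence
  spanned by a grouplike element, which spans the whole simple subcoalgebra.\<close>

lemma coradical_pointed: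
  assumes "pointed H"
  shows "coradical H = hv.span G"
proof
  have "C \<subseteq> hv.span G" if "simple_subcoalgebra H C" for C
  proof -
    have C: "subcoalgebra H C" "C \<noteq> {0}" "\<And>D. subcoalgebra H D \<Longrightarrow> D \<subseteq> C \<Longrightarrow> D = {0} \<or> D = C"
      using that by (auto simp: simple_subcoalgebra_def)
    obtain V where V: "right_coideal V" "V \<subseteq> C" "V \<noteq> {0}"
      "\<And>W. right_coideal W \<Longrightarrow> W \<subseteq> V \<Longrightarrow> W = {0} \<or> W = V"
      using minimal_right_coideal[OF subcoalgebra_right_coideal[OF C(1)] C(2)] by blast
    obtain \<rho> where "simple_comodule H (scl H) V \<rho>"
      using simple_comodule_of_minimal_right_coideal[OF V(1,3,4)] by blast
    then have "hv.dim V = 1"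
      using assms by (auto simp: pointed_def)
    then obtain a where a: "a \<in> V" "a \<in> G"
      using one_dim_right_coideal_grouplike[OF V(1)] by blast
    have "hv.span {a} = C"
    proof -
      have "hv.span {a} \<subseteq> C"
        using a V(2) C(1) by (intro hv.span_minimal) (auto simp: subcoalgebra_def)
      then show ?thesis
        using C(3) simple_subcoalgebra_grouplike[OF a(2)] by (auto simp: simple_subcoalgebra_def)
    qed
    then show ?thesis
      using a(2) hv.span_mono[of "{a}" G] by auto
  qed
  then show "coradical H \<subseteq> hv.span G"
    unfolding coradical_def by (intro hv.span_minimal) auto
  show "hv.span G \<subseteq> coradical H"
    unfolding coradical_def
    by (intro hv.span_mono) (use simple_subcoalgebra_grouplike hv.span_base in blast)
qed

end

section \<open>Skew-primitive elements and the rank\<close>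

lemma (in vector_space) lin_ext_combination3:
  "lin_ext scale (\<lambda>p. scale c0 (u p) + scale c1 (v p) + scale c2 (w p)) f =
    scale c0 (lin_ext scale u f) + scale c1 (lin_ext scale v f) + scale c2 (lin_ext scale w f)"
  by (simp add: lin_ext_def scale_right_distrib sum.distrib scale_sum_right mult.commute)

lemma lin_ext_singles: "lin_ext fscale (\<lambda>p. Poly_Mapping.single p 1) f = f"
proof (rule poly_mapping_eqI)
  fix k
  have "Poly_Mapping.lookup (lin_ext fscale (\<lambda>p. Poly_Mapping.single p 1) f) k =
      (\<Sum>p\<in>Poly_Mapping.keys f. if p = k then Poly_Mapping.lookup f p else 0)"
    unfolding lin_ext_def by (simp add: lookup_sum fscale_single lookup_single when_def)
  also have "\<dots> = Poly_Mapping.lookup f k"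
    by (simp add: in_keys_iff)
  finally show "Poly_Mapping.lookup (lin_ext fscale (\<lambda>p. Poly_Mapping.single p 1) f) k = Poly_Mapping.lookup f k" .
qed

lemma span_singles: "f \<in> vs_span fscale (range (\<lambda>p. Poly_Mapping.single p 1))"
proof -
  have "lin_ext fscale (\<lambda>p. Poly_Mapping.single p 1) f \<in> vs_span fscale (range (\<lambda>p. Poly_Mapping.single p 1))"
    unfolding lin_ext_def by (intro fvs.span_sum fvs.span_scale fvs.span_base) auto
  then show ?thesis
    by (simp only: lin_ext_singles)
qed

text \<open>A solution is the cross product of the two rows. If it vanishes, the rows are proportional and a
  vector orthogonal to a nonzero one of them is a solution.\<close>

lemma two_equations_three_unknowns:
  fixes p0 p1 p2 r0 r1 r2 :: "'k::field"
  shows "\<exists>c0 c1 c2. (c0 \<noteq> 0 \<or> c1 \<noteq> 0 \<or> c2 \<noteq> 0) \<and> c0 * p0 + c1 * p1 + c2 * p2 = 0 \<and> c0 * r0 + c1 * r1 + c2 * r2 = 0"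
proof (cases "p1 * r2 = p2 * r1 \<and> p2 * r0 = p0 * r2 \<and> p0 * r1 = p1 * r0")
  case False
  then show ?thesis
    by (intro exI[of _ "p1 * r2 - p2 * r1"] exI[of _ "p2 * r0 - p0 * r2"] exI[of _ "p0 * r1 - p1 * r0"])
      (auto simp: algebra_simps)
next
  case par: True
  have orth: "\<exists>c0 c1 c2. (c0 \<noteq> 0 \<or> c1 \<noteq> 0 \<or> c2 \<noteq> 0) \<and> c0 * a0 + c1 * a1 + c2 * a2 = 0 \<and> c0 * b0 + c1 * b1 + c2 * b2 = 0"
    if ab: "a1 * b2 = a2 * b1" "a2 * b0 = a0 * b2" "a0 * b1 = a1 * b0" "a0 \<noteq> 0 \<or> a1 \<noteq> 0 \<or> a2 \<noteq> 0"
    for a0 a1 a2 b0 b1 b2 :: 'k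
  proof -
    consider "a0 \<noteq> 0" | "a0 = 0" "a1 \<noteq> 0" | "a0 = 0" "a1 = 0" "a2 \<noteq> 0"
      using ab(4) by blast
    then show ?thesis
    proof cases
      case 1
      with ab show ?thesis
        by (intro exI[of _ a1] exI[of _ "- a0"] exI[of _ 0]) (auto simp: algebra_simps)
    next
      case 2
      with ab show ?thesis
        by (intro exI[of _ 0] exI[of _ a2] exI[of _ "- a1"]) (auto simp: algebra_simps)
    next
      case 3
      with ab show ?thesis
        by (intro exI[of _ 1] exI[of _ 0] exI[of _ 0]) auto
    qed
  qed
  show ?thesis
  proof (cases "p0 \<noteq> 0 \<or> p1 \<noteq> 0 \<or> p2 \<noteq> 0")
    case True
    then show ?thesis
      using orth[of p1 r2 p2 r1 r0 p0] par by blast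
  next
    case False
    show ?thesis
    proof (cases "r0 \<noteq> 0 \<or> r1 \<noteq> 0 \<or> r2 \<noteq> 0")
      case True
      then show ?thesis
        using orth[of r1 p2 r2 p1 p0 r0] par by (metis mult.commute)
    next
      case False
      with \<open>\<not> (p0 \<noteq> 0 \<or> p1 \<noteq> 0 \<or> p2 \<noteq> 0)\<close> show ?thesis
        by (intro exI[of _ 1]) auto
    qed
  qed
qed

locale pointed_hopf_algebra = finite_dim_hopf_algebra H for H :: "('k::field, 'h::ring_1) hopf" +
  assumes pointed: "pointed H"
begin

abbreviation kG where
  "kG \<equiv> hv.span G"

lemma kG_mult: "a \<in> kG \<Longrightarrow> b \<in> kG \<Longrightarrow> a * b \<in> kG"
  by (rule span_mult) (auto intro: hv.span_base grouplike_mult)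

lemma grouplike_in_kG: "a \<in> G \<Longrightarrow> a \<in> kG"
  by (rule hv.span_base)

lemma filtration_0: "coradical_filtration H 0 = kG"
  by (simp add: coradical_pointed[OF pointed])

lemma filtration_1: "coradical_filtration H 1 = legs_in (UNIV \<times> kG \<union> kG \<times> UNIV)"
  by (simp add: coradical_pointed[OF pointed] legs_in_def)

lemma skew_primitive_filtration_1: "skew_primitive H a b y \<Longrightarrow> y \<in> coradical_filtration H 1"
  unfolding filtration_1
  by (rule skew_primitive_legs_in) (auto simp: skew_primitive_def intro: grouplike_in_kG)

definition coord :: "'h \<Rightarrow> 'h \<Rightarrow> 'k" where
  "coord a = (SOME f. functional_on f \<and> (\<forall>b\<in>G. f b = (if b = a then 1 else 0)))"

lemma coord:
  assumes "a \<in> G"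
  shows "functional_on (coord a)" "b \<in> G \<Longrightarrow> coord a b = (if b = a then 1 else 0)"
  using someI_ex[OF grouplike_functional[OF assms]] by (auto simp: coord_def)

text \<open>The functional on \<open>H\<^sub>1\<close> that \<open>\<psi>\<close> induces: on \<open>H\<^sub>1 / H\<^sub>0\<close>, which is graded by \<open>G\<close> through
  its left coaction, it is \<open>y \<mapsto> \<psi> (a\<^sup>-\<^sup>1 y)\<close> in degree \<open>a\<close>.\<close>

definition descend :: "('h \<Rightarrow> 'k) \<Rightarrow> 'h \<Rightarrow> 'k" where
  "descend \<psi> y = (\<Sum>b\<in>G. comult_sum (\<lambda>u v. coord b u * \<psi> (\<S> b * v)) y)"

context
  fixes \<psi> assumes \<psi>: "functional_on \<psi>" "\<forall>a\<in>kG. \<psi> a = 0"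
begin

lemma functional_descend: "functional_on (descend \<psi>)"
proof (rule hv.functionalI)
  note * = hv.functionalD(1,2)[OF functional_convolution[OF coord(1) functional_mult(1)[OF \<psi>(1)]]]
  show "descend \<psi> (a + b) = descend \<psi> a + descend \<psi> b" for a b
    by (simp add: descend_def * sum.distrib)
  show "descend \<psi> (c \<cdot> a) = c * descend \<psi> a" for c a
    by (simp add: descend_def * sum_distrib_left)
qed

lemma sum_coord:
  assumes "c \<in> G"
  shows "(\<Sum>b\<in>G. coord b c * h b) = h c"
proof -
  have "(\<Sum>b\<in>G. coord b c * h b) = (\<Sum>b\<in>G. if b = c then h b else 0)"
    using assms by (intro sum.cong) (auto simp: coord)
  then show ?thesis
    using assms finite_grouplikes by simp
qed

lemma descend_skew_primitive:
  assumes "skew_primitive H a b y"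
  shows "descend \<psi> y = \<psi> (\<S> a * y)"
proof -
  have ab: "a \<in> G" "b \<in> G"
    using assms by (auto simp: skew_primitive_def)
  have "comult_sum (\<lambda>u v. coord c u * \<psi> (\<S> c * v)) y = coord c a * \<psi> (\<S> c * y)" if "c \<in> G" for c
    using comult_sum_functionals_skew_primitive[OF coord(1)[OF that] functional_mult(1)[OF \<psi>(1), of "\<S> c"] assms]
      bspec[OF \<psi>(2), OF grouplike_in_kG[OF grouplike_mult[OF antipode_grouplike[OF that] ab(2)]]]
    by simp
  then show ?thesis
    by (simp add: descend_def sum_coord[OF ab(1)])
qed

lemma descend_grouplike:
  assumes "a \<in> G"
  shows "descend \<psi> a = 0"
  unfolding descend_def
  using assms \<psi>(2)
  by (intro sum.neutral) (simp add: comult_sum_functionals_grouplike[OF coord(1) functional_mult(1)[OF \<psi>(1)]]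
      grouplike_in_kG grouplike_mult antipode_grouplike)

text \<open>In each summand \<open>u \<otimes> v\<close> of \<open>\<Delta> y\<close> one of the factors lies in \<open>kG\<close>. If it is \<open>v\<close>, the summand
  contributes zero to both sides; if \<open>u\<close> is a grouplike element \<open>c\<close>, it contributes \<open>\<psi> (c\<^sup>-\<^sup>1 v)\<close> to both.\<close>

lemma descend_grouplike_mult:
  assumes a: "a \<in> G" and y: "y \<in> coradical_filtration H 1"
  shows "descend \<psi> (a * y) = descend \<psi> y"
proof -
  obtain ps where ps: "set ps \<subseteq> UNIV \<times> kG \<union> kG \<times> UNIV" "heq H (comult H y) ps"
    using y unfolding filtration_1 by (auto simp: legs_in_def)
  have summand: "(\<Sum>b\<in>G. coord b (a * u) * \<psi> (\<S> b * (a * v))) = (\<Sum>b\<in>G. coord b u * \<psi> (\<S> b * v))"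
    if uv: "u \<in> kG \<or> v \<in> kG" for u v
    using uv
  proof
    assume "u \<in> kG"
    then show ?thesis
    proof (induction rule: hv.span_induct_alt)
      case base
      then show ?case
        by (simp add: hv.functionalD(3)[OF coord(1)])
    next
      case (step c x z)
      have "\<S> (a * x) * (a * v) = \<S> x * v"
        using grouplike_antipode(1)[OF a] by (simp add: antipode_mult mult.assoc) (metis mult.assoc mult_1_left)
      then have "(\<Sum>b\<in>G. coord b (a * x) * \<psi> (\<S> b * (a * v))) = (\<Sum>b\<in>G. coord b x * \<psi> (\<S> b * v))"
        using step(1) a grouplike_mult[OF a step(1)]
        by (simp add: sum_coord[where h = "\<lambda>b. \<psi> (\<S> b * (a * v))"] sum_coord[where h = "\<lambda>b. \<psi> (\<S> b * v)"])
      with step show ?case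
        by (simp add: distrib_left scl_mult_right hv.functionalD(1,2)[OF coord(1)] distrib_right
            sum.distrib mult.assoc sum_distrib_left[symmetric])
    qed
  next
    assume v: "v \<in> kG"
    have "\<S> b * (a * v) \<in> kG" "\<S> b * v \<in> kG" if "b \<in> G" for b
      using v grouplike_in_kG[OF a] grouplike_in_kG[OF antipode_grouplike[OF that]]
      by (simp_all add: kG_mult)
    then show ?thesis
      by (simp add: \<psi>(2))
  qed
  have "descend \<psi> (a * y) = (\<Sum>b\<in>G. comult_sum (\<lambda>u v. coord b (a * u) * \<psi> (\<S> b * (a * v))) y)"
    by (simp add: descend_def comult_sum_grouplike_mult[OF coord(1) functional_mult(1)[OF \<psi>(1)] a])
  also have "\<dots> = (\<Sum>b\<in>G. \<Sum>(u, v)\<leftarrow>ps. coord b (a * u) * \<psi> (\<S> b * (a * v)))"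
    using comult_sum_functionals_heq[OF functional_mult(1)[OF coord(1)]
        functional_mult(1)[OF functional_mult(1)[OF \<psi>(1)]] ps(2)]
    by (intro sum.cong) auto
  also have "\<dots> = (\<Sum>(u, v)\<leftarrow>ps. \<Sum>b\<in>G. coord b (a * u) * \<psi> (\<S> b * (a * v)))"
    by (simp add: sum_list_swap_sum case_prod_unfold)
  also have "\<dots> = (\<Sum>(u, v)\<leftarrow>ps. \<Sum>b\<in>G. coord b u * \<psi> (\<S> b * v))"
    using ps(1) by (intro arg_cong[of _ _ sum_list] map_cong refl) (auto simp: summand)
  also have "\<dots> = (\<Sum>b\<in>G. \<Sum>(u, v)\<leftarrow>ps. coord b u * \<psi> (\<S> b * v))"
    by (simp add: sum_list_swap_sum case_prod_unfold)
  also have "\<dots> = descend \<psi> y"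
    unfolding descend_def
    using comult_sum_functionals_heq[OF coord(1) functional_mult(1)[OF \<psi>(1)] ps(2)]
    by (intro sum.cong) auto
  finally show ?thesis .
qed

lemma descend_kG_mult:
  assumes "a \<in> kG" and y: "y \<in> coradical_filtration H 1"
  shows "descend \<psi> (a * y) = \<epsilon> a * descend \<psi> y"
  using assms(1)
proof (induction rule: hv.span_induct_alt)
  case base
  then show ?case
    by (simp add: hv.functionalD(3)[OF functional_descend] hv.functionalD(3)[OF functional_counit])
next
  case (step c x z)
  then show ?case
    by (simp add: distrib_right scl_mult_left hv.functionalD(1,2)[OF functional_descend] counit_add counit_scl
        descend_grouplike_mult[OF _ y] counit_grouplike)
qed

end

text \<open>A functional \<open>f\<close> on \<open>H\<^sub>1\<close> with \<open>f (a y) = \<epsilon>(a) f y\<close> for \<open>a\<close> in \<open>H\<^sub>0\<close> induces one on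
  \<open>k \<otimes>\<^sub>H\<^sub>0 H\<^sub>1\<close>; this is its lift to the free vector space.\<close>

definition balanced_functional :: "('h \<Rightarrow> 'k) \<Rightarrow> ('k \<times> 'h \<Rightarrow>\<^sub>0 'k) \<Rightarrow> 'k" where
  "balanced_functional f = lin_ext (*) (\<lambda>(c, y). c * f y)"

lemma balanced_functional_vanishes:
  assumes f: "functional_on f"
    and bal: "\<And>a y. a \<in> kG \<Longrightarrow> y \<in> coradical_filtration H 1 \<Longrightarrow> f (a * y) = \<epsilon> a * f y"
    and "w \<in> vs_span fscale (balanced_rels H)"
  shows "balanced_functional f w = 0"
  unfolding balanced_functional_def
  using _ assms(3)
proof (rule scalars.lin_ext_vanishes_on_span)
  fix r assume "r \<in> balanced_rels H"
  then show "lin_ext (*) (\<lambda>(c, y). c * f y) r = 0"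
    unfolding balanced_rels_def bilinear_rels_def
    using bal
    by (auto simp: scalars.lin_ext_diff hv.functionalD(1,2)[OF f] distrib_left distrib_right mult.assoc
        filtration_0 mult.left_commute simp del: coradical_filtration.simps One_nat_def)
qed

text \<open>Otherwise there are functionals on \<open>H\<close> that vanish on \<open>kG\<close> and are dual to the two translated
  elements.
  Descended to \<open>H\<^sub>1\<close> they are, together with the counit, three functionals on
  \<open>k \<otimes>\<^sub>H\<^sub>0 H\<^sub>1\<close> that are dual to the classes of \<open>y\<^sub>1\<close>, \<open>y\<^sub>2\<close> and \<open>1\<close>, although this space
  has dimension two.\<close>

lemma rank_one_skew_primitives_dependent:
  assumes rank: "has_rank H 1" and y1: "skew_primitive H a1 b1 y1" and y2: "skew_primitive H a2 b2 y2"
  shows "\<exists>c1 c2. (c1 \<noteq> 0 \<or> c2 \<noteq> 0) \<and> c1 \<cdot> (\<S> a1 * y1) + c2 \<cdot> (\<S> a2 * y2) \<in> kG"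
proof (rule ccontr)
  assume contr: "\<not> ?thesis"
  let ?z1 = "\<S> a1 * y1" and ?z2 = "\<S> a2 * y2"
  have "?z1 \<notin> hv.span (insert ?z2 G)"
  proof
    assume "?z1 \<in> hv.span (insert ?z2 G)"
    then obtain k where "?z1 - k \<cdot> ?z2 \<in> kG"
      by (auto simp: hv.span_insert)
    then have "1 \<cdot> ?z1 + (- k) \<cdot> ?z2 \<in> kG"
      by simp
    with contr show False
      by (metis zero_neq_one)
  qed
  then obtain \<psi>1 where \<psi>1: "functional_on \<psi>1" "\<And>b. b \<in> hv.span (insert ?z2 G) \<Longrightarrow> \<psi>1 b = 0" "\<psi>1 ?z1 = 1"
    using hv.separating_functional by blast
  have "?z2 \<notin> hv.span (insert ?z1 G)"
  proof
    assume "?z2 \<in> hv.span (insert ?z1 G)"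
    then obtain k where "?z2 - k \<cdot> ?z1 \<in> kG"
      by (auto simp: hv.span_insert)
    then have "(- k) \<cdot> ?z1 + 1 \<cdot> ?z2 \<in> kG"
      by simp
    with contr show False
      by (metis zero_neq_one)
  qed
  then obtain \<psi>2 where \<psi>2: "functional_on \<psi>2" "\<And>b. b \<in> hv.span (insert ?z1 G) \<Longrightarrow> \<psi>2 b = 0" "\<psi>2 ?z2 = 1"
    using hv.separating_functional by blast
  have kG_sub: "b \<in> hv.span (insert z G)" if "b \<in> kG" for b z
    using that hv.span_mono[of G "insert z G"] by auto
  have van1: "\<forall>b\<in>kG. \<psi>1 b = 0" and van2: "\<forall>b\<in>kG. \<psi>2 b = 0"
    using \<psi>1(2) \<psi>2(2) kG_sub by blast+
  have z12: "\<psi>1 ?z2 = 0" "\<psi>2 ?z1 = 0"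
    using \<psi>1(2) \<psi>2(2) hv.span_base by auto
  let ?V = "{f. Poly_Mapping.keys f \<subseteq> UNIV \<times> coradical_filtration H 1}"
  let ?W = "vs_span fscale (balanced_rels H)"
  have "quotient_dim fscale ?V ?W (1 + 1)"
    using rank unfolding has_rank_def by blast
  then obtain B where B: "B \<subseteq> ?V" "card B = 2" "?V \<subseteq> vs_span fscale (B \<union> ?W)"
    unfolding quotient_dim_def one_add_one by blast
  then obtain p r where pr: "B = {p, r}"
    by (auto simp: card_2_iff)
  let ?F0 = "balanced_functional \<epsilon>" and ?F1 = "balanced_functional (descend \<psi>1)"
    and ?F2 = "balanced_functional (descend \<psi>2)"
  \<comment> \<open>A combination that vanishes on the two elements of \<open>B\<close> vanishes on the whole space.\<close>
  obtain c0 c1 c2 where c: "c0 \<noteq> 0 \<or> c1 \<noteq> 0 \<or> c2 \<noteq> 0"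
    "c0 * ?F0 p + c1 * ?F1 p + c2 * ?F2 p = 0" "c0 * ?F0 r + c1 * ?F1 r + c2 * ?F2 r = 0"
    using two_equations_three_unknowns by blast
  define F where "F v = c0 * ?F0 v + c1 * ?F1 v + c2 * ?F2 v" for v
  have F_lin: "F v = lin_ext (*) (\<lambda>(c, y). c0 * (c * \<epsilon> y) + c1 * (c * descend \<psi>1 y) + c2 * (c * descend \<psi>2 y)) v" for v
    unfolding F_def balanced_functional_def scalars.lin_ext_combination3[symmetric] by (simp add: case_prod_unfold)
  have Fv: "F v = 0" if "v \<in> vs_span fscale (B \<union> ?W)" for v
    unfolding F_lin using _ that
  proof (rule scalars.lin_ext_vanishes_on_span)
    fix w assume w: "w \<in> B \<union> ?W"
    have "F w = 0"
    proof (cases "w \<in> B")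
      case True
      then show ?thesis
        using c pr by (auto simp: F_def)
    next
      case False
      with w have w: "w \<in> ?W" by blast
      have "?F0 w = 0"
        by (rule balanced_functional_vanishes[OF functional_counit _ w]) (simp add: counit_mult)
      moreover have "?F1 w = 0"
        by (rule balanced_functional_vanishes[OF functional_descend[OF \<psi>1(1) van1] _ w]) (rule descend_kG_mult[OF \<psi>1(1) van1])
      moreover have "?F2 w = 0"
        by (rule balanced_functional_vanishes[OF functional_descend[OF \<psi>2(1) van2] _ w]) (rule descend_kG_mult[OF \<psi>2(1) van2])
      ultimately show ?thesis
        by (simp add: F_def)
    qed
    then show "lin_ext (*) (\<lambda>(c, y). c0 * (c * \<epsilon> y) + c1 * (c * descend \<psi>1 y) + c2 * (c * descend \<psi>2 y)) w = 0"
      unfolding F_lin .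
  qed
  have Fs: "F (Poly_Mapping.single (1, y) 1) = c0 * \<epsilon> y + c1 * descend \<psi>1 y + c2 * descend \<psi>2 y" for y
    by (simp add: F_lin)
  have mem: "F (Poly_Mapping.single (1, y) 1) = 0" if "y \<in> coradical_filtration H 1" for y
  proof (rule Fv)
    have "Poly_Mapping.single (1, y) 1 \<in> ?V"
      using that by (simp del: One_nat_def coradical_filtration.simps)
    then show "Poly_Mapping.single (1, y) 1 \<in> vs_span fscale (B \<union> ?W)"
      using B(3) by blast
  qed
  have one: "1 \<in> coradical_filtration H 1"
    unfolding filtration_1
    by (rule grouplike_legs_in[OF one_grouplike]) (auto intro: grouplike_in_kG one_grouplike)
  have "c0 = 0"
    using mem[OF one] descend_grouplike[OF \<psi>1(1) van1 one_grouplike] descend_grouplike[OF \<psi>2(1) van2 one_grouplike]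
    by (simp add: Fs counit_one)
  moreover have "c1 = 0"
    using mem[OF skew_primitive_filtration_1[OF y1]] descend_skew_primitive[OF \<psi>1(1) van1 y1]
      descend_skew_primitive[OF \<psi>2(1) van2 y1] \<psi>1(3) z12 skew_primitive_counit_antipode(1)[OF y1]
    by (simp add: Fs)
  moreover have "c2 = 0"
    using mem[OF skew_primitive_filtration_1[OF y2]] descend_skew_primitive[OF \<psi>1(1) van1 y2]
      descend_skew_primitive[OF \<psi>2(1) van2 y2] \<psi>2(3) z12 skew_primitive_counit_antipode(1)[OF y2]
    by (simp add: Fs)
  ultimately show False
    using c(1) by simp
qed

text \<open>For a group algebra the space \<open>k \<otimes>\<^sub>H\<^sub>0 H\<^sub>1\<close> is spanned by the class of \<open>1 \<otimes> 1\<close>, but rank one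
  means that it has dimension two.\<close>

lemma rank_one_not_group_algebra:
  assumes rank: "has_rank H 1"
  shows "kG \<noteq> UNIV"
proof
  assume all: "kG = UNIV"
  let ?V = "{f. Poly_Mapping.keys f \<subseteq> UNIV \<times> coradical_filtration H 1}"
  let ?W = "vs_span fscale (balanced_rels H)"
  let ?e = "Poly_Mapping.single (1, 1) 1 :: 'k \<times> 'h \<Rightarrow>\<^sub>0 'k"
  have H1: "coradical_filtration H 1 = UNIV"
    unfolding filtration_1 all using legs_in_UNIV by auto
  have W: "vs_subspace fscale ?W"
    by (rule fvs.subspace_span)
  have s: "Poly_Mapping.single (c, y) 1 - fscale (c * \<epsilon> y) ?e \<in> ?W" for c y
  proof -
    have "Poly_Mapping.single (c * \<epsilon> y, 1) 1 - Poly_Mapping.single (c, y * 1) 1 \<in> ?W"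
      unfolding balanced_rels_def
      by (intro fvs.span_base UnI2 CollectI exI[of _ c] exI[of _ y] exI[of _ 1])
        (simp add: H1 filtration_0 all del: One_nat_def coradical_filtration.simps)
    then have 1: "Poly_Mapping.single (c, y) 1 - Poly_Mapping.single (c * \<epsilon> y, 1) 1 \<in> ?W"
      using fvs.subspace_neg[OF W] by fastforce
    have "Poly_Mapping.single ((c * \<epsilon> y) * 1, 1) 1 - Poly_Mapping.single (1, 1) (c * \<epsilon> y) \<in> ?W"
      unfolding balanced_rels_def by (intro fvs.span_base UnI1 bilinear_relsI(3)) (simp_all add: H1 del: One_nat_def)
    then show ?thesis
      using mem_cong_trans[OF W 1] by (simp add: fscale_single)
  qed
  have red: "\<exists>k. f - fscale k ?e \<in> ?W" for f :: "'k \<times> 'h \<Rightarrow>\<^sub>0 'k"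
    using span_singles[of f]
  proof (induction rule: fvs.span_induct_alt)
    case base
    show ?case
      using fvs.subspace_0[OF W] by (intro exI[of _ 0]) simp
  next
    case (step d f g)
    then obtain c y where f: "f = Poly_Mapping.single (c, y) 1"
      by fastforce
    obtain l where "g - fscale l ?e \<in> ?W"
      using step by blast
    with fvs.subspace_scale[OF W s[of c y], of d]
    have "fscale d (f - fscale (c * \<epsilon> y) ?e) + (g - fscale l ?e) \<in> ?W"
      unfolding f by (intro fvs.subspace_add[OF W])
    then show ?case
      by (intro exI[of _ "d * (c * \<epsilon> y) + l"]) (simp add: fvs.scale_right_diff_distrib fvs.scale_left_distrib algebra_simps)
  qed
  have "quotient_dim fscale ?V ?W (1 + 1)"
    using rank unfolding has_rank_def by blast
  then obtain B where B: "finite B" "card B = 2" "\<forall>u. (\<Sum>b\<in>B. fscale (u b) b) \<in> ?W \<longrightarrow> (\<forall>b\<in>B. u b = 0)"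
    unfolding quotient_dim_def one_add_one by blast
  then obtain p r where pr: "B = {p, r}" "p \<noteq> r"
    by (auto simp: card_2_iff)
  obtain k l where kl: "p - fscale k ?e \<in> ?W" "r - fscale l ?e \<in> ?W"
    using red by blast
  define u where "u b = (if l = 0 \<and> k = 0 then 1 else if b = p then l else - k)" for b
  have "fscale (u p) (p - fscale k ?e) + fscale (u r) (r - fscale l ?e) \<in> ?W"
    by (intro fvs.subspace_add[OF W] fvs.subspace_scale[OF W] kl)
  moreover have "fscale (u p) (p - fscale k ?e) + fscale (u r) (r - fscale l ?e) = (\<Sum>b\<in>B. fscale (u b) b)"
    using pr by (auto simp: u_def fvs.scale_right_diff_distrib mult.commute)
  ultimately have "u p = 0" "u r = 0"
    using B(3) pr by auto
  then show False
    using pr(2) by (auto simp: u_def split: if_splits)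
qed

end

section \<open>Quantum binomial coefficients\<close>

fun qbinomial :: "'k::field \<Rightarrow> nat \<Rightarrow> nat \<Rightarrow> 'k" where
  "qbinomial q n 0 = 1"
| "qbinomial q 0 (Suc k) = 0"
| "qbinomial q (Suc n) (Suc k) = q ^ Suc k * qbinomial q n (Suc k) + qbinomial q n k"

lemma qbinomial_eq_0: "n < k \<Longrightarrow> qbinomial q n k = 0"
  by (induction q n k rule: qbinomial.induct) auto

lemma qbinomial_self: "qbinomial q n n = 1"
  by (induction n) (auto simp: qbinomial_eq_0)

lemma qbinomial_one: "qbinomial q n 1 * (q - 1) = q ^ n - 1"
  by (induction n) (auto simp: algebra_simps)

lemma qbinomial_one_at_1: "qbinomial 1 n 1 = of_nat n"
  by (induction n) auto

text \<open>This is \<open>(q - 1)\<^sup>n [n]\<^sub>q!\<close>; the product formula for it holds without dividing by \<open>q - 1\<close>.\<close>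

definition qfactorial_unnormalized :: "'k::field \<Rightarrow> nat \<Rightarrow> 'k" where
  "qfactorial_unnormalized q n = (\<Prod>i\<in>{1..n}. q ^ i - 1)"

lemma qfactorial_Suc: "qfactorial_unnormalized q (Suc n) = qfactorial_unnormalized q n * (q ^ Suc n - 1)"
  by (simp add: qfactorial_unnormalized_def)

lemma qbinomial_qfactorial:
  "k \<le> n \<Longrightarrow> qbinomial q n k * (qfactorial_unnormalized q k * qfactorial_unnormalized q (n - k)) =
    qfactorial_unnormalized q n"
proof (induction n arbitrary: k)
  case 0
  then show ?case
    by (simp add: qfactorial_unnormalized_def)
next
  case (Suc n)
  let ?F = "qfactorial_unnormalized q"
  show ?case
  proof (cases k)
    case 0
    then show ?thesis
      by (simp add: qfactorial_unnormalized_def)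
  next
    case (Suc l)
    have l: "qbinomial q n l * (?F l * ?F (n - l)) = ?F n"
      using Suc.IH[of l] Suc Suc.prems by simp
    show ?thesis
    proof (cases "l = n")
      case True
      then show ?thesis
        using Suc by (simp add: qbinomial_self qbinomial_eq_0 qfactorial_unnormalized_def)
    next
      case False
      then have "Suc l \<le> n"
        using Suc Suc.prems by simp
      then obtain r where r: "n = Suc (l + r)"
        by (metis add_Suc le_Suc_ex)
      have a: "qbinomial q n (Suc l) * (?F (Suc l) * ?F r) = ?F n"
        using Suc.IH[of "Suc l"] r by simp
      have b: "?F (Suc r) = ?F r * (q ^ Suc r - 1)" "?F (Suc l) = ?F l * (q ^ Suc l - 1)"
        by (rule qfactorial_Suc)+
      have "qbinomial q (Suc n) k * (?F k * ?F (Suc n - k))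
          = q ^ Suc l * (q ^ Suc r - 1) * (qbinomial q n (Suc l) * (?F (Suc l) * ?F r))
            + (q ^ Suc l - 1) * (qbinomial q n l * (?F l * ?F (Suc r)))"
        using Suc r by (simp add: b algebra_simps)
      also have "\<dots> = ?F n * (q ^ Suc l * (q ^ Suc r - 1) + (q ^ Suc l - 1))"
        using l r unfolding a by (simp add: algebra_simps)
      also have "q ^ Suc l * (q ^ Suc r - 1) + (q ^ Suc l - 1) = q ^ Suc n - 1"
        unfolding r by (simp add: algebra_simps power_add)
      finally show ?thesis
        by (simp add: qfactorial_Suc)
    qed
  qed
qed

lemma primitive_root_qbinomial:
  assumes "primitive_root_of_unity m q" "0 < i" "i < m"
  shows "qbinomial q m i = 0"
proof -
  let ?F = "qfactorial_unnormalized q"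
  have nz: "?F j \<noteq> 0" if "j < m" for j
    using that assms(1) by (auto simp: qfactorial_unnormalized_def primitive_root_of_unity_def)
  have "?F m = 0"
    using assms by (auto simp: qfactorial_unnormalized_def primitive_root_of_unity_def intro!: prod_zero)
  then have "qbinomial q m i * (?F i * ?F (m - i)) = 0"
    using qbinomial_qfactorial[of i m q] assms by simp
  then show ?thesis
    using nz[of i] nz[of "m - i"] assms by simp
qed

section \<open>The structure of pointed Hopf algebras of rank one\<close>

lemma (in vector_space) independent_family_card:
  assumes "finite I" and ind: "\<And>c. (\<Sum>i\<in>I. scale (c i) (v i)) = 0 \<Longrightarrow> \<forall>i\<in>I. c i = 0"
    and B: "finite B" "span B = UNIV"
  shows "card I \<le> card B"
proof -
  have inj: "inj_on v I"
  proof (rule inj_onI, rule ccontr)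
    fix i j assume ij: "i \<in> I" "j \<in> I" "v i = v j" "i \<noteq> j"
    have "(\<Sum>l\<in>I. scale ((if l = i then 1 else 0) - (if l = j then 1 else 0)) (v l)) =
        (\<Sum>l\<in>I. (if l = i then v l else 0) - (if l = j then v l else 0))"
      by (intro sum.cong) (auto simp: scale_left_diff_distrib)
    also have "\<dots> = 0"
      using ij assms(1) by (simp add: sum_subtractf)
    finally show False
      using ind[of "\<lambda>l. (if l = i then 1 else 0) - (if l = j then 1 else 0)"] ij by auto
  qed
  have "independent (v ` I)"
  proof (rule independent_if_scalars_zero)
    show "finite (v ` I)"
      using assms(1) by simp
    fix f y assume f: "(\<Sum>y\<in>v ` I. scale (f y) y) = 0" and "y \<in> v ` I"
    have "(\<Sum>i\<in>I. scale (f (v i)) (v i)) = 0"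
      using f by (simp add: sum.reindex[OF inj])
    then show "f y = 0"
      using ind[of "\<lambda>i. f (v i)"] \<open>y \<in> v ` I\<close> by auto
  qed
  then have "card (v ` I) \<le> card B"
    using independent_span_bound[OF B(1)] B(2) by simp
  then show ?thesis
    by (simp add: card_image inj)
qed

context finite_dim_hopf_algebra
begin

lemma comult_sum_mult_grouplike:
  assumes "functional_on f" "functional_on h" "a \<in> G"
  shows "comult_sum (\<lambda>u v. f u * h v) (b * a) = comult_sum (\<lambda>b1 b2. f (b1 * a) * h (b2 * a)) b"
  unfolding comult_sum_functionals_mult[OF assms(1,2)]
  by (simp add: comult_sum_functionals_grouplike[OF functional_mult(1)[OF assms(1)] functional_mult(1)[OF assms(2)] assms(3)])

lemma skew_primitive_combination:
  assumes "skew_primitive H a b y" "skew_primitive H a b z"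
  shows "skew_primitive H a b (c \<cdot> y + d \<cdot> z)"
proof (rule skew_primitiveI)
  show "a \<in> G" "b \<in> G"
    using assms by (auto simp: skew_primitive_def)
  fix f h assume fh: "functional_on f" "functional_on h"
  show "comult_sum (\<lambda>u v. f u * h v) (c \<cdot> y + d \<cdot> z) = f a * h (c \<cdot> y + d \<cdot> z) + f (c \<cdot> y + d \<cdot> z) * h b"
    by (simp add: hv.functionalD(1,2)[OF functional_convolution[OF fh]] hv.functionalD(1,2)[OF fh(1)]
        hv.functionalD(1,2)[OF fh(2)] comult_sum_functionals_skew_primitive[OF fh assms(1)]
        comult_sum_functionals_skew_primitive[OF fh assms(2)] algebra_simps)
qed

lemma skew_primitive_grouplike_diff:
  assumes "a \<in> G"
  shows "skew_primitive H a 1 (a - 1)"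
proof (rule skew_primitiveI[OF assms one_grouplike])
  fix f h assume fh: "functional_on f" "functional_on h"
  show "comult_sum (\<lambda>u v. f u * h v) (a - 1) = f a * h (a - 1) + f (a - 1) * h 1"
    by (simp add: hv.functionalD(4)[OF functional_convolution[OF fh]] hv.functionalD(4)[OF fh(1)]
        hv.functionalD(4)[OF fh(2)] comult_sum_functionals_grouplike[OF fh] assms one_grouplike algebra_simps)
qed

lemma skew_primitive_conjugate:
  assumes "skew_primitive H g 1 y" "a \<in> G" "g * a = a * g"
  shows "skew_primitive H g 1 (a * y * \<S> a)"
proof (rule skew_primitiveI)
  show "g \<in> G" "1 \<in> G"
    using assms by (auto simp: skew_primitive_def)
  fix f h assume fh: "functional_on f" "functional_on h"
  have aga: "a * (g * \<S> a) = g"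
    using assms(3) grouplike_antipode(2)[OF assms(2)] by (metis mult.assoc mult_1_right)
  have "comult_sum (\<lambda>u v. f u * h v) (a * y * \<S> a) = comult_sum (\<lambda>u v. f (a * (u * \<S> a)) * h (a * (v * \<S> a))) y"
    using comult_sum_grouplike_mult[OF fh assms(2), of "y * \<S> a"]
      comult_sum_mult_grouplike[OF functional_mult(1)[OF fh(1)] functional_mult(1)[OF fh(2)] antipode_grouplike[OF assms(2)]]
    by (simp add: mult.assoc)
  also have "\<dots> = f g * h (a * y * \<S> a) + f (a * y * \<S> a) * h 1"
    using comult_sum_functionals_skew_primitive[OF functional_mult(2)[OF functional_mult(1)[OF fh(1)]]
        functional_mult(2)[OF functional_mult(1)[OF fh(2)]] assms(1)]
    by (simp add: aga mult.assoc grouplike_antipode(2)[OF assms(2)])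
  finally show "comult_sum (\<lambda>u v. f u * h v) (a * y * \<S> a) = f g * h (a * y * \<S> a) + f (a * y * \<S> a) * h 1" .
qed

text \<open>A \<open>q\<close>-commuting skew-primitive element obeys the quantum binomial theorem.\<close>

context
  fixes g y q
  assumes y: "skew_primitive H g 1 y" and q: "g * y = q \<cdot> (y * g)"
begin

lemma g_power_y: "g * y ^ n = q ^ n \<cdot> (y ^ n * g)"
proof (induction n)
  case (Suc n)
  have "g * y ^ Suc n = q \<cdot> (y * (g * y ^ n))"
    by (simp add: q scl_mult_left mult.assoc[symmetric])
  then show ?case
    by (simp add: Suc scl_mult_right scl_mult_left mult.assoc)
qed simp

lemma comult_sum_power:
  assumes "functional_on f" "functional_on h" "a \<in> G"
  shows "comult_sum (\<lambda>u v. f u * h v) (y ^ n * a) =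
    (\<Sum>i\<le>n. qbinomial q n i * (f (y ^ i * g ^ (n - i) * a) * h (y ^ (n - i) * a)))"
  using assms(1,2)
proof (induction n arbitrary: f h)
  case 0
  then show ?case
    by (simp add: comult_sum_functionals_grouplike assms(3))
next
  case (Suc n)
  note fh = Suc.prems
  define T where "T i = f (y ^ i * g ^ (Suc n - i) * a) * h (y ^ (Suc n - i) * a)" for i
  have 1: "f (g * (y ^ i * g ^ (n - i) * a)) * h (y * (y ^ (n - i) * a)) = q ^ i * T i" if "i \<le> n" for i
  proof -
    have "g * (y ^ i * g ^ (n - i) * a) = q ^ i \<cdot> (y ^ i * g ^ (Suc n - i) * a)"
      using that by (simp add: mult.assoc[symmetric] g_power_y scl_mult_left Suc_diff_le)
    then show ?thesis
      using that by (simp add: T_def hv.functionalD(2)[OF fh(1)] Suc_diff_le mult.assoc)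
  qed
  have 2: "f (y * (y ^ i * g ^ (n - i) * a)) * h (y ^ (n - i) * a) = T (Suc i)" for i
    by (simp add: T_def mult.assoc)
  have "comult_sum (\<lambda>u v. f u * h v) (y ^ Suc n * a) =
      comult_sum (\<lambda>u v. f (g * u) * h (y * v)) (y ^ n * a) + comult_sum (\<lambda>u v. f (y * u) * h v) (y ^ n * a)"
    using comult_sum_skew_primitive_mult[OF fh y, of "y ^ n * a"] by (simp add: mult.assoc)
  also have "\<dots> = (\<Sum>i\<le>n. qbinomial q n i * (q ^ i * T i)) + (\<Sum>i\<le>n. qbinomial q n i * T (Suc i))"
    by (simp add: Suc.IH[OF functional_mult(1)[OF fh(1)] functional_mult(1)[OF fh(2)]]
        Suc.IH[OF functional_mult(1)[OF fh(1)] fh(2)] 1 2)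
  also have "(\<Sum>i\<le>n. qbinomial q n i * (q ^ i * T i)) = (\<Sum>i\<le>Suc n. qbinomial q n i * (q ^ i * T i))"
    by (simp add: qbinomial_eq_0)
  also have "\<dots> = T 0 + (\<Sum>i\<le>n. qbinomial q n (Suc i) * (q ^ Suc i * T (Suc i)))"
    by (subst sum.atMost_Suc_shift) simp
  also have "\<dots> + (\<Sum>i\<le>n. qbinomial q n i * T (Suc i)) = T 0 + (\<Sum>i\<le>n. qbinomial q (Suc n) (Suc i) * T (Suc i))"
    by (simp add: sum.distrib[symmetric] algebra_simps)
  also have "\<dots> = (\<Sum>i\<le>Suc n. qbinomial q (Suc n) i * T i)"
    by (subst sum.atMost_Suc_shift) simp
  finally show ?case
    by (simp only: T_def)
qed

text \<open>Induction on the degree. Suppose that there is a relation whose degree in \<open>y\<close> is \<open>d\<close>.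
  For \<open>d \<ge> 2\<close> let \<open>f\<close> and \<open>h\<close> be dual to \<open>y g\<^sup>d\<^sup>-\<^sup>1 b\<close> and to \<open>y\<^sup>d\<^sup>-\<^sup>1 b\<close> in the independent family of elements
  of lower degree. In \<open>\<Delta> (y\<^sup>j a)\<close> the product of \<open>f\<close> and \<open>h\<close> sees only terms of bidegree \<open>(1, d - 1)\<close>: terms
  containing \<open>y\<^sup>d\<close>, on which \<open>f\<close> or \<open>h\<close> is unknown, have a grouplike other factor, on which the other
  functional vanishes. So the product picks out the coefficient of \<open>y\<^sup>d b\<close> times \<open>[d]\<^sub>q\<close>.
  For \<open>d = 1\<close> the functional \<open>h\<close> vanishes on \<open>kG\<close> but not on \<open>y b\<close>.\<close>

lemma powers_independent:
  assumes "y \<notin> hv.span G" and "\<And>i. 0 < i \<Longrightarrow> i < d \<Longrightarrow> qbinomial q i 1 \<noteq> 0"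
    and "(\<Sum>p\<in>{..<d} \<times> G. c p \<cdot> (y ^ fst p * snd p)) = 0"
  shows "\<forall>p\<in>{..<d} \<times> G. c p = 0"
  using assms(2,3)
proof (induction d arbitrary: c)
  case (Suc d)
  have g: "g \<in> G"
    using y by (simp add: skew_primitive_def)
  have IH: "\<And>c. (\<Sum>p\<in>{..<d} \<times> G. c p \<cdot> (y ^ fst p * snd p)) = 0 \<Longrightarrow> \<forall>p\<in>{..<d} \<times> G. c p = 0"
    using Suc.IH Suc.prems(1) by simp
  have fin: "finite ({..<n} \<times> G)" for n :: nat
    using finite_grouplikes by simp
  have split: "{..<Suc d} \<times> G = {..<d} \<times> G \<union> {d} \<times> G"
    by auto
  have dual: "\<exists>f. functional_on f \<and> (\<forall>i<d. \<forall>a\<in>G. f (y ^ i * a) = (if i = j \<and> a = b then 1 else 0))"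
    if "j < d" "b \<in> G" for j b
  proof -
    have "(j, b) \<in> {..<d} \<times> G"
      using that by simp
    from hv.dual_family[where v = "\<lambda>p. y ^ fst p * snd p", OF fin IH this]
    obtain f where "functional_on f" "\<forall>p\<in>{..<d} \<times> G. f (y ^ fst p * snd p) = (if p = (j, b) then 1 else 0)"
      by blast
    then show ?thesis
      by (intro exI[of _ f]) auto
  qed
  \<comment> \<open>It is enough to find functionals whose product picks out the coefficient of \<open>y\<^sup>d b\<close>.\<close>
  have top: "c (d, b) = 0" if b: "b \<in> G" for b
  proof -
    have "\<exists>f h k. functional_on f \<and> functional_on h \<and> k \<noteq> 0 \<and>
        (\<forall>j\<le>d. \<forall>a\<in>G. comult_sum (\<lambda>u v. f u * h v) (y ^ j * a) = (if j = d \<and> a = b then k else 0))"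
    proof -
      consider "d = 0" | "d = 1" | "d \<ge> 2"
        by linarith
      then show ?thesis
      proof cases
        case 1
        obtain f where "functional_on f" "\<And>a. a \<in> G \<Longrightarrow> f a = (if a = b then 1 else 0)"
          using grouplike_functional[OF b] by blast
        then show ?thesis
          using 1 by (intro exI[of _ f] exI[of _ 1]) (auto simp: comult_sum_functionals_grouplike)
      next
        case 2
        obtain f where f: "functional_on f" "\<And>a. a \<in> G \<Longrightarrow> f a = (if a = g * b then 1 else 0)"
          using grouplike_functional[OF grouplike_mult[OF g b]] by blast
        have "y * b \<notin> hv.span G"
        proof
          assume "y * b \<in> hv.span G"
          then have "y * b * \<S> b \<in> hv.span G"
            by (rule span_mult[where B = G])
              (auto intro: hv.span_base grouplike_mult antipode_grouplike b)
          then show False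
            using assms(1) b by (simp add: mult.assoc grouplike_antipode)
        qed
        then obtain h where h: "functional_on h" "\<And>a. a \<in> hv.span G \<Longrightarrow> h a = 0" "h (y * b) = 1"
          using hv.separating_functional by blast
        have hG: "h a = 0" if "a \<in> G" for a
          using that h(2) hv.span_base by blast
        have "comult_sum (\<lambda>u v. f u * h v) (y ^ j * a) = (if j = d \<and> a = b then 1 else 0)"
          if "j \<le> d" "a \<in> G" for j a
        proof -
          have "j = 0 \<or> j = 1"
            using that 2 by linarith
          then show ?thesis
            using comult_sum_power[OF f(1) h(1) that(2), of j] that 2 b g
            by (auto simp: hG f h(3) grouplike_mult grouplike_cancel)
        qed
        then show ?thesis
          using f(1) h(1) by (metis zero_neq_one)
      next
        case 3
        have d: "1 < d" "d - 1 < d" and gb: "g ^ (d - 1) * b \<in> G"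
          using 3 g b grouplike_mult grouplike_power by auto
        obtain f where f: "functional_on f"
          "\<And>i a. i < d \<Longrightarrow> a \<in> G \<Longrightarrow> f (y ^ i * a) = (if i = 1 \<and> a = g ^ (d - 1) * b then 1 else 0)"
          using dual[OF d(1) gb] by blast
        obtain h where h: "functional_on h"
          "\<And>i a. i < d \<Longrightarrow> a \<in> G \<Longrightarrow> h (y ^ i * a) = (if i = d - 1 \<and> a = b then 1 else 0)"
          using dual[OF d(2) b] by blast
        have "comult_sum (\<lambda>u v. f u * h v) (y ^ j * a) = (if j = d \<and> a = b then qbinomial q d 1 else 0)"
          if j: "j \<le> d" and a: "a \<in> G" for j a
        proof -
          have summand: "f (y ^ i * g ^ (j - i) * a) * h (y ^ (j - i) * a) = (if i = 1 \<and> j = d \<and> a = b then 1 else 0)"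
            if "i \<le> j" for i
          proof -
            have ga: "g ^ (j - i) * a \<in> G"
              using g a grouplike_mult grouplike_power by blast
            show ?thesis
            proof (cases "i < d")
              case True
              then have fi: "f (y ^ i * g ^ (j - i) * a) = (if i = 1 \<and> g ^ (j - i) * a = g ^ (d - 1) * b then 1 else 0)"
                using f(2)[OF True ga] by (simp add: mult.assoc)
              show ?thesis
              proof (cases "i = 1")
                case True
                have "j - 1 < d"
                  using j 3 by simp
                then show ?thesis
                  using fi True h(2)[OF _ a, of "j - 1"] that j 3 grouplike_cancel(1)[OF grouplike_power[OF g]]
                  by auto
              next
                case False
                then show ?thesis
                  using fi by simp
              qed
            next
              case False
              then have "i = d" "j = d"
                using that j by auto
              then show ?thesis
                using h(2)[of 0 a] a 3 by simp
            qed
          qed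
          have "comult_sum (\<lambda>u v. f u * h v) (y ^ j * a) =
              (\<Sum>i\<le>j. if i = 1 then if j = d \<and> a = b then qbinomial q j 1 else 0 else 0)"
            unfolding comult_sum_power[OF f(1) h(1) a] by (intro sum.cong) (auto simp: summand)
          then show ?thesis
            using 3 by auto
        qed
        moreover have "qbinomial q d 1 \<noteq> 0"
          using Suc.prems(1)[of d] 3 by simp
        ultimately show ?thesis
          using f(1) h(1) by blast
      qed
    qed
    then obtain f h k where fhk: "functional_on f" "functional_on h" "k \<noteq> 0"
      "\<And>j a. j \<le> d \<Longrightarrow> a \<in> G \<Longrightarrow> comult_sum (\<lambda>u v. f u * h v) (y ^ j * a) = (if j = d \<and> a = b then k else 0)"
      by blast
    have "0 = comult_sum (\<lambda>u v. f u * h v) (\<Sum>p\<in>{..<Suc d} \<times> G. c p \<cdot> (y ^ fst p * snd p))"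
      unfolding Suc.prems(2) by (simp add: hv.functionalD(3)[OF functional_convolution[OF fhk(1,2)]])
    also have "\<dots> = (\<Sum>p\<in>{..<Suc d} \<times> G. if p = (d, b) then c p * k else 0)"
      unfolding hv.functionalD(6)[OF functional_convolution[OF fhk(1,2)]]
      by (intro sum.cong) (auto simp: hv.functionalD(2)[OF functional_convolution[OF fhk(1,2)]] fhk(4) split: if_splits)
    also have "\<dots> = c (d, b) * k"
      using b by (simp add: fin)
    finally show ?thesis
      using fhk(3) by simp
  qed
  have "(\<Sum>p\<in>{..<Suc d} \<times> G. c p \<cdot> (y ^ fst p * snd p)) =
      (\<Sum>p\<in>{..<d} \<times> G. c p \<cdot> (y ^ fst p * snd p)) + (\<Sum>p\<in>{d} \<times> G. c p \<cdot> (y ^ fst p * snd p))"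
    unfolding split by (rule sum.union_disjoint) (use finite_grouplikes in auto)
  also have "(\<Sum>p\<in>{d} \<times> G. c p \<cdot> (y ^ fst p * snd p)) = 0"
    using top by (intro sum.neutral) auto
  finally have "\<forall>p\<in>{..<d} \<times> G. c p = 0"
    using IH[of c] Suc.prems(2) by simp
  then show ?case
    unfolding split using top by blast
qed simp

end

end

locale rank_one_hopf_algebra = pointed_hopf_algebra H
  for H :: "('k::field_char_0, 'h::ring_1) hopf" +
  fixes g x :: 'h
  assumes rank: "has_rank H 1"
    and g_center: "g \<in> grouplike_center H"
    and x_skew: "skew_primitive H g 1 x"
    and generated: "generated_subalgebra H (grouplikes H \<union> {x}) = UNIV"
begin

lemma g_grouplike: "g \<in> G"
  using g_center by (simp add: grouplike_center_def)

lemma g_comm: "a \<in> G \<Longrightarrow> g * a = a * g"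
  using g_center by (simp add: grouplike_center_def)

lemma g_comm_kG: "a \<in> kG \<Longrightarrow> g * a = a * g"
  by (induction rule: hv.span_induct_alt) (auto simp: distrib_left distrib_right scl_mult_left scl_mult_right g_comm)

lemma generated_subset:
  assumes "is_subalgebra H K" "G \<subseteq> K" "x \<in> K"
  shows "K = UNIV"
  using assms generated by (auto simp: generated_subalgebra_def)

lemma x_notin_kG: "x \<notin> kG"
proof
  assume x: "x \<in> kG"
  have "is_subalgebra H kG"
    by (auto simp: is_subalgebra_def kG_mult intro: grouplike_in_kG one_grouplike)
  then have "kG = UNIV"
    by (rule generated_subset) (auto intro: grouplike_in_kG x)
  with rank_one_not_group_algebra[OF rank] show False ..
qed

lemma kG_grouplike_mult_iff:
  assumes "a \<in> G"
  shows "a * y \<in> kG \<longleftrightarrow> y \<in> kG" "y * a \<in> kG \<longleftrightarrow> y \<in> kG"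
proof -
  note a = grouplike_in_kG[OF assms] grouplike_in_kG[OF antipode_grouplike[OF assms]]
  show "a * y \<in> kG \<longleftrightarrow> y \<in> kG"
    using kG_mult[OF a(1), of y] kG_mult[OF a(2), of "a * y"] grouplike_antipode(1)[OF assms]
    by (auto simp: mult.assoc[symmetric])
  show "y * a \<in> kG \<longleftrightarrow> y \<in> kG"
    using kG_mult[OF _ a(1), of y] kG_mult[OF _ a(2), of "y * a"] grouplike_antipode(2)[OF assms]
    by (auto simp: mult.assoc)
qed

text \<open>Rank one means that modulo the group algebra and up to translation \<open>x\<close> is the only
  skew-primitive element: \<open>y\<close> and \<open>x\<close>, moved to degree \<open>1\<close>, are dependent modulo \<open>kG\<close>, and \<open>x\<close> is not
  in \<open>kG\<close>.\<close>

lemma skew_primitive_decomposition: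
  assumes "skew_primitive H a b y"
  shows "\<exists>c. \<S> a * y - c \<cdot> (\<S> g * x) \<in> kG"
proof -
  obtain c1 c2 where c: "c1 \<noteq> 0 \<or> c2 \<noteq> 0" "c1 \<cdot> (\<S> a * y) + c2 \<cdot> (\<S> g * x) \<in> kG"
    using rank_one_skew_primitives_dependent[OF rank assms x_skew] by blast
  have "c1 \<noteq> 0"
  proof
    assume "c1 = 0"
    then have c2: "c2 \<noteq> 0" "c2 \<cdot> (\<S> g * x) \<in> kG"
      using c by auto
    from hv.span_scale[OF c2(2), of "1 / c2"] have "\<S> g * x \<in> kG"
      using c2(1) by simp
    then show False
      using x_notin_kG kG_grouplike_mult_iff(1)[OF antipode_grouplike[OF g_grouplike]] by simp
  qed
  have "(1 / c1) \<cdot> (c1 \<cdot> (\<S> a * y) + c2 \<cdot> (\<S> g * x)) \<in> kG"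
    by (rule hv.span_scale[OF c(2)])
  then show ?thesis
    using \<open>c1 \<noteq> 0\<close> by (intro exI[of _ "- c2 / c1"]) (simp add: hv.scale_right_distrib)
qed

text \<open>The convolution square of the coordinate functional of \<open>b\<close> takes on \<open>z\<close> the value of the coordinate itself,
  because \<open>z\<close> is in \<open>kG\<close>, and it is zero for \<open>b \<noteq> a, 1\<close>, because \<open>z\<close> is skew-primitive. The counit relates
  the remaining two coordinates; for \<open>a = 1\<close> there is only one, and it equals its double.\<close>

lemma kG_skew_primitive:
  assumes "z \<in> kG" "skew_primitive H a 1 z"
  shows "\<exists>c. z = c \<cdot> (a - 1)"
proof -
  have a: "a \<in> G"
    using assms by (simp add: skew_primitive_def)
  obtain t where z: "z = (\<Sum>b\<in>G. t b \<cdot> b)"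
    using assms(1) unfolding hv.span_finite[OF finite_grouplikes] by blast
  have ct: "coord b z = t b" if "b \<in> G" for b
  proof -
    have "coord b z = (\<Sum>c\<in>G. if c = b then t c else 0)"
      unfolding z hv.functionalD(6)[OF coord(1)[OF that]]
      using that by (intro sum.cong) (auto simp: hv.functionalD(2)[OF coord(1)] coord(2))
    then show ?thesis
      using that finite_grouplikes by simp
  qed
  have sq: "comult_sum (\<lambda>u v. coord b u * coord b v) z = t b" if "b \<in> G" for b
  proof -
    note lin = functional_convolution[OF coord(1)[OF that] coord(1)[OF that]]
    have "comult_sum (\<lambda>u v. coord b u * coord b v) z = (\<Sum>c\<in>G. if c = b then t c else 0)"
      unfolding z hv.functionalD(6)[OF lin]
      using that by (intro sum.cong) (auto simp: hv.functionalD(2)[OF lin] comult_sum_functionals_grouplike coord)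
    then show ?thesis
      using that finite_grouplikes by simp
  qed
  have t: "t b = coord b a * t b + t b * coord b 1" if "b \<in> G" for b
    using sq[OF that] comult_sum_functionals_skew_primitive[OF coord(1)[OF that] coord(1)[OF that] assms(2)]
    by (simp add: ct that)
  have t0: "t b = 0" if "b \<in> G" "b \<noteq> a" "b \<noteq> 1" for b
    using t[OF that(1)] that a one_grouplike by (simp add: coord)
  show ?thesis
  proof (cases "a = 1")
    case True
    have "t 1 = t 1 + t 1"
      using t[OF one_grouplike] True by (simp add: coord one_grouplike)
    then have "t 1 = 0"
      by simp
    then have "t b = 0" if "b \<in> G" for b
      using t0 that True by (cases "b = 1") auto
    then show ?thesis
      by (simp add: z)
  next
    case False
    have "z = (\<Sum>b\<in>{a, 1}. t b \<cdot> b)"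
      unfolding z using t0 a one_grouplike finite_grouplikes by (intro sum.mono_neutral_right) auto
    then have z': "z = t a \<cdot> a + t 1 \<cdot> 1"
      using False by simp
    have "\<epsilon> z = 0"
      by (rule skew_primitive_counit_antipode(1)[OF assms(2)])
    then have "t 1 = - t a"
      unfolding z' by (simp add: counit_add counit_scl counit_one counit_grouplike[OF a] add_eq_0_iff2)
    then show ?thesis
      unfolding z' by (intro exI[of _ "t a"]) (simp add: hv.scale_right_diff_distrib)
  qed
qed

lemma skew_primitive_span:
  assumes "skew_primitive H g 1 y"
  shows "\<exists>c d. y = c \<cdot> x + d \<cdot> (g - 1)"
proof -
  obtain c where "\<S> g * y - c \<cdot> (\<S> g * x) \<in> kG"
    using skew_primitive_decomposition[OF assms] by blast
  then have "\<S> g * (y - c \<cdot> x) \<in> kG"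
    by (simp add: right_diff_distrib scl_mult_right)
  then have "1 \<cdot> y + (- c) \<cdot> x \<in> kG"
    using kG_grouplike_mult_iff(1)[OF antipode_grouplike[OF g_grouplike]] by simp
  then obtain d where "1 \<cdot> y + (- c) \<cdot> x = d \<cdot> (g - 1)"
    using kG_skew_primitive skew_primitive_combination[OF assms x_skew] by blast
  then have "y = c \<cdot> x + d \<cdot> (g - 1)"
    by (simp add: algebra_simps)
  then show ?thesis
    by blast
qed

lemma conjugate_x:
  assumes "a \<in> G"
  shows "\<exists>c d. a * x = c \<cdot> (x * a) + d \<cdot> ((g - 1) * a)"
proof -
  obtain c d where "a * x * \<S> a = c \<cdot> x + d \<cdot> (g - 1)"
    using skew_primitive_span[OF skew_primitive_conjugate[OF x_skew assms g_comm[OF assms]]] by blast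
  then have "a * x * \<S> a * a = (c \<cdot> x + d \<cdot> (g - 1)) * a"
    by simp
  then have "a * x = c \<cdot> (x * a) + d \<cdot> ((g - 1) * a)"
    using grouplike_antipode(1)[OF assms] by (simp add: mult.assoc distrib_right scl_mult_left)
  then show ?thesis
    by blast
qed

text \<open>If \<open>g x = x g + d (g - 1) g\<close>, then \<open>g\<^sup>n x = x g\<^sup>n + n d (g - 1) g\<^sup>n\<close>, and in
  characteristic zero the finite order of \<open>g\<close> forces \<open>d (g - 1) = 0\<close>. Otherwise the eigenvalues
  of the conjugation by \<open>g\<close> on the span of \<open>x\<close> and \<open>g - 1\<close> differ.\<close>

lemma normalize_x: "\<exists>c q. g * (x + c \<cdot> (g - 1)) = q \<cdot> ((x + c \<cdot> (g - 1)) * g)"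
proof -
  obtain q d where q: "g * x = q \<cdot> (x * g) + d \<cdot> ((g - 1) * g)"
    using conjugate_x[OF g_grouplike] by blast
  have gg: "g * (g - 1) = (g - 1) * g"
    by (simp add: left_diff_distrib right_diff_distrib)
  show ?thesis
  proof (cases "q = 1")
    case False
    define c where "c = d / (q - 1)"
    have "d + c = q * c"
      using False by (simp add: c_def field_simps)
    have "g * (x + c \<cdot> (g - 1)) = q \<cdot> (x * g) + (d + c) \<cdot> ((g - 1) * g)"
      by (simp add: distrib_left scl_mult_right q gg hv.scale_left_distrib)
    also have "\<dots> = q \<cdot> ((x + c \<cdot> (g - 1)) * g)"
      unfolding \<open>d + c = q * c\<close> by (simp add: distrib_right scl_mult_left hv.scale_right_distrib)
    finally show ?thesis
      by blast
  next
    case True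
    have *: "g ^ n * x = x * g ^ n + (of_nat n * d) \<cdot> ((g - 1) * g ^ n)" for n
    proof (induction n)
      case (Suc n)
      have "g ^ Suc n * x = g * (g ^ n * x)"
        by (simp add: mult.assoc)
      also have "\<dots> = (g * x) * g ^ n + (of_nat n * d) \<cdot> ((g * (g - 1)) * g ^ n)"
        by (simp add: Suc distrib_left scl_mult_right mult.assoc)
      also have "\<dots> = x * g ^ Suc n + (of_nat (Suc n) * d) \<cdot> ((g - 1) * g ^ Suc n)"
        using True by (simp add: q gg distrib_right scl_mult_left mult.assoc hv.scale_left_distrib)
      finally show ?case .
    qed simp
    obtain n where n: "n > 0" "g ^ n = 1"
      using grouplike_finite_order[OF g_grouplike] by blast
    then have "(of_nat n * d) \<cdot> (g - 1) = 0"
      using *[of n] by simp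
    then have "d \<cdot> (g - 1) = 0"
      using n by auto
    then have "g * x = 1 \<cdot> (x * g)"
      using q True by (metis scl_mult_left mult_zero_left add.right_neutral)
    then show ?thesis
      by (intro exI[of _ 0] exI[of _ 1]) simp
  qed
qed

lemma rank_one_shift: "rank_one_hopf_algebra H g (x + c \<cdot> (g - 1))"
proof (unfold_locales)
  let ?y = "x + c \<cdot> (g - 1)"
  show "has_rank H 1" "g \<in> grouplike_center H"
    by (rule rank g_center)+
  show "skew_primitive H g 1 ?y"
    using skew_primitive_combination[OF x_skew skew_primitive_grouplike_diff[OF g_grouplike], of 1 c] by simp
  have "K = UNIV" if K: "is_subalgebra H K" "G \<union> {?y} \<subseteq> K" for K
  proof (rule generated_subset)
    show "is_subalgebra H K" "G \<subseteq> K"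
      using K by auto
    have sub: "hv.subspace K"
      using K by (simp add: is_subalgebra_def)
    have "g \<in> K" "1 \<in> K" "?y \<in> K"
      using K g_grouplike by (auto simp: is_subalgebra_def)
    then have "?y - c \<cdot> (g - 1) \<in> K"
      by (intro hv.subspace_diff[OF sub] hv.subspace_scale[OF sub])
    then show "x \<in> K"
      by simp
  qed
  then show "generated_subalgebra H (G \<union> {?y}) = UNIV"
    unfolding generated_subalgebra_def by blast
qed

end

text \<open>From here on \<open>x\<close> is chosen as in \<open>normalize_x\<close>. The scalar \<open>q\<close> is the value \<open>\<chi>(g)\<close> of the character
  that describes the commutation of \<open>x\<close> with \<open>G\<close>.\<close>

locale normalized_rank_one_hopf_algebra = rank_one_hopf_algebra H g x
  for H :: "('k::field_char_0, 'h::ring_1) hopf" and g x +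
  fixes q :: 'k
  assumes gx: "g * x = q \<cdot> (x * g)"
begin

definition m :: nat where
  "m = (LEAST i. 0 < i \<and> qbinomial q i 1 = 0)"

text \<open>If no quantum integer vanished, all the elements \<open>x\<^sup>j a\<close> would be independent,
  contradicting the finite dimension. So \<open>q\<close> is a root of unity, and \<open>q \<noteq> 1\<close> since the characteristic is zero.\<close>

lemma m_exists: "\<exists>i. 0 < i \<and> qbinomial q i 1 = 0"
proof (rule ccontr)
  assume "\<not> ?thesis"
  then have nz: "\<And>i. 0 < i \<Longrightarrow> qbinomial q i 1 \<noteq> 0"
    by blast
  obtain B where B: "finite B" "hv.span B = UNIV"
    using fin_dim by (auto simp: finite_dim_def)
  let ?I = "{..<Suc (card B)} \<times> G"
  have "card ?I \<le> card B"
    by (rule hv.independent_family_card[where v = "\<lambda>p. x ^ fst p * snd p", OF _ _ B])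
      (use finite_grouplikes powers_independent[OF x_skew gx x_notin_kG nz] in auto)
  moreover have "card G > 0"
    using one_grouplike finite_grouplikes by (auto simp: card_gt_0_iff)
  ultimately show False
    by (simp add: card_cartesian_product) (metis Suc_n_not_le_n add_leD1 le_trans mult_le_mono2 mult.right_neutral
        One_nat_def Suc_leI add.commute mult_Suc)
qed

lemma m: "0 < m" "qbinomial q m 1 = 0" "0 < i \<Longrightarrow> i < m \<Longrightarrow> qbinomial q i 1 \<noteq> 0"
  using LeastI_ex[OF m_exists] not_less_Least[of i "\<lambda>i. 0 < i \<and> qbinomial q i 1 = 0"]
  unfolding m_def by blast+

lemma m_ge_2: "m \<ge> 2"
  using m by (cases "m = 1") (auto simp: numeral_2_eq_2)

lemma q_neq_1: "q \<noteq> 1"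
proof
  assume "q = 1"
  then have "of_nat m = (0 :: 'k)"
    using m(2) qbinomial_one_at_1 by metis
  with m(1) show False
    by simp
qed

lemma q_primitive: "primitive_root_of_unity m q"
  unfolding primitive_root_of_unity_def
proof (intro conjI allI impI)
  show "q ^ m = 1"
    using qbinomial_one[of q m] m(2) by simp
  show "q ^ j \<noteq> 1" if "0 < j \<and> j < m" for j
    using qbinomial_one[of q j] m(3)[of j] q_neq_1 that by auto
qed

lemma q_neq_0: "q \<noteq> 0"
  using q_primitive m(1) by (auto simp: primitive_root_of_unity_def power_0_left)

lemma powers_indep:
  "(\<Sum>p\<in>{..<m} \<times> G. c p \<cdot> (x ^ fst p * snd p)) = 0 \<Longrightarrow> \<forall>p\<in>{..<m} \<times> G. c p = 0"
  using powers_independent[OF x_skew gx x_notin_kG m(3)] by blast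

lemma g_neq_1: "g \<noteq> 1"
proof
  assume "g = 1"
  then have "1 \<cdot> x = q \<cdot> x"
    using gx by simp
  then show False
    using q_neq_1 x_notin_kG hv.span_zero by (metis hv.scale_cancel_right)
qed

text \<open>Conjugation by \<open>g\<close> commutes with conjugation by \<open>a\<close> and separates \<open>x\<close> from \<open>g - 1\<close>, so that \<open>x\<close> is an
  eigenvector of conjugation by \<open>a\<close>, too.\<close>

lemma x_char_exists: "a \<in> G \<Longrightarrow> \<exists>c. a * x = c \<cdot> (x * a)"
proof -
  assume a: "a \<in> G"
  obtain c d where cd: "a * x = c \<cdot> (x * a) + d \<cdot> ((g - 1) * a)"
    using conjugate_x[OF a] by blast
  have gga: "g * ((g - 1) * a) = (g - 1) * a * g"
    by (simp add: left_diff_distrib right_diff_distrib g_comm[OF a, symmetric] mult.assoc)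
  have "q \<cdot> (a * x * g) = a * (g * x)"
    by (simp add: gx scl_mult_right mult.assoc)
  also have "\<dots> = g * (a * x)"
    by (simp add: g_comm[OF a] mult.assoc[symmetric])
  also have "\<dots> = c \<cdot> (g * x * a) + d \<cdot> (g * ((g - 1) * a))"
    by (simp add: cd distrib_left scl_mult_right mult.assoc)
  also have "\<dots> = q \<cdot> c \<cdot> (x * a * g) + d \<cdot> ((g - 1) * a * g)"
    by (simp only: gx gga) (simp add: scl_mult_left mult.assoc g_comm[OF a] mult.commute)
  finally have "(q \<cdot> c \<cdot> (x * a) + q \<cdot> d \<cdot> ((g - 1) * a)) * g = (q \<cdot> c \<cdot> (x * a) + d \<cdot> ((g - 1) * a)) * g"
    unfolding cd by (simp add: distrib_right scl_mult_left hv.scale_right_distrib)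
  then have "q \<cdot> d \<cdot> ((g - 1) * a) = d \<cdot> ((g - 1) * a)"
    by (simp add: grouplike_cancel(2)[OF g_grouplike])
  then have "((q - 1) * d) \<cdot> ((g - 1) * a) = 0"
    by (simp add: left_diff_distrib hv.scale_left_diff_distrib)
  then have "d \<cdot> ((g - 1) * a) = 0"
    using q_neq_1 by auto
  then show ?thesis
    using cd by auto
qed

definition chi :: "'h \<Rightarrow> 'k" where
  "chi a = (SOME c. a * x = c \<cdot> (x * a))"

lemma chi: "a \<in> G \<Longrightarrow> a * x = chi a \<cdot> (x * a)"
  unfolding chi_def by (rule someI_ex[OF x_char_exists])

lemma x_grouplike_neq_0: "a \<in> G \<Longrightarrow> x * a \<noteq> 0"
  using kG_grouplike_mult_iff(2)[of a x] x_notin_kG hv.span_zero by metis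

lemma chi_unique: "a \<in> G \<Longrightarrow> a * x = c \<cdot> (x * a) \<Longrightarrow> chi a = c"
  using chi[of a] x_grouplike_neq_0[of a] by (metis hv.scale_cancel_right)

lemma chi_g: "chi g = q"
  by (rule chi_unique[OF g_grouplike gx])

lemma chi_one: "chi 1 = 1"
  by (rule chi_unique[OF one_grouplike]) simp

lemma chi_mult: "a \<in> G \<Longrightarrow> b \<in> G \<Longrightarrow> chi (a * b) = chi a * chi b"
proof (rule chi_unique[OF grouplike_mult])
  assume ab: "a \<in> G" "b \<in> G"
  have "a * b * x = chi b \<cdot> (a * x * b)"
    by (simp add: mult.assoc chi[OF ab(2)] scl_mult_right)
  also have "\<dots> = (chi a * chi b) \<cdot> (x * (a * b))"
    by (simp add: chi[OF ab(1)] scl_mult_left mult.assoc mult.commute)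
  finally show "a * b * x = (chi a * chi b) \<cdot> (x * (a * b))" .
qed

lemma grouplike_x_power: "a \<in> G \<Longrightarrow> a * x ^ n = chi a ^ n \<cdot> (x ^ n * a)"
proof (induction n)
  case (Suc n)
  have "a * x ^ Suc n = chi a \<cdot> (x * (a * x ^ n))"
    by (simp add: chi[OF Suc.prems] scl_mult_left mult.assoc[symmetric])
  then show ?case
    by (simp add: Suc scl_mult_right scl_mult_left mult.assoc)
qed simp

lemma chi_power: "a \<in> G \<Longrightarrow> chi (a ^ n) = chi a ^ n"
  by (induction n) (auto simp: chi_one chi_mult grouplike_power)

text \<open>The inner quantum binomial coefficients of \<open>m\<close> vanish, so that \<open>x\<^sup>m\<close> is skew-primitive. Since it
  commutes with \<open>g\<close>, it has no component along the translates of \<open>x\<close>.\<close>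

lemma x_power_m: "\<exists>c. x ^ m = c \<cdot> (g ^ m - 1)"
proof -
  have gm: "g ^ m \<in> G"
    by (rule grouplike_power[OF g_grouplike])
  have skew: "skew_primitive H (g ^ m) 1 (x ^ m)"
  proof (rule skew_primitiveI[OF gm one_grouplike])
    fix f h assume fh: "functional_on f" "functional_on h"
    let ?t = "\<lambda>i. qbinomial q m i * (f (x ^ i * g ^ (m - i)) * h (x ^ (m - i)))"
    have "comult_sum (\<lambda>u v. f u * h v) (x ^ m) = (\<Sum>i\<le>m. ?t i)"
      using comult_sum_power[OF x_skew gx fh one_grouplike, of m] by simp
    also have "\<dots> = (\<Sum>i\<in>{0, m}. ?t i)"
      using primitive_root_qbinomial[OF q_primitive] by (intro sum.mono_neutral_right) auto
    also have "\<dots> = f (g ^ m) * h (x ^ m) + f (x ^ m) * h 1"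
      using m(1) by (simp add: qbinomial_self)
    finally show "comult_sum (\<lambda>u v. f u * h v) (x ^ m) = f (g ^ m) * h (x ^ m) + f (x ^ m) * h 1" .
  qed
  obtain c where "\<S> (g ^ m) * x ^ m - c \<cdot> (\<S> g * x) \<in> kG"
    using skew_primitive_decomposition[OF skew] by blast
  then have "g ^ m * (\<S> (g ^ m) * x ^ m - c \<cdot> (\<S> g * x)) \<in> kG"
    using kG_grouplike_mult_iff(1)[OF gm] by blast
  moreover have "g ^ m * \<S> g = g ^ (m - 1)"
    using m(1) grouplike_antipode(2)[OF g_grouplike]
    by (cases m) (simp_all add: mult.assoc power_Suc2 del: power_Suc)
  ultimately have k: "x ^ m - c \<cdot> (g ^ (m - 1) * x) \<in> kG" (is "?k \<in> _")
    by (simp add: right_diff_distrib scl_mult_right mult.assoc[symmetric] grouplike_antipode(2)[OF gm])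
  have "g * ?k = x ^ m * g - (c * q) \<cdot> (g ^ (m - 1) * x * g)"
  proof -
    have "g * x ^ m = x ^ m * g"
      using grouplike_x_power[OF g_grouplike, of m] q_primitive by (simp add: chi_g primitive_root_of_unity_def)
    moreover have "g * (g ^ (m - 1) * x) = q \<cdot> (g ^ (m - 1) * x * g)"
      by (metis gx mult.assoc power_commutes scl_mult_right)
    ultimately show ?thesis
      by (simp add: right_diff_distrib scl_mult_right)
  qed
  moreover have "?k * g = x ^ m * g - c \<cdot> (g ^ (m - 1) * x * g)"
    by (simp add: left_diff_distrib scl_mult_left)
  ultimately have "(c * q) \<cdot> (g ^ (m - 1) * x * g) = c \<cdot> (g ^ (m - 1) * x * g)"
    using g_comm_kG[OF k] by simp
  moreover have "g ^ (m - 1) * x * g \<noteq> 0"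
    using kG_grouplike_mult_iff(2)[OF g_grouplike, of "g ^ (m - 1) * x"] hv.span_zero x_notin_kG
      kG_grouplike_mult_iff(1)[OF grouplike_power[OF g_grouplike], of "m - 1" x] by metis
  ultimately have "c * q = c"
    by simp
  then have "c = 0"
    using q_neq_1 by simp
  then have "x ^ m \<in> kG"
    using k by simp
  then show ?thesis
    by (rule kG_skew_primitive[OF _ skew])
qed

abbreviation basis_index where
  "basis_index \<equiv> {..<m} \<times> G"

abbreviation basis_elem :: "nat \<times> 'h \<Rightarrow> 'h" where
  "basis_elem p \<equiv> x ^ fst p * snd p"

lemma finite_basis_index: "finite basis_index"
  using finite_grouplikes by simp

lemma basis_elem_mult:
  assumes "a \<in> G" "b \<in> G"
  shows "(x ^ i * a) * (x ^ j * b) = chi a ^ j \<cdot> (x ^ (i + j) * (a * b))"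
proof -
  have "(x ^ i * a) * (x ^ j * b) = x ^ i * (a * x ^ j) * b"
    by (simp add: mult.assoc)
  then show ?thesis
    by (simp add: grouplike_x_power[OF assms(1)] scl_mult_left scl_mult_right power_add mult.assoc)
qed

lemma span_basis: "hv.span (basis_elem ` basis_index) = UNIV"
proof (rule generated_subset)
  let ?K = "hv.span (basis_elem ` basis_index)"
  have low: "x ^ j * a \<in> ?K" if "j < m" "a \<in> G" for j a
    using that by (intro hv.span_base image_eqI[of _ _ "(j, a)"]) auto
  have high: "x ^ j * a \<in> ?K" if "j < 2 * m" "a \<in> G" for j a
  proof (cases "j < m")
    case False
    obtain c where c: "x ^ m = c \<cdot> (g ^ m - 1)"
      using x_power_m by blast
    have "x ^ j * a = x ^ (j - m) * x ^ m * a"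
      using False by (simp add: power_add[symmetric])
    also have "\<dots> = c \<cdot> (x ^ (j - m) * (g ^ m * a) - x ^ (j - m) * a)"
      unfolding c by (simp add: scl_mult_left scl_mult_right left_diff_distrib right_diff_distrib mult.assoc)
    also have "\<dots> \<in> ?K"
      using False that
      by (intro hv.span_scale hv.span_diff low grouplike_mult grouplike_power g_grouplike) auto
    finally show ?thesis .
  qed (use that low in auto)
  have "a * b \<in> ?K" if "a \<in> ?K" "b \<in> ?K" for a b
    using that by (rule span_mult)
      (auto simp: basis_elem_mult intro!: hv.span_scale high grouplike_mult)
  then show "is_subalgebra H ?K"
    using low[of 0 1] m(1) one_grouplike by (simp add: is_subalgebra_def)
  show "G \<subseteq> ?K"
    using low[of 0] m(1) by auto
  show "x \<in> ?K"
    using low[of 1 1] m_ge_2 one_grouplike by simp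
qed

definition bcoord :: "nat \<times> 'h \<Rightarrow> 'h \<Rightarrow> 'k" where
  "bcoord p = (SOME f. functional_on f \<and> (\<forall>r\<in>basis_index. f (basis_elem r) = (if r = p then 1 else 0)))"

lemma bcoord:
  assumes "p \<in> basis_index"
  shows "functional_on (bcoord p)" "r \<in> basis_index \<Longrightarrow> bcoord p (basis_elem r) = (if r = p then 1 else 0)"
  using someI_ex[OF hv.dual_family[where v = basis_elem, OF finite_basis_index powers_indep assms]]
  unfolding bcoord_def by blast+

lemma bcoord_expansion: "h = (\<Sum>p\<in>basis_index. bcoord p h \<cdot> basis_elem p)"
proof -
  have "h \<in> hv.span (basis_elem ` basis_index)"
    by (simp add: span_basis)
  then show ?thesis
  proof (induction rule: hv.span_induct_alt)
    case base
    then show ?case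
      by (simp add: hv.functionalD(3)[OF bcoord(1)])
  next
    case (step c y z)
    then obtain r where r: "r \<in> basis_index" "y = basis_elem r"
      by blast
    have "(\<Sum>p\<in>basis_index. bcoord p y \<cdot> basis_elem p) = (\<Sum>p\<in>basis_index. if p = r then basis_elem p else 0)"
      unfolding r(2) using r(1) by (intro sum.cong) (auto simp: bcoord(2) simp del: mem_Sigma_iff)
    also have "\<dots> = y"
      using r finite_basis_index by simp
    finally have y: "(\<Sum>p\<in>basis_index. bcoord p y \<cdot> basis_elem p) = y" .
    have "(\<Sum>p\<in>basis_index. bcoord p (c \<cdot> y + z) \<cdot> basis_elem p) =
        c \<cdot> (\<Sum>p\<in>basis_index. bcoord p y \<cdot> basis_elem p) + (\<Sum>p\<in>basis_index. bcoord p z \<cdot> basis_elem p)"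
      by (simp add: hv.functionalD(1,2)[OF bcoord(1)] hv.scale_left_distrib sum.distrib hv.scale_sum_right)
    then show ?case
      using y step.IH by simp
  qed
qed


end

section \<open>Hopf ideals and Hopf subalgebras generated by skew-primitive elements\<close>

context finite_dim_hopf_algebra
begin

text \<open>All conditions are checked on the generators \<open>h y h'\<close>; the ideal is stable under the antipode because
  \<open>\<S> y = - a\<^sup>-\<^sup>1 y\<close>.\<close>

lemma skew_primitive_hopf_ideal:
  assumes y: "skew_primitive H a 1 y"
  defines "I \<equiv> hv.span {h * y * h' | h h'. True}"
  shows "hopf_ideal H I" "y \<in> I"
proof -
  have gen: "h * y * h' \<in> I" for h h'
    unfolding I_def by (intro hv.span_base) blast
  show yI: "y \<in> I"
    using gen[of 1 1] by simp
  have sub: "hv.subspace I"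
    unfolding I_def by (rule hv.subspace_span)
  have left: "h * z \<in> I" and right: "z * h \<in> I" if "z \<in> I" for h z
  proof -
    have U: "h \<in> hv.span UNIV"
      by (simp add: hv.span_base)
    show "h * z \<in> I"
      unfolding I_def
      by (rule span_mult[OF U that[unfolded I_def]])
        (use gen in \<open>auto simp: I_def mult.assoc[symmetric]\<close>)
    show "z * h \<in> I"
      unfolding I_def
      by (rule span_mult[OF that[unfolded I_def] U])
        (use gen in \<open>auto simp: I_def mult.assoc\<close>)
  qed
  let ?P = "I \<times> UNIV \<union> UNIV \<times> I"
  have P: "hv.subspace (legs_in ?P)"
    by (rule subspace_legs_in) (auto intro: hv.subspace_scale[OF sub])
  have legs: "I \<subseteq> legs_in ?P"
    unfolding I_def
  proof (rule hv.span_minimal[OF _ P[unfolded I_def]])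
    have "h * y * h' \<in> legs_in ?P" for h h'
    proof -
      have "y \<in> legs_in ?P"
        by (rule skew_primitive_legs_in[OF y]) (use yI in auto)
      then have "h * y \<in> legs_in ?P"
        by (rule legs_in_mult[OF legs_in_UNIV]) (use left in auto)
      then show ?thesis
        by (rule legs_in_mult[OF _ legs_in_UNIV]) (use right in auto)
    qed
    then show "{h * y * h' | h h'. True} \<subseteq> legs_in (hv.span {h * y * h' | h h'. True} \<times> UNIV \<union> UNIV \<times> hv.span {h * y * h' | h h'. True})"
      by (auto simp: I_def)
  qed
  have eps: "\<epsilon> z = 0" if "z \<in> I" for z
    using that unfolding I_def
    by (induction rule: hv.span_induct_alt)
      (auto simp: counit_add counit_scl counit_mult skew_primitive_counit_antipode(1)[OF y]
        hv.functionalD(3)[OF functional_counit])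
  have anti: "\<S> z \<in> I" if "z \<in> I" for z
    using that unfolding I_def
  proof (induction rule: hv.span_induct_alt)
    case base
    then show ?case by (simp add: hv.span_zero)
  next
    case (step c u z)
    then obtain h h' where u: "u = h * y * h'"
      by blast
    have "\<S> u = - (\<S> h' * \<S> a * y * \<S> h)"
      by (simp add: u antipode_mult skew_primitive_counit_antipode(2)[OF y] mult.assoc)
    then have "\<S> u \<in> I"
      using hv.subspace_neg[OF sub gen] by metis
    then show ?case
      using step unfolding I_def by (simp add: antipode_add antipode_scl hv.span_add hv.span_scale)
  qed
  show "hopf_ideal H I"
    unfolding hopf_ideal_def
    using sub left right legs eps anti by (auto simp: legs_in_def)
qed

end

context rank_one_hopf_algebra
begin

lemma generated_subalgebra_is_subalgebra: "is_subalgebra H (generated_subalgebra H X)"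
  unfolding is_subalgebra_def generated_subalgebra_def
  by (auto intro!: hv.subspace_Inter)

lemma generated_subalgebra_minimal: "is_subalgebra H K \<Longrightarrow> X \<subseteq> K \<Longrightarrow> generated_subalgebra H X \<subseteq> K"
  by (auto simp: generated_subalgebra_def)

lemma generated_subalgebra_superset: "X \<subseteq> generated_subalgebra H X"
  by (auto simp: generated_subalgebra_def)

lemma subalgebra_power: "is_subalgebra H K \<Longrightarrow> a \<in> K \<Longrightarrow> a ^ n \<in> K"
  by (induction n) (auto simp: is_subalgebra_def)

text \<open>The elements with comultiplication in \<open>K \<otimes> K\<close> and those with antipode in \<open>K\<close> form subalgebras
  that contain \<open>g\<close> and \<open>x\<close>.\<close>

lemma hopf_subalgebra_generated: "hopf_subalgebra H (generated_subalgebra H {g, x})"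
proof -
  let ?K = "generated_subalgebra H {g, x}"
  have K: "is_subalgebra H ?K" and gx: "g \<in> ?K" "x \<in> ?K"
    using generated_subalgebra_is_subalgebra generated_subalgebra_superset[of "{g, x}"] by auto
  have sub: "hv.subspace ?K" and one: "1 \<in> ?K" and mult: "a \<in> ?K \<Longrightarrow> b \<in> ?K \<Longrightarrow> a * b \<in> ?K" for a b
    using K by (auto simp: is_subalgebra_def)
  have "?K \<subseteq> legs_in (?K \<times> ?K)"
  proof (rule generated_subalgebra_minimal)
    show "is_subalgebra H (legs_in (?K \<times> ?K))"
      unfolding is_subalgebra_def
    proof (intro conjI ballI)
      show "hv.subspace (legs_in (?K \<times> ?K))"
        by (rule subspace_legs_in) (auto intro: hv.subspace_scale[OF sub])
      show "1 \<in> legs_in (?K \<times> ?K)"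
        using one by (intro grouplike_legs_in one_grouplike) auto
      show "a * b \<in> legs_in (?K \<times> ?K)" if "a \<in> legs_in (?K \<times> ?K)" "b \<in> legs_in (?K \<times> ?K)" for a b
        using that by (rule legs_in_mult) (auto intro: mult)
    qed
    show "{g, x} \<subseteq> legs_in (?K \<times> ?K)"
      using gx one by (auto intro!: grouplike_legs_in[OF g_grouplike] skew_primitive_legs_in[OF x_skew])
  qed
  moreover have "?K \<subseteq> {a. \<S> a \<in> ?K}"
  proof (rule generated_subalgebra_minimal)
    show "is_subalgebra H {a. \<S> a \<in> ?K}"
      unfolding is_subalgebra_def
      by (auto intro!: hv.subspaceI mult
          simp: antipode_add antipode_scl antipode_mult one hv.subspace_add[OF sub] hv.subspace_scale[OF sub] hv.subspace_0[OF sub])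
    have Sg: "\<S> g \<in> ?K"
      using antipode_grouplike_power[OF g_grouplike] subalgebra_power[OF K gx(1)] by metis
    moreover have "\<S> x \<in> ?K"
      using Sg gx skew_primitive_counit_antipode(2)[OF x_skew] by (simp add: mult hv.subspace_neg[OF sub])
    ultimately show "{g, x} \<subseteq> {a. \<S> a \<in> ?K}"
      by simp
  qed
  ultimately show ?thesis
    using K sub by (auto simp: hopf_subalgebra_def subcoalgebra_iff)
qed

lemma generated_hopf_subalgebra_eq: "generated_hopf_subalgebra H {g, x} = generated_subalgebra H {g, x}"
proof
  show "generated_hopf_subalgebra H {g, x} \<subseteq> generated_subalgebra H {g, x}"
    using hopf_subalgebra_generated generated_subalgebra_superset[of "{g, x}"]
    by (auto simp: generated_hopf_subalgebra_def)
  show "generated_subalgebra H {g, x} \<subseteq> generated_hopf_subalgebra H {g, x}"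
    by (auto simp: generated_hopf_subalgebra_def generated_subalgebra_def hopf_subalgebra_def)
qed

lemma generated_subalgebra_shift:
  "generated_subalgebra H {g, x + c \<cdot> (g - 1)} = generated_subalgebra H {g, x}"
proof -
  have *: "is_subalgebra H K \<Longrightarrow> g \<in> K \<Longrightarrow> x + c \<cdot> (g - 1) \<in> K \<longleftrightarrow> x \<in> K" for K
  proof -
    assume K: "is_subalgebra H K" "g \<in> K"
    then have sub: "hv.subspace K" and "c \<cdot> (g - 1) \<in> K"
      by (auto simp: is_subalgebra_def intro!: hv.subspace_scale hv.subspace_diff)
    then show ?thesis
      using hv.subspace_add[OF sub, of x "c \<cdot> (g - 1)"] hv.subspace_diff[OF sub, of "x + c \<cdot> (g - 1)" "c \<cdot> (g - 1)"]
      by auto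
  qed
  show ?thesis
    unfolding generated_subalgebra_def using * by (intro arg_cong[of _ _ Inter]) auto
qed

end

section \<open>The presentation of a Taft algebra\<close>

lemma (in vector_space) span_finite_family:
  assumes "finite I" "f \<in> span (v ` I)"
  shows "\<exists>c. f = (\<Sum>i\<in>I. scale (c i) (v i))"
  using assms(2)
proof (induction rule: span_induct_alt)
  case base
  show ?case
    by (rule exI[of _ "\<lambda>_. 0"]) simp
next
  case (step k y z)
  then obtain c i where c: "z = (\<Sum>i\<in>I. scale (c i) (v i))" "i \<in> I" "y = v i"
    by blast
  have "(\<Sum>j\<in>I. scale ((if j = i then k else 0) + c j) (v j)) = (\<Sum>j\<in>I. (if j = i then scale k (v j) else 0) + scale (c j) (v j))"
    by (intro sum.cong) (auto simp: scale_left_distrib)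
  also have "\<dots> = scale k y + z"
    using c assms(1) by (simp add: sum.distrib)
  finally show ?case
    by metis
qed

lemma translate_lin_ext: "translate u r v = lin_ext fscale (\<lambda>w. Poly_Mapping.single (u @ w @ v) 1) r"
  by (simp add: translate_def lin_ext_def fscale_single)

lemma lin_ext_compose:
  assumes "Vector_Spaces.linear s t L"
  shows "L (lin_ext s \<phi> f) = lin_ext t (\<lambda>p. L (\<phi> p)) f"
proof -
  interpret Vector_Spaces.linear s t L by fact
  show ?thesis
    by (simp add: lin_ext_def sum scale)
qed

context hopf_algebra
begin

lemma free_eval_lin_ext: "free_eval H \<phi> = lin_ext (scl H) (\<lambda>w. prod_list (map \<phi> w))"
  by (simp add: free_eval_def lin_ext_def fun_eq_iff)

lemma free_eval_translate: "free_eval H \<phi> (translate u r v) = prod_list (map \<phi> u) * free_eval H \<phi> r * prod_list (map \<phi> v)"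
proof -
  have "free_eval H \<phi> (translate u r v) =
      lin_ext (scl H) (\<lambda>w. prod_list (map \<phi> u) * prod_list (map \<phi> w) * prod_list (map \<phi> v)) r"
    unfolding free_eval_lin_ext translate_lin_ext
    by (subst lin_ext_compose[OF hv.linear_lin_ext]) (simp add: mult.assoc)
  also have "\<dots> = prod_list (map \<phi> u) * free_eval H \<phi> r * prod_list (map \<phi> v)"
    by (simp add: free_eval_lin_ext lin_ext_def sum_distrib_left sum_distrib_right scl_mult_left scl_mult_right)
  finally show ?thesis .
qed

lemma free_eval_ideal:
  assumes "\<And>r. r \<in> R \<Longrightarrow> free_eval H \<phi> r = 0" "f \<in> free_ideal R"
  shows "free_eval H \<phi> f = 0"
  unfolding free_eval_lin_ext
  using _ assms(2)[unfolded free_ideal_def]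
  by (rule hv.lin_ext_vanishes_on_span)
    (auto simp: free_eval_lin_ext[symmetric] free_eval_translate assms(1))

lemma relation_in_free_ideal: "r \<in> R \<Longrightarrow> r \<in> free_ideal R"
proof -
  assume r: "r \<in> R"
  have "r = translate [] r []"
    by (simp add: translate_lin_ext lin_ext_singles)
  with r show ?thesis
    unfolding free_ideal_def by (intro fvs.span_base) blast
qed

lemma presented_by_subset:
  assumes "presented_by H K \<phi> R" "is_subalgebra H K'" "range \<phi> \<subseteq> K'"
  shows "K \<subseteq> K'"
proof -
  have "prod_list (map \<phi> w) \<in> K'" for w
    using assms(2,3) by (induction w) (auto simp: is_subalgebra_def)
  then have "free_eval H \<phi> f \<in> K'" for f
    using assms(2) unfolding free_eval_def is_subalgebra_def
    by (auto intro!: hv.subspace_sum hv.subspace_scale)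
  then show ?thesis
    using assms(1) by (auto simp: presented_by_def)
qed

lemma range_free_eval: "range (free_eval H \<phi>) = generated_subalgebra H (range \<phi>)"
proof
  show "range (free_eval H \<phi>) \<subseteq> generated_subalgebra H (range \<phi>)"
  proof (unfold generated_subalgebra_def, intro Inter_greatest)
    fix K assume "K \<in> {K. is_subalgebra H K \<and> range \<phi> \<subseteq> K}"
    then have K: "is_subalgebra H K" "range \<phi> \<subseteq> K"
      by auto
    have "prod_list (map \<phi> w) \<in> K" for w
      using K by (induction w) (auto simp: is_subalgebra_def)
    then show "range (free_eval H \<phi>) \<subseteq> K"
      using K unfolding free_eval_def is_subalgebra_def
      by (auto intro!: hv.subspace_sum hv.subspace_scale)
  qed
  let ?S = "range (\<lambda>w. prod_list (map \<phi> w))"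
  have word: "prod_list (map \<phi> w) \<in> hv.span ?S" for w
    by (intro hv.span_base) auto
  have "is_subalgebra H (hv.span ?S)"
    unfolding is_subalgebra_def
  proof (intro conjI ballI)
    show "1 \<in> hv.span ?S"
      using word[of "[]"] by simp
    show "a * b \<in> hv.span ?S" if "a \<in> hv.span ?S" "b \<in> hv.span ?S" for a b
      using that
    proof (rule span_mult)
      fix u v assume "u \<in> ?S" "v \<in> ?S"
      then obtain w w' where "u = prod_list (map \<phi> w)" "v = prod_list (map \<phi> w')"
        by blast
      then show "u * v \<in> hv.span ?S"
        using word[of "w @ w'"] by simp
    qed
  qed simp
  moreover have "range \<phi> \<subseteq> hv.span ?S"
  proof safe
    fix a
    show "\<phi> a \<in> hv.span ?S"
      using word[of "[a]"] by simp
  qed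
  ultimately have "generated_subalgebra H (range \<phi>) \<subseteq> hv.span ?S"
    by (auto simp: generated_subalgebra_def)
  also have "hv.span ?S \<subseteq> range (free_eval H \<phi>)"
  proof (rule hv.span_minimal)
    show "hv.subspace (range (free_eval H \<phi>))"
    proof -
      interpret L: Vector_Spaces.linear fscale "scl H" "free_eval H \<phi>"
        unfolding free_eval_lin_ext by (rule hv.linear_lin_ext)
      show ?thesis
        using L.subspace_image[OF fvs.subspace_UNIV] .
    qed
    have "prod_list (map \<phi> w) = free_eval H \<phi> (Poly_Mapping.single w 1)" for w
      by (simp add: free_eval_lin_ext)
    then show "?S \<subseteq> range (free_eval H \<phi>)"
      by auto
  qed
  finally show "generated_subalgebra H (range \<phi>) \<subseteq> range (free_eval H \<phi>)" .
qed

end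

text \<open>The combinations of normal words modulo the relations are stable under left multiplication by both
  generators, because \<open>x\<close> can be moved past powers of \<open>g\<close> at the cost of a power of \<open>q\<close>.\<close>

lemma taft_normal_form:
  fixes q :: "'k::field" and n :: nat
  assumes q: "q \<noteq> 0" and n: "n > 0"
  defines "J \<equiv> free_ideal (taft_rels n q)"
  defines "W \<equiv> \<lambda>p. Poly_Mapping.single (replicate (fst p) Gen_g @ replicate (snd p) Gen_x) (1::'k)"
  shows "f \<in> vs_span fscale (W ` ({..<n} \<times> {..<n}) \<union> J)"
proof -
  let ?M = "W ` ({..<n} \<times> {..<n})"
  let ?N = "vs_span fscale (?M \<union> J)"
  let ?s = "\<lambda>w. Poly_Mapping.single w (1::'k)"
  have J: "vs_subspace fscale J"
    unfolding J_def free_ideal_def by (rule fvs.subspace_span)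
  have JN: "J \<subseteq> ?N" and MN: "?M \<subseteq> ?N"
    by (auto intro: fvs.span_base)
  have tr: "translate u r v \<in> J" if "r \<in> taft_rels n q" for u r v
    unfolding J_def free_ideal_def using that by (intro fvs.span_base) blast
  define lm :: "taft_gen \<Rightarrow> (taft_gen list \<Rightarrow>\<^sub>0 'k) \<Rightarrow> _" where "lm c = lin_ext fscale (\<lambda>w. ?s (c # w))" for c
  have lm: "Vector_Spaces.linear fscale fscale (lm c)" for c
    unfolding lm_def by (rule fvs.linear_lin_ext)
  have lm_s [simp]: "lm c (Poly_Mapping.single w k) = Poly_Mapping.single (c # w) k" for c w k
    by (simp add: lm_def fscale_single)
  have lm_span: "lm c f \<in> vs_span fscale B" if "f \<in> vs_span fscale A" "\<And>a. a \<in> A \<Longrightarrow> lm c a \<in> vs_span fscale B" for c f A B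
    using that(1)
  proof (induction rule: fvs.span_induct_alt)
    case base
    then show ?case
      by (simp add: lm_def fvs.span_zero)
  next
    case (step k y z)
    then show ?case
      using that(2) by (simp add: lm_def fvs.lin_ext_add fvs.lin_ext_scale fvs.span_add fvs.span_scale)
  qed
  have lm_J: "lm c f \<in> J" if "f \<in> J" for c f
  proof -
    have "lm c (translate u r v) = translate (c # u) r v" for u r v
      unfolding translate_lin_ext by (subst lin_ext_compose[OF lm]) simp
    then show ?thesis
      using that unfolding J_def free_ideal_def
      by (elim lm_span) (auto intro!: fvs.span_base, blast)
  qed
  have rel_g: "?s (replicate n Gen_g @ v) - ?s v \<in> J" for v
    using tr[of "?s (replicate n Gen_g) - ?s []" "[]" v]
    by (simp add: taft_rels_def translate_lin_ext fvs.lin_ext_diff)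
  have rel_x: "?s (u @ replicate n Gen_x) \<in> J" for u
    using tr[of "?s (replicate n Gen_x)" u "[]"]
    by (simp add: taft_rels_def translate_lin_ext)
  have rel_gx: "?s (Gen_g # Gen_x # v) - fscale q (?s (Gen_x # Gen_g # v)) \<in> J" for v
    using tr[of "?s [Gen_g, Gen_x] - Poly_Mapping.single [Gen_x, Gen_g] q" "[]" v]
    by (simp add: taft_rels_def translate_lin_ext fvs.lin_ext_diff)
  have comm: "?s (Gen_x # replicate i Gen_g @ v) - fscale (inverse q ^ i) (?s (replicate i Gen_g @ Gen_x # v)) \<in> J" for i v
  proof (induction i)
    case 0
    then show ?case
      by (simp add: fvs.subspace_0[OF J])
  next
    case (Suc i)
    let ?w = "replicate i Gen_g @ v"
    have "fscale (- inverse q) (?s (Gen_g # Gen_x # ?w) - fscale q (?s (Gen_x # Gen_g # ?w))) \<in> J"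
      by (rule fvs.subspace_scale[OF J rel_gx])
    then have 1: "?s (Gen_x # Gen_g # ?w) - fscale (inverse q) (?s (Gen_g # Gen_x # ?w)) \<in> J"
      using q by (simp add: fvs.scale_right_diff_distrib)
    have "fscale (inverse q) (lm Gen_g (?s (Gen_x # ?w) - fscale (inverse q ^ i) (?s (replicate i Gen_g @ Gen_x # v)))) \<in> J"
      by (rule fvs.subspace_scale[OF J lm_J[OF Suc]])
    then have 2: "fscale (inverse q) (?s (Gen_g # Gen_x # ?w)) -
        fscale (inverse q ^ Suc i) (?s (Gen_g # replicate i Gen_g @ Gen_x # v)) \<in> J"
      by (simp add: lm_def fvs.lin_ext_diff fvs.scale_right_diff_distrib fscale_single)
    from mem_cong_trans[OF J 1 2] show ?case
      by simp
  qed
  have N: "vs_subspace fscale ?N"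
    by (rule fvs.subspace_span)
  have lm_M: "lm c a \<in> ?N" if a: "a \<in> ?M" for c a
  proof -
    obtain i j where ij: "i < n" "j < n" "a = ?s (replicate i Gen_g @ replicate j Gen_x)"
      using a by (auto simp: W_def)
    show ?thesis
    proof (cases c)
      case Gen_g
      show ?thesis
      proof (cases "Suc i < n")
        case True
        then have "W (Suc i, j) \<in> ?N"
          using ij by (intro fvs.span_base) auto
        then show ?thesis
          using ij Gen_g by (simp add: W_def)
      next
        case False
        then have i: "n = Suc i"
          using ij by simp
        have "(?s (replicate n Gen_g @ replicate j Gen_x) - ?s (replicate j Gen_x)) + W (0, j) \<in> ?N"
          using ij n by (intro fvs.subspace_add[OF N] subsetD[OF JN] rel_g fvs.span_base) auto
        then show ?thesis
          using ij Gen_g i by (simp add: W_def)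
      qed
    next
      case Gen_x
      have "?s (replicate i Gen_g @ replicate (Suc j) Gen_x) \<in> ?N"
      proof (cases "Suc j < n")
        case True
        then have "W (i, Suc j) \<in> ?N"
          using ij by (intro fvs.span_base) auto
        then show ?thesis
          by (simp add: W_def)
      next
        case False
        then show ?thesis
          using ij rel_x[of "replicate i Gen_g"] JN by (metis Suc_lessI subsetD)
      qed
      then have "(?s (Gen_x # replicate i Gen_g @ replicate j Gen_x)
          - fscale (inverse q ^ i) (?s (replicate i Gen_g @ Gen_x # replicate j Gen_x)))
          + fscale (inverse q ^ i) (?s (replicate i Gen_g @ Gen_x # replicate j Gen_x)) \<in> ?N"
        by (intro fvs.subspace_add[OF N subsetD[OF JN comm]] fvs.subspace_scale[OF N]) simp
      then show ?thesis
        using ij Gen_x by simp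
    qed
  qed
  have "?s w \<in> ?N" for w
  proof (induction w)
    case Nil
    have "W (0, 0) \<in> ?N"
      using n by (intro fvs.span_base) auto
    then show ?case
      by (simp add: W_def)
  next
    case (Cons c w)
    have "lm c (?s w) \<in> ?N"
      by (rule lm_span[OF Cons]) (use lm_M lm_J JN in blast)
    then show ?case
      by simp
  qed
  then have "vs_span fscale (range ?s) \<subseteq> ?N"
    by (intro fvs.span_minimal N) auto
  then show ?thesis
    using span_singles[of f] by blast
qed

context normalized_rank_one_hopf_algebra
begin

text \<open>Let \<open>g'\<close> and \<open>x'\<close> be the generators of the presentation. Since they generate \<open>x\<close>, the element \<open>x'\<close> is
  not in \<open>kG\<close>, so that by rank one \<open>x' = c g' g\<^sup>-\<^sup>1 x\<close> modulo \<open>kG\<close> with \<open>c \<noteq> 0\<close>. Comparing the right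
  factors of the comultiplications gives \<open>g' = g\<close>, and then \<open>x'\<close> is a combination of \<open>x\<close> and \<open>g - 1\<close>. Thus the
  root of unity of the Taft algebra is \<open>q\<close>, and its order is \<open>m\<close>.\<close>

lemma taft_imp_order:
  assumes "is_taft_algebra H (generated_subalgebra H {g, x})"
  shows "g ^ m = 1"
proof -
  let ?K = "generated_subalgebra H {g, x}"
  obtain n z g' x' where n: "n \<ge> 2" "primitive_root_of_unity n z" and g': "g' \<in> G"
    and x': "skew_primitive H g' 1 x'"
    and pres: "presented_by H ?K (case_taft_gen g' x') (taft_rels n z)"
    using assms by (auto simp: is_taft_algebra_def)
  let ?\<phi> = "case_taft_gen g' x'"
  have ev: "free_eval H ?\<phi> r = 0" if "r \<in> taft_rels n z" for r
    using pres relation_in_free_ideal[OF that] by (auto simp: presented_by_def)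
  have g'n: "g' ^ n = 1"
    using ev[of "Poly_Mapping.single (replicate n Gen_g) 1 - Poly_Mapping.single [] 1"]
    by (simp add: taft_rels_def free_eval_lin_ext hv.lin_ext_diff prod_list_replicate)
  have g'x': "g' * x' = z \<cdot> (x' * g')"
    using ev[of "Poly_Mapping.single [Gen_g, Gen_x] 1 - Poly_Mapping.single [Gen_x, Gen_g] z"]
    by (simp add: taft_rels_def free_eval_lin_ext hv.lin_ext_diff)
  have x'_notin: "x' \<notin> kG"
  proof
    assume x'kG: "x' \<in> kG"
    have "is_subalgebra H kG"
      by (auto simp: is_subalgebra_def kG_mult intro: grouplike_in_kG one_grouplike)
    then have "?K \<subseteq> kG"
      by (rule presented_by_subset[OF pres]) (auto split: taft_gen.split simp: x'kG grouplike_in_kG[OF g'])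
    then show False
      using generated_subalgebra_superset[of "{g, x}"] x_notin_kG by blast
  qed
  let ?a = "g' * \<S> g"
  have a: "?a \<in> G"
    by (intro grouplike_mult g' antipode_grouplike g_grouplike)
  have ag: "?a * g = g'"
    by (simp add: mult.assoc grouplike_antipode g_grouplike)
  obtain c where c: "\<S> g' * x' - c \<cdot> (\<S> g * x) \<in> kG"
    using skew_primitive_decomposition[OF x'] by blast
  then have "g' * (\<S> g' * x' - c \<cdot> (\<S> g * x)) \<in> kG"
    using kG_grouplike_mult_iff(1)[OF g'] by blast
  then have k: "x' - c \<cdot> (?a * x) \<in> kG" (is "?k \<in> _")
    by (simp add: right_diff_distrib scl_mult_right mult.assoc[symmetric] grouplike_antipode(2)[OF g'])
  have "c \<noteq> 0"
    using k x'_notin by auto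
  have ax: "?a * x \<notin> kG"
    using kG_grouplike_mult_iff(1)[OF a] x_notin_kG by simp
  obtain f where f: "functional_on f" "\<And>b. b \<in> kG \<Longrightarrow> f b = 0" "f (?a * x) = 1"
    using hv.separating_functional[OF ax] by blast
  have "h 1 = h ?a" if h: "functional_on h" for h
  proof -
    note lin = hv.functionalD[OF functional_convolution[OF f(1) h]]
    have "comult_sum (\<lambda>u v. f u * h v) b = 0" if "b \<in> kG" for b
      using that
      by (induction rule: hv.span_induct_alt)
        (auto simp: lin comult_sum_functionals_grouplike[OF f(1) h] f(2)[OF grouplike_in_kG])
    from this[OF k] have "comult_sum (\<lambda>u v. f u * h v) x' = c * comult_sum (\<lambda>u v. f u * h v) (?a * x)"
      by (simp only: lin(4) lin(2) right_minus_eq)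
    also have "comult_sum (\<lambda>u v. f u * h v) (?a * x) = f g' * h (?a * x) + f (?a * x) * h ?a"
      using comult_sum_grouplike_mult[OF f(1) h a, of x]
        comult_sum_functionals_skew_primitive[OF functional_mult(1)[OF f(1)] functional_mult(1)[OF h] x_skew]
      by (simp add: ag)
    also have "comult_sum (\<lambda>u v. f u * h v) x' = f x' * h 1"
      using comult_sum_functionals_skew_primitive[OF f(1) h x'] f(2)[OF grouplike_in_kG[OF g']] by simp
    also have "f x' = c"
      using f(2)[OF k] f(3) by (simp add: hv.functionalD(4,2)[OF f(1)])
    finally show ?thesis
      using \<open>c \<noteq> 0\<close> f(2)[OF grouplike_in_kG[OF g']] f(3) by simp
  qed
  then have "1 = ?a"
    by (rule hv.functionals_separate)
  then have gg': "g' = g"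
    using ag by simp
  obtain c d where cd: "x' = c \<cdot> x + d \<cdot> (g - 1)"
    using skew_primitive_span[OF x'[unfolded gg']] by blast
  have g1: "g - 1 \<in> kG"
    by (intro hv.span_diff grouplike_in_kG g_grouplike one_grouplike)
  have "(c * q) \<cdot> (x * g) + d \<cdot> (g * (g - 1)) = (z * c) \<cdot> (x * g) + (z * d) \<cdot> ((g - 1) * g)"
    using g'x' unfolding gg' cd
    by (simp add: distrib_left distrib_right scl_mult_left scl_mult_right gx hv.scale_right_distrib)
  then have "(c * q - z * c) \<cdot> (x * g) = (z * d) \<cdot> ((g - 1) * g) - d \<cdot> (g * (g - 1))"
    by (simp add: hv.scale_left_diff_distrib algebra_simps)
  also have "\<dots> \<in> kG"
    by (intro hv.span_diff hv.span_scale kG_mult g1 grouplike_in_kG g_grouplike)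
  finally have kk: "(c * q - z * c) \<cdot> (x * g) \<in> kG" .
  have "c * q - z * c = 0"
  proof (rule ccontr)
    assume nz: "c * q - z * c \<noteq> 0"
    have "inverse (c * q - z * c) * (c * q - z * c) = 1"
      by (rule field_class.field_inverse[OF nz])
    with hv.span_scale[OF kk, of "inverse (c * q - z * c)"] have "x * g \<in> kG"
      by (metis hv.scale_scale hv.scale_one)
    then show False
      using kG_grouplike_mult_iff(2)[OF g_grouplike] x_notin_kG by simp
  qed
  moreover have "c \<noteq> 0"
    using cd x'_notin hv.span_scale[OF g1] by auto
  ultimately have "q = z"
    by (simp add: mult.commute)
  then have "n = m"
    using n q_primitive m(1) unfolding primitive_root_of_unity_def
    by (metis linorder_neqE_nat less_le_trans zero_less_numeral)
  then show ?thesis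
    using g'n gg' by simp
qed

text \<open>The normal words evaluate to \<open>g\<^sup>i x\<^sup>j = q\<^sup>i\<^sup>j x\<^sup>j g\<^sup>i\<close>, and for \<open>i, j < m\<close> these are, up to nonzero scalars,
  distinct basis elements of \<open>H\<close>. So no relations are missing.\<close>

lemma order_imp_taft:
  assumes gm: "g ^ m = 1"
  shows "is_taft_algebra H (generated_subalgebra H {g, x})"
proof -
  let ?K = "generated_subalgebra H {g, x}"
  let ?\<phi> = "case_taft_gen g x"
  let ?R = "taft_rels m q"
  have "range ?\<phi> = {g, x}"
    by (auto split: taft_gen.splits simp: image_iff)
  then have range: "range (free_eval H ?\<phi>) = ?K"
    by (simp add: range_free_eval)
  have xm: "x ^ m = 0"
    using x_power_m gm by auto
  have rels: "free_eval H ?\<phi> r = 0" if "r \<in> ?R" for r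
    using that by (auto simp: taft_rels_def free_eval_lin_ext hv.lin_ext_diff prod_list_replicate gm xm gx)
  have "f \<in> free_ideal ?R" if f: "free_eval H ?\<phi> f = 0" for f
  proof -
    let ?W = "\<lambda>p. Poly_Mapping.single (replicate (fst p) Gen_g @ replicate (snd p) Gen_x) (1::'k)"
    let ?I = "{..<m} \<times> {..<m}"
    have "f \<in> fvs.span (?W ` ?I \<union> free_ideal ?R)"
      by (rule taft_normal_form[OF q_neq_0 m(1)])
    then obtain u v where uv: "f = u + v" "u \<in> fvs.span (?W ` ?I)" "v \<in> fvs.span (free_ideal ?R)"
      unfolding fvs.span_Un by blast
    have v: "v \<in> free_ideal ?R"
      using uv(3) unfolding free_ideal_def by (simp add: fvs.span_span)
    obtain c where c: "u = (\<Sum>p\<in>?I. fscale (c p) (?W p))"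
      using fvs.span_finite_family[OF _ uv(2)] by blast
    have "free_eval H ?\<phi> u = 0"
      using f free_eval_ideal[OF rels v] unfolding uv(1) by (simp add: free_eval_lin_ext hv.lin_ext_add)
    moreover have "free_eval H ?\<phi> u = (\<Sum>p\<in>?I. c p \<cdot> (g ^ fst p * x ^ snd p))"
    proof -
      interpret L: Vector_Spaces.linear fscale "scl H" "free_eval H ?\<phi>"
        unfolding free_eval_lin_ext by (rule hv.linear_lin_ext)
      show ?thesis
        unfolding c L.sum L.scale by (simp add: free_eval_lin_ext prod_list_replicate)
    qed
    ultimately have sum0: "(\<Sum>p\<in>?I. (c p * q ^ (fst p * snd p)) \<cdot> basis_elem (snd p, g ^ fst p)) = 0"
      using grouplike_x_power[OF grouplike_power[OF g_grouplike]]
      by (simp add: chi_power[OF g_grouplike] chi_g power_mult)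
    have g_inj: "g ^ i = g ^ j \<longleftrightarrow> i = j" if "i < m" "j < m" for i j
    proof
      have neq: False if "i < j" "j < m" "g ^ i = g ^ j" for i j
      proof -
        have "q ^ i * q ^ (j - i) = q ^ i"
          using that chi_power[OF g_grouplike] chi_g by (metis le_add_diff_inverse less_imp_le power_add)
        then have "q ^ (j - i) = 1"
          using q_neq_0 by simp
        then show False
          using q_primitive that by (auto simp: primitive_root_of_unity_def)
      qed
      show "i = j" if "g ^ i = g ^ j"
        using neq[of i j] neq[of j i] that \<open>i < m\<close> \<open>j < m\<close> by (metis linorder_neqE_nat)
    qed simp
    have "c r = 0" if r: "r \<in> ?I" for r
    proof -
      have idx: "(snd p, g ^ fst p) \<in> basis_index" if "p \<in> ?I" for p
        using that grouplike_power[OF g_grouplike] by auto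
      let ?b = "bcoord (snd r, g ^ fst r)"
      note b = bcoord[OF idx[OF r]]
      have "0 = ?b (\<Sum>p\<in>?I. (c p * q ^ (fst p * snd p)) \<cdot> basis_elem (snd p, g ^ fst p))"
        unfolding sum0 by (simp add: hv.functionalD(3)[OF b(1)])
      also have "\<dots> = (\<Sum>p\<in>?I. if p = r then c p * q ^ (fst p * snd p) else 0)"
        unfolding hv.functionalD(6)[OF b(1)]
      proof (intro sum.cong refl)
        fix p assume p: "p \<in> ?I"
        have "?b (basis_elem (snd p, g ^ fst p)) = (if p = r then 1 else 0)"
          using b(2)[OF idx[OF p]] p r g_inj by (auto simp: prod_eq_iff)
        then show "?b ((c p * q ^ (fst p * snd p)) \<cdot> basis_elem (snd p, g ^ fst p)) =
            (if p = r then c p * q ^ (fst p * snd p) else 0)"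
          by (simp add: hv.functionalD(2)[OF b(1)])
      qed
      also have "\<dots> = c r * q ^ (fst r * snd r)"
        using r by simp
      finally show ?thesis
        using q_neq_0 by simp
    qed
    then have "u = 0"
      unfolding c by (intro sum.neutral) simp
    then show ?thesis
      using uv(1) v by simp
  qed
  then have "presented_by H ?K ?\<phi> ?R"
    unfolding presented_by_def using range free_eval_ideal[OF rels] by blast
  then show ?thesis
    unfolding is_taft_algebra_def
    using hopf_subalgebra_generated m_ge_2 q_primitive g_grouplike x_skew by blast
qed

end

section \<open>Actions on fields\<close>

locale hopf_action_on_field = finite_dim_hopf_algebra H + L: field L
  for H :: "('k::field, 'h::ring_1) hopf" and L :: "('l, 'm) ring_scheme" (structure) +
  fixes \<iota> :: "'k \<Rightarrow> 'l" and act :: "'h \<Rightarrow> 'l \<Rightarrow> 'l"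
  assumes action: "module_algebra H L \<iota> act"
begin

lemma iota_closed [simp]: "\<iota> c \<in> carrier L"
  and iota_one [simp]: "\<iota> 1 = \<one>"
  and iota_add: "\<iota> (c + d) = \<iota> c \<oplus> \<iota> d"
  and iota_mult: "\<iota> (c * d) = \<iota> c \<otimes> \<iota> d"
  using action by (auto simp: module_algebra_def k_algebra_def)

lemma iota_zero [simp]: "\<iota> 0 = \<zero>"
  using iota_add[of 0 0] by simp

lemma iota_power: "\<iota> (c ^ n) = \<iota> c [^] (n::nat)"
  by (induction n) (simp_all add: iota_mult L.m_comm)

lemma iota_eq_0_iff: "\<iota> c = \<zero> \<longleftrightarrow> c = 0"
proof
  assume "\<iota> c = \<zero>"
  show "c = 0"
  proof (rule ccontr)
    assume "c \<noteq> 0"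
    then have "\<one> = \<iota> c \<otimes> \<iota> (1 / c)"
      by (simp flip: iota_mult)
    with \<open>\<iota> c = \<zero>\<close> show False
      by simp
  qed
qed simp

lemma diff_eq_zero_imp_eq:
  assumes "a \<in> carrier L" "b \<in> carrier L" "a \<ominus> b = \<zero>"
  shows "a = b"
proof -
  have "a = (a \<ominus> b) \<oplus> b"
    using assms(1,2) by algebra
  then show ?thesis
    using assms by simp
qed

lemma act_closed [simp]: "u \<in> carrier L \<Longrightarrow> act h u \<in> carrier L"
  and act_add: "u \<in> carrier L \<Longrightarrow> act (h + h') u = act h u \<oplus> act h' u"
  and act_scl: "u \<in> carrier L \<Longrightarrow> act (c \<cdot> h) u = \<iota> c \<otimes> act h u"
  and act_add_right: "u \<in> carrier L \<Longrightarrow> v \<in> carrier L \<Longrightarrow> act h (u \<oplus> v) = act h u \<oplus> act h v"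
  and act_one: "u \<in> carrier L \<Longrightarrow> act 1 u = u"
  and act_mult: "u \<in> carrier L \<Longrightarrow> act (h * h') u = act h (act h' u)"
  and act_unit: "act h \<one> = \<iota> (\<epsilon> h)"
  and act_prod: "u \<in> carrier L \<Longrightarrow> v \<in> carrier L \<Longrightarrow> act h (u \<otimes> v) =
        foldr (\<lambda>(h1, h2) r. (act h1 u \<otimes> act h2 v) \<oplus> r) (comult H h) \<zero>"
  using action by (simp_all add: module_algebra_def)

lemma act_scalar_right: "u \<in> carrier L \<Longrightarrow> act h (\<iota> c \<otimes> u) = \<iota> c \<otimes> act h u"
proof -
  have "\<forall>c h. \<forall>u\<in>carrier L. act h (\<iota> c \<otimes> u) = \<iota> c \<otimes> act h u"
    using action unfolding module_algebra_def by (elim conjE)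
  then show "u \<in> carrier L \<Longrightarrow> act h (\<iota> c \<otimes> u) = \<iota> c \<otimes> act h u"
    by blast
qed

lemma act_zero: "u \<in> carrier L \<Longrightarrow> act 0 u = \<zero>"
  using act_scl[of u 0 0] by simp

lemma act_diff:
  assumes "u \<in> carrier L"
  shows "act (h - h') u = act h u \<ominus> act h' u"
proof -
  have "act (h - h') u \<oplus> act h' u = act h u"
    using act_add[OF assms, of "h - h'" h'] by simp
  moreover have "(a \<oplus> b) \<ominus> b = a" if "a \<in> carrier L" "b \<in> carrier L" for a b
    using that by algebra
  ultimately show ?thesis
    using assms by (metis act_closed)
qed

lemma act_scalar: "act h (\<iota> c) = \<iota> c \<otimes> \<iota> (\<epsilon> h)"
  using act_scalar_right[of \<one> h c] by (simp add: act_unit)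

text \<open>The analogue of \<open>lin_ext\<close> for values in \<open>L\<close>, whose operations live on a carrier set.\<close>

definition lext :: "('a \<Rightarrow> 'l) \<Rightarrow> ('a \<Rightarrow>\<^sub>0 'k) \<Rightarrow> 'l" where
  "lext \<beta> f = (\<Oplus>p\<in>Poly_Mapping.keys f. \<iota> (Poly_Mapping.lookup f p) \<otimes> \<beta> p)"

context
  fixes \<beta> :: "'a \<Rightarrow> 'l"
  assumes \<beta> [simp]: "\<And>p. \<beta> p \<in> carrier L"
begin

lemma lext_closed [simp]: "lext \<beta> f \<in> carrier L"
  by (auto simp: lext_def intro!: L.finsum_closed)

lemma lext_superset:
  assumes "finite S" "Poly_Mapping.keys f \<subseteq> S"
  shows "lext \<beta> f = (\<Oplus>p\<in>S. \<iota> (Poly_Mapping.lookup f p) \<otimes> \<beta> p)"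
  unfolding lext_def
  by (rule L.add.finprod_mono_neutral_cong_left) (use assms in \<open>auto simp: in_keys_iff\<close>)

lemma lext_add: "lext \<beta> (f + h) = lext \<beta> f \<oplus> lext \<beta> h"
proof -
  let ?S = "Poly_Mapping.keys f \<union> Poly_Mapping.keys h"
  have "Poly_Mapping.keys (f + h) \<subseteq> ?S"
    by (rule keys_add)
  then have "lext \<beta> (f + h) = (\<Oplus>p\<in>?S. \<iota> (Poly_Mapping.lookup f p) \<otimes> \<beta> p \<oplus> \<iota> (Poly_Mapping.lookup h p) \<otimes> \<beta> p)"
    by (simp add: lext_superset[where S = ?S] lookup_add iota_add L.l_distr)
  also have "\<dots> = lext \<beta> f \<oplus> lext \<beta> h"
    by (subst L.finsum_addf) (auto simp: lext_superset[where S = ?S])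
  finally show ?thesis .
qed

lemma lext_scale: "lext \<beta> (fscale c f) = \<iota> c \<otimes> lext \<beta> f"
proof -
  have "Poly_Mapping.keys (fscale c f) \<subseteq> Poly_Mapping.keys f"
    by (auto simp: in_keys_iff lookup_fscale)
  then have "lext \<beta> (fscale c f) = (\<Oplus>p\<in>Poly_Mapping.keys f. \<iota> c \<otimes> (\<iota> (Poly_Mapping.lookup f p) \<otimes> \<beta> p))"
    by (simp add: lext_superset[where S = "Poly_Mapping.keys f"] lookup_fscale iota_mult L.m_assoc)
  also have "\<dots> = \<iota> c \<otimes> lext \<beta> f"
    unfolding lext_def by (subst L.finsum_rdistr) auto
  finally show ?thesis .
qed

lemma lext_single: "lext \<beta> (Poly_Mapping.single p c) = \<iota> c \<otimes> \<beta> p"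
proof -
  have "lext \<beta> (Poly_Mapping.single p c) = (\<Oplus>r\<in>{p}. \<iota> (Poly_Mapping.lookup (Poly_Mapping.single p c) r) \<otimes> \<beta> r)"
    by (rule lext_superset) auto
  then show ?thesis
    by simp
qed

lemma lext_diff: "lext \<beta> (f - h) = lext \<beta> f \<ominus> lext \<beta> h"
proof -
  have "lext \<beta> f = lext \<beta> (f - h) \<oplus> lext \<beta> h"
    using lext_add[of "f - h" h] by simp
  moreover have "(a \<oplus> b) \<ominus> b = a" if "a \<in> carrier L" "b \<in> carrier L" for a b
    using that by algebra
  ultimately show ?thesis
    by simp
qed

lemma lext_vanishes_on_span:
  assumes "\<And>r. r \<in> R \<Longrightarrow> lext \<beta> r = \<zero>" "f \<in> vs_span fscale R"
  shows "lext \<beta> f = \<zero>"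
  using assms(2)
proof (induction rule: fvs.span_induct_alt)
  case base
  show ?case
    by (simp add: lext_def)
next
  case (step c x y)
  then show ?case
    by (simp add: lext_add lext_scale assms(1))
qed

lemma lext_formal_sum: "lext \<beta> (formal_sum ps) = foldr (\<lambda>p r. \<beta> p \<oplus> r) ps \<zero>"
  by (induction ps) (simp_all add: formal_sum_def lext_add lext_single, simp add: lext_def)

end

text \<open>The module algebra axiom evaluates a bilinear expression on one list representing \<open>\<Delta> h\<close>. As for
  \<open>tensor_eq_imp_bilinear_eq\<close>, any representing list gives the same value.\<close>

lemma act_prod_heq:
  assumes u: "u \<in> carrier L" and v: "v \<in> carrier L" and heq: "heq H (comult H h) ps"
  shows "act h (u \<otimes> v) = foldr (\<lambda>(h1, h2) r. (act h1 u \<otimes> act h2 v) \<oplus> r) ps \<zero>"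
proof -
  let ?\<beta> = "\<lambda>(h1, h2). act h1 u \<otimes> act h2 v"
  have \<beta>: "?\<beta> p \<in> carrier L" for p
    using u v by (auto split: prod.split)
  note diff = lext_diff[of ?\<beta>, OF \<beta>] and single = lext_single[of ?\<beta>, OF \<beta>]
  have minus2: "(a \<oplus> b) \<ominus> a \<ominus> b = \<zero>" if "a \<in> carrier L" "b \<in> carrier L" for a b
    using that by algebra
  have minus1: "a \<ominus> a = \<zero>" if "a \<in> carrier L" for a
    using that by algebra
  have comm: "a \<otimes> (\<iota> c \<otimes> b) = \<iota> c \<otimes> (a \<otimes> b)" if "a \<in> carrier L" "b \<in> carrier L" for a b c
    using that iota_closed[of c] by algebra
  have "lext ?\<beta> (formal_sum (comult H h) - formal_sum ps) = \<zero>"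
    using _ heq[unfolded tensor_eq_def]
  proof (rule lext_vanishes_on_span[of ?\<beta>, OF \<beta>])
    fix r assume "r \<in> bilinear_rels (\<cdot>) UNIV (\<cdot>) (UNIV :: 'h set)"
    then show "lext ?\<beta> r = \<zero>"
      unfolding bilinear_rels_def
      using u v
      by (auto simp: diff single act_add act_scl L.l_distr L.r_distr minus1 minus2 comm L.m_assoc)
  qed
  then have "lext ?\<beta> (formal_sum (comult H h)) = lext ?\<beta> (formal_sum ps)"
    unfolding diff using diff_eq_zero_imp_eq[OF lext_closed[of ?\<beta>, OF \<beta>] lext_closed[of ?\<beta>, OF \<beta>]] by blast
  then show ?thesis
    unfolding act_prod[OF u v] lext_formal_sum[of ?\<beta>, OF \<beta>]
    by (simp add: case_prod_unfold)
qed

lemma act_grouplike_prod: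
  assumes "a \<in> G" "u \<in> carrier L" "v \<in> carrier L"
  shows "act a (u \<otimes> v) = act a u \<otimes> act a v"
  using act_prod_heq[OF assms(2,3), of a "[(a, a)]"] assms by (simp add: grouplikes_def)

lemma act_skew_primitive_prod:
  assumes "skew_primitive H a 1 y" "u \<in> carrier L" "v \<in> carrier L"
  shows "act y (u \<otimes> v) = act a u \<otimes> act y v \<oplus> act y u \<otimes> v"
  using act_prod_heq[OF assms(2,3), of y "[(a, y), (y, 1)]"] assms by (simp add: skew_primitive_def act_one)

lemma act_grouplike_power:
  assumes "a \<in> G" "u \<in> carrier L"
  shows "act a (u [^] (n::nat)) = act a u [^] n"
proof (induction n)
  case 0
  show ?case
    by (simp add: act_unit counit_grouplike assms)
next
  case (Suc n)
  then show ?case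
    using assms by (simp add: act_grouplike_prod)
qed

lemma act_grouplike_eq_0:
  assumes "a \<in> G" "u \<in> carrier L" "act a u = \<zero>"
  shows "u = \<zero>"
proof -
  have "act (\<S> a * a) u = act (\<S> a) \<zero>"
    using assms by (simp add: act_mult)
  then show ?thesis
    using assms act_scalar_right[of \<zero> "\<S> a" 0] by (simp add: grouplike_antipode act_one)
qed

lemma inner_faithful_skew_primitive:
  assumes "inner_faithful H L act" "skew_primitive H a 1 y" "\<And>u. u \<in> carrier L \<Longrightarrow> act y u = \<zero>"
  shows "y = 0"
proof (rule ccontr)
  assume "y \<noteq> 0"
  let ?I = "hv.span {h * y * h' | h h'. True}"
  have 0: "act h \<zero> = \<zero>" for h
    using act_scalar_right[of \<zero> h 0] by simp
  have "act h u = \<zero>" if "h \<in> ?I" "u \<in> carrier L" for h u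
    using that(1)
    by (induction rule: hv.span_induct_alt)
      (auto simp: act_zero act_add act_scl act_mult assms(3) 0 that(2))
  moreover have "?I \<noteq> {0}"
    using skew_primitive_hopf_ideal(2)[OF assms(2)] \<open>y \<noteq> 0\<close> by blast
  ultimately show False
    using assms(1) skew_primitive_hopf_ideal(1)[OF assms(2)] unfolding inner_faithful_def by blast
qed

definition ev :: "'l \<Rightarrow> 'k poly \<Rightarrow> 'l" where
  "ev w p = fold_coeffs (\<lambda>a r. \<iota> a \<oplus> w \<otimes> r) p \<zero>"

context
  fixes w assumes w [simp]: "w \<in> carrier L"
begin

lemma ev_0 [simp]: "ev w 0 = \<zero>"
  by (simp add: ev_def)

lemma ev_pCons: "ev w (pCons a p) = \<iota> a \<oplus> w \<otimes> ev w p"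
  by (cases "p = 0 \<and> a = 0") (auto simp: ev_def)

lemma ev_closed [simp]: "ev w p \<in> carrier L"
  by (induction p) (auto simp: ev_pCons)

lemma ev_add: "ev w (p + r) = ev w p \<oplus> ev w r"
proof (induction p r rule: poly_induct2)
  case (pCons a p b r)
  have "\<iota> a \<oplus> \<iota> b \<oplus> w \<otimes> (ev w p \<oplus> ev w r) = \<iota> a \<oplus> w \<otimes> ev w p \<oplus> (\<iota> b \<oplus> w \<otimes> ev w r)"
    using iota_closed[of a] iota_closed[of b] w ev_closed[of p] ev_closed[of r] by algebra
  then show ?case
    by (simp add: ev_pCons pCons iota_add)
qed simp

lemma ev_smult: "ev w (smult c p) = \<iota> c \<otimes> ev w p"
proof (induction p)
  case (pCons a p)
  have "\<iota> c \<otimes> \<iota> a \<oplus> w \<otimes> (\<iota> c \<otimes> ev w p) = \<iota> c \<otimes> (\<iota> a \<oplus> w \<otimes> ev w p)"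
    using iota_closed[of a] iota_closed[of c] w ev_closed[of p] by algebra
  then show ?case
    by (simp add: ev_pCons pCons iota_mult)
qed simp

lemma ev_linear_factor: "ev w ([:- r, 1:] * p) = (w \<oplus> \<iota> (- r)) \<otimes> ev w p"
proof -
  have "[:- r, 1:] * p = smult (- r) p + pCons 0 p"
    by simp
  then have "ev w ([:- r, 1:] * p) = \<iota> (- r) \<otimes> ev w p \<oplus> w \<otimes> ev w p"
    by (simp add: ev_add ev_smult ev_pCons del: smult_minus_left)
  then show ?thesis
    by (simp add: L.l_distr L.a_comm)
qed

lemma ev_monom: "ev w (monom 1 n) = w [^] n"
  by (induction n) (simp_all add: monom_0 monom_Suc ev_pCons L.m_comm)

text \<open>The polynomial splits into linear factors over the algebraically closed field, and \<open>L\<close> has no zero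
  divisors.\<close>

lemma root_in_base_field:
  assumes closed: "\<And>p :: 'k poly. degree p > 0 \<Longrightarrow> \<exists>z. poly p z = 0"
    and "p \<noteq> 0" "ev w p = \<zero>"
  shows "\<exists>c. w = \<iota> c"
  using assms(2,3)
proof (induction "degree p" arbitrary: p rule: less_induct)
  case less
  show ?case
  proof (cases "degree p = 0")
    case True
    then obtain a where "p = [:a:]"
      by (rule degree_eq_zeroE)
    then have "a = 0"
      using less.prems by (simp add: ev_pCons iota_eq_0_iff)
    then show ?thesis
      using \<open>p = [:a:]\<close> less.prems by simp
  next
    case False
    then obtain z where "poly p z = 0"
      using closed[of p] by auto
    then obtain r where r: "p = [:- z, 1:] * r"
      by (auto simp: poly_eq_0_iff_dvd)
    then have "r \<noteq> 0"
      using less.prems by auto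
    then have deg: "degree r < degree p"
      unfolding r by (subst degree_mult_eq) auto
    have "w \<oplus> \<iota> (- z) = \<zero> \<or> ev w r = \<zero>"
      using less.prems(2) unfolding r ev_linear_factor by (simp add: L.integral_iff)
    then show ?thesis
    proof
      assume "w \<oplus> \<iota> (- z) = \<zero>"
      then have "w \<oplus> (\<iota> (- z) \<oplus> \<iota> z) = \<iota> z"
        by (simp add: L.a_assoc[symmetric])
      then have "w = \<iota> z"
        by (simp flip: iota_add)
      then show ?thesis
        by blast
    next
      assume "ev w r = \<zero>"
      then show ?thesis
        using less.hyps[OF deg \<open>r \<noteq> 0\<close>] by blast
    qed
  qed
qed

lemma root_of_scalar_in_base_field:
  assumes closed: "\<And>p :: 'k poly. degree p > 0 \<Longrightarrow> \<exists>z. poly p z = 0"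
    and "n > 0" "w [^] (n::nat) = \<iota> c"
  shows "\<exists>c. w = \<iota> c"
proof (rule root_in_base_field[OF closed])
  show "monom 1 n + [:- c:] \<noteq> (0 :: 'k poly)"
  proof
    assume "monom 1 n + [:- c:] = (0 :: 'k poly)"
    then have "coeff (monom 1 n + [:- c:]) n = (0 :: 'k)"
      by simp
    then show False
      using \<open>n > 0\<close> by (simp add: coeff_eq_0)
  qed
  have "ev w (monom 1 n + [:- c:]) = \<iota> (c + - c)"
    unfolding ev_add ev_monom iota_add using assms(3) by (simp add: ev_pCons)
  then show "ev w (monom 1 n + [:- c:]) = \<zero>"
    by simp
qed

end

end

section \<open>The polynomials expressing powers of a twisted difference\<close>

text \<open>If \<open>x\<close> acts as \<open>w (g - 1)\<close> and \<open>g w = q w\<close>, then \<open>x\<^sup>j\<close> acts as \<open>w\<^sup>j K\<^sub>j(g)\<close>, where \<open>K\<^sub>j\<close>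
  is \<open>twist_poly q j\<close>.\<close>

definition twist_poly :: "'k::field \<Rightarrow> nat \<Rightarrow> 'k poly" where
  "twist_poly q j = (\<Prod>i<j. [:- 1, q ^ i:])"

lemma twist_poly_0: "twist_poly q 0 = 1"
  by (simp add: twist_poly_def)

lemma twist_poly_Suc: "twist_poly q (Suc j) = [:- 1, q ^ j:] * twist_poly q j"
  by (simp add: twist_poly_def mult.commute)

lemma coeff_twist_poly_Suc:
  "coeff (twist_poly q (Suc j)) i = q ^ j * (case i of 0 \<Rightarrow> 0 | Suc l \<Rightarrow> coeff (twist_poly q j) l) - coeff (twist_poly q j) i"
  by (simp add: twist_poly_Suc coeff_pCons split: nat.split)

lemma coeff_twist_poly_high: "j < i \<Longrightarrow> coeff (twist_poly q j) i = 0"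
proof (induction j arbitrary: i)
  case (Suc j)
  then show ?case
    by (simp add: coeff_twist_poly_Suc split: nat.split)
qed (simp add: twist_poly_0)

lemma coeff_twist_poly_top: "q \<noteq> 0 \<Longrightarrow> coeff (twist_poly q j) j \<noteq> 0"
  by (induction j) (simp_all add: twist_poly_0 coeff_twist_poly_Suc coeff_twist_poly_high)

text \<open>Both sides have degree at most \<open>m\<close>, the same coefficient in degree \<open>m\<close> and the \<open>m\<close> distinct roots \<open>q\<^sup>l\<close>.\<close>

lemma twist_poly_primitive_root:
  assumes q: "primitive_root_of_unity m q" and "m > 0"
  shows "twist_poly q m = smult (coeff (twist_poly q m) m) (monom 1 m - 1)"
proof -
  let ?K = "twist_poly q m" and ?D = "twist_poly q m - smult (coeff (twist_poly q m) m) (monom 1 m - 1)"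
  have qm: "q ^ m = 1"
    using q by (simp add: primitive_root_of_unity_def)
  have inj: "inj_on (\<lambda>l. q ^ l) {..<m}"
  proof (rule linorder_inj_onI)
    fix i j assume ij: "i < j" "i \<in> {..<m}" "j \<in> {..<m}"
    show "q ^ i \<noteq> q ^ j"
    proof
      assume "q ^ i = q ^ j"
      then have "q ^ i * q ^ (j - i) = q ^ i * 1"
        using ij by (metis le_add_diff_inverse less_imp_le mult_1_right power_add)
      moreover have "q ^ i \<noteq> 0"
        using qm \<open>m > 0\<close> by (auto simp: power_0_left)
      ultimately have "q ^ (j - i) = 1"
        using mult_left_cancel by blast
      then show False
        using q ij by (auto simp: primitive_root_of_unity_def)
    qed
  qed auto
  have root: "poly ?D (q ^ l) = 0" if "l < m" for l
  proof -
    have "\<exists>i<m. q ^ i * q ^ l = 1"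
    proof (cases "l = 0")
      case True
      then show ?thesis
        using \<open>m > 0\<close> by auto
    next
      case False
      then show ?thesis
        using that qm by (intro exI[of _ "m - l"]) (simp flip: power_add)
    qed
    then have "poly ?K (q ^ l) = 0"
      unfolding twist_poly_def poly_prod by (auto simp: mult.commute)
    moreover have "(q ^ l) ^ m = 1"
      using qm by (metis power_mult mult.commute power_one)
    ultimately show ?thesis
      by (simp add: poly_monom)
  qed
  have deg: "degree ?D < m" if "?D \<noteq> 0"
  proof -
    have "coeff ?D i = 0" if "i \<ge> m" for i
      using that \<open>m > 0\<close> by (cases "i = m") (auto simp: coeff_twist_poly_high coeff_eq_0)
    then show ?thesis
      using \<open>?D \<noteq> 0\<close> by (metis leading_coeff_0_iff not_le)
  qed
  have "?D = 0"
  proof (rule ccontr)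
    assume nz: "?D \<noteq> 0"
    have "(\<lambda>l. q ^ l) ` {..<m} \<subseteq> {z. poly ?D z = 0}"
      using root by blast
    then have "card ((\<lambda>l. q ^ l) ` {..<m}) \<le> card {z. poly ?D z = 0}"
      by (rule card_mono[OF poly_roots_finite[OF nz]])
    then have "m \<le> card {z. poly ?D z = 0}"
      by (simp add: card_image[OF inj] del: poly_diff)
    also have "\<dots> \<le> degree ?D"
      by (rule card_poly_roots_bound[OF nz])
    finally show False
      using deg[OF nz] by simp
  qed
  then show ?thesis
    by simp
qed

context hopf_algebra
begin

fun twist_product :: "'k \<Rightarrow> 'h \<Rightarrow> nat \<Rightarrow> 'h" where
  "twist_product q g 0 = 1"
| "twist_product q g (Suc j) = (q ^ j \<cdot> g - 1) * twist_product q g j"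

lemma twist_product_eq: "twist_product q g j = (\<Sum>i\<le>j. coeff (twist_poly q j) i \<cdot> g ^ i)"
proof (induction j)
  case 0
  show ?case
    by (simp add: twist_poly_0)
next
  case (Suc j)
  let ?k = "coeff (twist_poly q j)"
  have "twist_product q g (Suc j) = (\<Sum>i\<le>j. (q ^ j * ?k i) \<cdot> g ^ Suc i) - (\<Sum>i\<le>j. ?k i \<cdot> g ^ i)"
    by (simp add: Suc left_diff_distrib scl_mult_left scl_mult_right sum_distrib_left
        hv.scale_right_diff_distrib sum_subtractf mult.commute[of _ "q ^ j"])
  also have "(\<Sum>i\<le>j. (q ^ j * ?k i) \<cdot> g ^ Suc i) = (\<Sum>i\<le>Suc j. (q ^ j * (case i of 0 \<Rightarrow> 0 | Suc l \<Rightarrow> ?k l)) \<cdot> g ^ i)"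
    by (subst sum.atMost_Suc_shift) simp
  also have "(\<Sum>i\<le>j. ?k i \<cdot> g ^ i) = (\<Sum>i\<le>Suc j. ?k i \<cdot> g ^ i)"
    by (simp add: coeff_twist_poly_high)
  finally show ?case
    by (simp only: coeff_twist_poly_Suc hv.scale_left_diff_distrib sum_subtractf)
qed

lemma twist_product_primitive_root:
  assumes "primitive_root_of_unity m q" "m > 0"
  shows "twist_product q g m = coeff (twist_poly q m) m \<cdot> (g ^ m - 1)"
proof -
  define c where "c = coeff (twist_poly q m) m"
  have coef: "coeff (twist_poly q m) i = (if i = m then c else if i = 0 then - c else 0)" for i
    by (subst twist_poly_primitive_root[OF assms]) (use \<open>m > 0\<close> in \<open>auto simp: coeff_eq_0 c_def\<close>)
  have "twist_product q g m = (\<Sum>i\<le>m. (if i = m then c else if i = 0 then - c else 0) \<cdot> g ^ i)"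
    by (simp only: twist_product_eq coef)
  also have "\<dots> = (\<Sum>i\<in>{0, m}. (if i = m then c else if i = 0 then - c else 0) \<cdot> g ^ i)"
    by (intro sum.mono_neutral_right) auto
  also have "\<dots> = c \<cdot> (g ^ m - 1)"
    using \<open>m > 0\<close> by (simp add: hv.scale_right_diff_distrib)
  finally show ?thesis
    by (simp only: c_def)
qed

end

section \<open>An inner faithful action on a field forces a Taft algebra\<close>

text \<open>On a field \<open>x\<close> acts as \<open>w (g - 1)\<close> with \<open>g w = q w\<close>, so that \<open>x\<^sup>m = \<alpha> (g\<^sup>m - 1)\<close> acts as
  \<open>c w\<^sup>m (g\<^sup>m - 1)\<close> with a scalar \<open>c \<noteq> 0\<close>. If \<open>g\<^sup>m \<noteq> 1\<close>, then \<open>g\<^sup>m - 1\<close> does not act by zero, \<open>w\<^sup>m\<close> is a scalar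
  and hence so is \<open>w\<close>. But \<open>g\<close> fixes scalars, so that \<open>w = q w\<close> and \<open>w = 0\<close>, contradicting the
  inner faithfulness.\<close>

lemma (in normalized_rank_one_hopf_algebra) inner_faithful_imp_order:
  fixes L :: "('l, 'm) ring_scheme" (structure)
  assumes closed: "\<And>p :: 'k poly. degree p > 0 \<Longrightarrow> \<exists>z. poly p z = 0"
    and L: "field L" "module_algebra H L \<iota> act" "inner_faithful H L act"
  shows "g ^ m = 1"
proof (rule ccontr)
  assume gm: "g ^ m \<noteq> 1"
  interpret L: field L by fact
  interpret A: hopf_action_on_field H L \<iota> act
    by unfold_locales (fact L)
  note faithful = A.inner_faithful_skew_primitive[OF L(3)]
  let ?g = "act g" and ?x = "act x"
  have x0: "x \<noteq> 0"
    using x_notin_kG hv.span_zero by metis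
  have "\<exists>u. u \<in> carrier L \<and> act (g - 1) u \<noteq> \<zero>"
    using faithful[OF skew_primitive_grouplike_diff[OF g_grouplike]] g_neq_1 by auto
  then obtain u0 where u0: "u0 \<in> carrier L" "act (g - 1) u0 \<noteq> \<zero>"
    by blast
  define D where "D = act (g - 1) u0"
  have D: "D = ?g u0 \<ominus> u0" "D \<in> carrier L" "D \<noteq> \<zero>"
    using u0 by (simp_all add: D_def A.act_diff A.act_one)
  define w where "w = ?x u0 \<otimes> inv D"
  have D_unit: "D \<in> Units L"
    using D L.field_Units by simp
  have w: "w \<in> carrier L"
    using D_unit u0 by (simp add: w_def)
  have wD: "w \<otimes> D = ?x u0"
    using D_unit D(2) u0 by (simp add: w_def L.m_assoc)
  have rearrange: "b \<otimes> (a \<ominus> f) = c \<otimes> (e \<ominus> d)"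
    if "a \<otimes> b \<oplus> c \<otimes> d = e \<otimes> c \<oplus> b \<otimes> f"
      and car: "a \<in> carrier L" "b \<in> carrier L" "c \<in> carrier L" "d \<in> carrier L" "e \<in> carrier L" "f \<in> carrier L"
    for a b c d e f
  proof -
    have "b \<otimes> (a \<ominus> f) = (a \<otimes> b \<oplus> c \<otimes> d) \<ominus> (c \<otimes> d \<oplus> b \<otimes> f)"
      using car by algebra
    also have "\<dots> = (e \<otimes> c \<oplus> b \<otimes> f) \<ominus> (c \<otimes> d \<oplus> b \<otimes> f)"
      using that(1) by simp
    also have "\<dots> = c \<otimes> (e \<ominus> d)"
      using car by algebra
    finally show ?thesis .
  qed
  \<comment> \<open>Comparing \<open>x (u0 v)\<close> with \<open>x (v u0)\<close> determines \<open>x v\<close>.\<close>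
  have x_act: "?x v = w \<otimes> (?g v \<ominus> v)" if v: "v \<in> carrier L" for v
  proof -
    have c: "?g u0 \<in> carrier L" "?x u0 \<in> carrier L" "?g v \<in> carrier L" "?x v \<in> carrier L"
      using u0 v by auto
    have "?g u0 \<otimes> ?x v \<oplus> ?x u0 \<otimes> v = ?g v \<otimes> ?x u0 \<oplus> ?x v \<otimes> u0"
      using A.act_skew_primitive_prod[OF x_skew u0(1) v] A.act_skew_primitive_prod[OF x_skew v u0(1)] u0(1) v
      by (simp add: L.m_comm)
    then have "?x v \<otimes> (?g u0 \<ominus> u0) = ?x u0 \<otimes> (?g v \<ominus> v)"
      by (rule rearrange[OF _ c(1) c(4) c(2) v c(3) u0(1)])
    then have "?x v \<otimes> D = w \<otimes> (?g v \<ominus> v) \<otimes> D"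
      unfolding D(1)[symmetric] wD[symmetric] using c v w D(2) by (simp add: L.m_ac)
    then show ?thesis
      using D c v w L.m_rcancel[of D "?x v" "w \<otimes> (?g v \<ominus> v)"] by simp
  qed
  have gD: "?g D = ?g (?g u0) \<ominus> ?g u0"
  proof -
    have "g * (g - 1) = (g - 1) * g"
      by (simp add: left_diff_distrib right_diff_distrib)
    then have "?g D = act (g - 1) (?g u0)"
      unfolding D_def using u0(1) by (metis A.act_mult)
    then show ?thesis
      using u0(1) by (simp add: A.act_diff A.act_one)
  qed
  \<comment> \<open>Apply both sides of \<open>g x = q x g\<close> to \<open>u0\<close> and cancel \<open>g (g u0 - u0)\<close>.\<close>
  have gw: "?g w = \<iota> q \<otimes> w"
  proof -
    have "?g w \<otimes> ?g D = ?g (?x u0)"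
      using A.act_grouplike_prod[OF g_grouplike w D(2)] wD by simp
    also have "\<dots> = act (q \<cdot> (x * g)) u0"
      using u0(1) by (simp flip: A.act_mult gx)
    also have "\<dots> = \<iota> q \<otimes> (w \<otimes> ?g D)"
      using u0(1) by (simp add: A.act_scl A.act_mult x_act gD)
    finally have "?g w \<otimes> ?g D = (\<iota> q \<otimes> w) \<otimes> ?g D"
      using w D(2) by (simp add: L.m_assoc)
    moreover have "?g D \<noteq> \<zero>"
      using A.act_grouplike_eq_0[OF g_grouplike D(2)] D(3) by blast
    ultimately show ?thesis
      using w D(2) by (simp add: L.m_rcancel)
  qed
  \<comment> \<open>Since \<open>g\<close> multiplies \<open>w\<^sup>j\<close> by \<open>q\<^sup>j\<close>, one further \<open>x\<close> contributes \<open>w (q\<^sup>j g - 1)\<close>.\<close>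
  have x_power_act: "act (x ^ j) u = w [^] j \<otimes> act (twist_product q g j) u" if u: "u \<in> carrier L" for j u
  proof (induction j)
    case 0
    then show ?case
      using u by (simp add: A.act_one)
  next
    case (Suc j)
    let ?V = "act (twist_product q g j) u" and ?W = "w [^] j" and ?Q = "\<iota> (q ^ j)"
    have V: "?V \<in> carrier L" "?W \<in> carrier L" "?g ?V \<in> carrier L" "?Q \<in> carrier L"
      using u w by auto
    have "act (x ^ Suc j) u = ?x (?W \<otimes> ?V)"
      using u Suc by (simp add: A.act_mult)
    also have "\<dots> = w \<otimes> (?g ?W \<otimes> ?g ?V \<ominus> ?W \<otimes> ?V)"
      using V by (simp add: x_act A.act_grouplike_prod[OF g_grouplike])
    also have "?g ?W = ?Q \<otimes> ?W"
      using w by (simp add: A.act_grouplike_power[OF g_grouplike] gw L.nat_pow_distrib A.iota_power)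
    also have "w \<otimes> (?Q \<otimes> ?W \<otimes> ?g ?V \<ominus> ?W \<otimes> ?V) = ?W \<otimes> w \<otimes> (?Q \<otimes> ?g ?V \<ominus> ?V)"
      using w V by algebra
    also have "?Q \<otimes> ?g ?V \<ominus> ?V = act (twist_product q g (Suc j)) u"
      using u V by (simp add: A.act_mult A.act_diff A.act_scl A.act_one)
    finally show ?case
      by simp
  qed
  obtain \<alpha> where \<alpha>: "x ^ m = \<alpha> \<cdot> (g ^ m - 1)"
    using x_power_m by blast
  let ?c = "coeff (twist_poly q m) m"
  have c: "?c \<noteq> 0"
    by (rule coeff_twist_poly_top[OF q_neq_0])
  have "\<exists>u. u \<in> carrier L \<and> act (g ^ m - 1) u \<noteq> \<zero>"
    using faithful[OF skew_primitive_grouplike_diff[OF grouplike_power[OF g_grouplike]]] gm by auto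
  then obtain u where u: "u \<in> carrier L" "act (g ^ m - 1) u \<noteq> \<zero>"
    by blast
  let ?z = "act (g ^ m - 1) u"
  have z: "?z \<in> carrier L" and wm: "w [^] m \<in> carrier L"
    using u w by auto
  have "w [^] m \<otimes> (\<iota> ?c \<otimes> ?z) = \<iota> \<alpha> \<otimes> ?z"
    using x_power_act[OF u(1), of m] u(1)
    by (simp add: \<alpha> twist_product_primitive_root[OF q_primitive m(1)] A.act_scl)
  then have "(w [^] m \<otimes> \<iota> ?c) \<otimes> ?z = \<iota> \<alpha> \<otimes> ?z"
    using z wm by (simp add: L.m_assoc)
  then have wc: "w [^] m \<otimes> \<iota> ?c = \<iota> \<alpha>"
    using z wm u(2) by (simp add: L.m_rcancel)
  have "w [^] m = w [^] m \<otimes> \<iota> (?c * (1 / ?c))"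
    using wm c by simp
  also have "\<dots> = \<iota> (\<alpha> * (1 / ?c))"
    unfolding A.iota_mult using wm by (simp add: L.m_assoc[symmetric] wc)
  finally obtain r where r: "w = \<iota> r"
    using A.root_of_scalar_in_base_field[OF w closed m(1)] by blast
  have "?g w = w"
    unfolding r by (simp add: A.act_scalar counit_grouplike[OF g_grouplike])
  then have "\<iota> q \<otimes> w \<ominus> w = \<zero>"
    using gw w by (simp add: L.minus_eq L.r_neg)
  moreover have "\<iota> q \<otimes> w = \<iota> (q - 1) \<otimes> w \<oplus> w"
    using w A.iota_add[of "q - 1" 1] by (simp add: L.l_distr)
  moreover have "(a \<oplus> b) \<ominus> b = a" if "a \<in> carrier L" "b \<in> carrier L" for a b
    using that by algebra
  ultimately have "\<iota> (q - 1) \<otimes> w = \<zero>"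
    using w by simp
  then have "w = \<zero>"
    using w q_neq_1 A.iota_eq_0_iff[of "q - 1"] by (simp add: L.integral_iff)
  then have "x = 0"
    by (intro faithful[OF x_skew]) (simp add: x_act)
  with x0 show False ..
qed

section \<open>Constructing an inner faithful action\<close>

text \<open>The data needed for an action in which \<open>x\<close> acts as \<open>w (g - 1)\<close>: an action \<open>\<sigma>\<close> of \<open>G\<close> on a field, an eigenvector
  \<open>w\<close> for the character \<open>chi\<close>, and an element \<open>t\<close> whose translates are independent
  over \<open>k\<close>, even with powers of \<open>w\<close> as coefficients.\<close>

locale twisted_field_action = normalized_rank_one_hopf_algebra H g x q
  for H :: "('k::field_char_0, 'h::ring_1) hopf" and g x q +
  fixes \<iota> :: "'k \<Rightarrow> 'f::field" and \<sigma> :: "'h \<Rightarrow> 'f \<Rightarrow> 'f" and w t :: 'f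
  assumes gm: "g ^ m = 1"
    and iota_add: "\<iota> (c + d) = \<iota> c + \<iota> d"
    and iota_mult: "\<iota> (c * d) = \<iota> c * \<iota> d"
    and iota_one: "\<iota> 1 = 1"
    and sigma_add: "a \<in> grouplikes H \<Longrightarrow> \<sigma> a (u + v) = \<sigma> a u + \<sigma> a v"
    and sigma_mult: "a \<in> grouplikes H \<Longrightarrow> \<sigma> a (u * v) = \<sigma> a u * \<sigma> a v"
    and sigma_iota: "a \<in> grouplikes H \<Longrightarrow> \<sigma> a (\<iota> c) = \<iota> c"
    and sigma_one: "\<sigma> 1 u = u"
    and sigma_compose: "a \<in> grouplikes H \<Longrightarrow> b \<in> grouplikes H \<Longrightarrow> \<sigma> (a * b) u = \<sigma> a (\<sigma> b u)"
    and sigma_w: "a \<in> grouplikes H \<Longrightarrow> \<sigma> a w = \<iota> (chi a) * w"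
    and independent: "(\<Sum>p\<in>basis_index. \<iota> (k p) * (w ^ fst p * \<sigma> (snd p) t)) = 0 \<Longrightarrow> \<forall>p\<in>basis_index. k p = 0"
begin

lemma iota_zero: "\<iota> 0 = 0"
  using iota_add[of 0 0] unfolding add_0_right by (rule iffD1[OF add_cancel_right_right])

lemma iota_minus: "\<iota> (c - d) = \<iota> c - \<iota> d"
  using iota_add[of "c - d" d] by simp

lemma iota_sum: "\<iota> (sum f A) = (\<Sum>i\<in>A. \<iota> (f i))"
  by (induction A rule: infinite_finite_induct) (simp_all add: iota_zero iota_add)

lemma iota_power: "\<iota> (c ^ n) = \<iota> c ^ n"
  by (induction n) (simp_all add: iota_one iota_mult)

lemma vs_F: "vector_space (\<lambda>c u. \<iota> c * u)"
  by unfold_locales (simp_all add: iota_add iota_mult iota_one algebra_simps)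

lemma sigma_zero: "a \<in> G \<Longrightarrow> \<sigma> a 0 = 0"
  using sigma_add[of a 0 0] unfolding add_0_right by (intro iffD1[OF add_cancel_right_right])

lemma sigma_minus: "a \<in> G \<Longrightarrow> \<sigma> a (u - v) = \<sigma> a u - \<sigma> a v"
  using sigma_add[of a "u - v" v] by simp

lemma sigma_sum: "a \<in> G \<Longrightarrow> \<sigma> a (sum f A) = (\<Sum>i\<in>A. \<sigma> a (f i))"
  by (induction A rule: infinite_finite_induct) (simp_all add: sigma_zero sigma_add)

lemma sigma_unit: "a \<in> G \<Longrightarrow> \<sigma> a 1 = 1"
  using sigma_iota[of a 1] by (simp add: iota_one)

text \<open>The operator by which \<open>x\<close> will act.\<close>

definition X :: "'f \<Rightarrow> 'f" where
  "X u = w * (\<sigma> g u - u)"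

lemma X_add: "X (u + v) = X u + X v"
  by (simp add: X_def sigma_add[OF g_grouplike] algebra_simps)

lemma X_zero: "X 0 = 0"
  by (simp add: X_def sigma_zero[OF g_grouplike])

lemma X_iota: "X (\<iota> c * u) = \<iota> c * X u"
  by (simp add: X_def sigma_mult[OF g_grouplike] sigma_iota[OF g_grouplike] algebra_simps)

lemma Xn_add: "(X ^^ n) (u + v) = (X ^^ n) u + (X ^^ n) v"
  by (induction n) (simp_all add: X_add)

lemma Xn_zero: "(X ^^ n) 0 = 0"
  by (induction n) (simp_all add: X_zero)

lemma Xn_iota: "(X ^^ n) (\<iota> c * u) = \<iota> c * (X ^^ n) u"
  by (induction n) (simp_all add: X_iota)

lemma sigma_X: "a \<in> G \<Longrightarrow> \<sigma> a (X u) = \<iota> (chi a) * X (\<sigma> a u)"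
  by (simp add: X_def sigma_mult sigma_minus sigma_w sigma_compose[symmetric] g_grouplike g_comm mult.assoc)

lemma sigma_Xn: "a \<in> G \<Longrightarrow> \<sigma> a ((X ^^ n) u) = \<iota> (chi a) ^ n * (X ^^ n) (\<sigma> a u)"
proof (induction n)
  case (Suc n)
  then show ?case
    using X_iota[of "chi a ^ n"] by (simp add: sigma_X iota_power mult.assoc)
qed simp

lemma Xn_eq: "(X ^^ j) u = w ^ j * (\<Sum>i\<le>j. \<iota> (coeff (twist_poly q j) i) * \<sigma> (g ^ i) u)"
proof (induction j)
  case 0
  show ?case
    by (simp add: twist_poly_0 iota_one sigma_one)
next
  case (Suc j)
  let ?k = "coeff (twist_poly q j)" and ?s = "\<lambda>i. \<sigma> (g ^ i) u"
  have gs: "\<sigma> g (?s i) = ?s (Suc i)" for i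
    using sigma_compose[OF g_grouplike grouplike_power[OF g_grouplike], of i u] by simp
  have gw: "\<sigma> g (w ^ n) = \<iota> (q ^ n) * w ^ n" for n
    by (induction n) (simp_all add: sigma_unit g_grouplike iota_one sigma_mult sigma_w chi_g iota_mult)
  have "(X ^^ Suc j) u = w * (\<iota> (q ^ j) * w ^ j * (\<Sum>i\<le>j. \<iota> (?k i) * ?s (Suc i)) - w ^ j * (\<Sum>i\<le>j. \<iota> (?k i) * ?s i))"
    by (simp add: Suc X_def sigma_mult[OF g_grouplike] gw sigma_sum[OF g_grouplike] sigma_iota[OF g_grouplike] gs)
  also have "\<dots> = w ^ Suc j * ((\<Sum>i\<le>j. \<iota> (q ^ j * ?k i) * ?s (Suc i)) - (\<Sum>i\<le>j. \<iota> (?k i) * ?s i))"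
    by (simp add: iota_mult sum_distrib_left algebra_simps)
  also have "(\<Sum>i\<le>j. \<iota> (q ^ j * ?k i) * ?s (Suc i)) =
      (\<Sum>i\<le>Suc j. \<iota> (q ^ j * (case i of 0 \<Rightarrow> 0 | Suc l \<Rightarrow> ?k l)) * ?s i)"
    by (subst sum.atMost_Suc_shift) (simp add: iota_zero)
  also have "(\<Sum>i\<le>j. \<iota> (?k i) * ?s i) = (\<Sum>i\<le>Suc j. \<iota> (?k i) * ?s i)"
    by (simp add: coeff_twist_poly_high iota_zero)
  finally show ?case
    by (simp only: coeff_twist_poly_Suc iota_minus left_diff_distrib sum_subtractf)
qed

lemma Xm: "(X ^^ m) u = 0"
proof -
  define c where "c = coeff (twist_poly q m) m"
  have coef: "coeff (twist_poly q m) i = (if i = m then c else if i = 0 then - c else 0)" for i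
    by (subst twist_poly_primitive_root[OF q_primitive m(1)]) (use m(1) in \<open>auto simp: coeff_eq_0 c_def\<close>)
  have "(\<Sum>i\<le>m. \<iota> (coeff (twist_poly q m) i) * \<sigma> (g ^ i) u) =
      (\<Sum>i\<in>{0, m}. \<iota> (if i = m then c else if i = 0 then - c else 0) * \<sigma> (g ^ i) u)"
    unfolding coef by (intro sum.mono_neutral_right) (auto simp: iota_zero)
  also have "\<dots> = 0"
    using m(1) iota_minus[of 0 c] by (simp add: gm sigma_one iota_zero)
  finally show ?thesis
    by (simp add: Xn_eq)
qed

lemma Xn_high: "m \<le> n \<Longrightarrow> (X ^^ n) u = 0"
  using funpow_add[of "n - m" m X] by (simp add: Xm Xn_zero)

lemma x_power_high: "m \<le> n \<Longrightarrow> x ^ n = 0"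
proof -
  assume "m \<le> n"
  then have "x ^ n = x ^ (n - m) * x ^ m"
    by (simp flip: power_add)
  then show ?thesis
    using x_power_m gm by auto
qed

definition act :: "'h \<Rightarrow> 'f \<Rightarrow> 'f" where
  "act h u = (\<Sum>p\<in>basis_index. \<iota> (bcoord p h) * (X ^^ fst p) (\<sigma> (snd p) u))"

lemma act_add: "act (h + h') u = act h u + act h' u"
  by (simp add: act_def hv.functionalD(1)[OF bcoord(1)] iota_add distrib_right sum.distrib)

lemma act_scl: "act (c \<cdot> h) u = \<iota> c * act h u"
  by (simp add: act_def hv.functionalD(2)[OF bcoord(1)] iota_mult sum_distrib_left mult.assoc)

lemma act_zero: "act 0 u = 0"
  using act_scl[of 0 0 u] by (simp add: iota_zero)

lemma act_add_right: "act h (u + v) = act h u + act h v"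
  unfolding act_def sum.distrib[symmetric]
  by (intro sum.cong) (auto simp: sigma_add Xn_add distrib_left)

lemma act_zero_right: "act h 0 = 0"
  using act_add_right[of h 0 0] unfolding add_0_right by (rule iffD1[OF add_cancel_right_right])

lemma act_iota_right: "act h (\<iota> c * u) = \<iota> c * act h u"
  unfolding act_def sum_distrib_left
  by (intro sum.cong) (auto simp: sigma_mult sigma_iota Xn_iota mult.left_commute)

lemma act_basis:
  assumes "a \<in> G"
  shows "act (x ^ j * a) u = (X ^^ j) (\<sigma> a u)"
proof (cases "j < m")
  case True
  then have ja: "(j, a) \<in> basis_index"
    using assms by simp
  have "act (basis_elem (j, a)) u =
      (\<Sum>p\<in>basis_index. if p = (j, a) then (X ^^ fst p) (\<sigma> (snd p) u) else 0)"
    unfolding act_def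
    by (intro sum.cong refl) (use bcoord(2)[OF _ ja] in \<open>auto simp: iota_one iota_zero simp del: mem_Sigma_iff\<close>)
  then show ?thesis
    using ja finite_basis_index by simp
next
  case False
  then show ?thesis
    using x_power_high Xn_high by (simp add: act_zero)
qed

lemma act_grouplike: "a \<in> G \<Longrightarrow> act a u = \<sigma> a u"
  using act_basis[of a 0] by simp

lemma act_x: "act x u = X u"
  using act_basis[OF one_grouplike, of 1] by (simp add: sigma_one)

lemma act_grouplike_mult:
  assumes a: "a \<in> G"
  shows "act (a * h) u = \<sigma> a (act h u)"
proof -
  have "h \<in> hv.span (basis_elem ` basis_index)"
    by (simp add: span_basis)
  then show ?thesis
  proof (induction rule: hv.span_induct_alt)
    case base
    then show ?case
      by (simp add: act_zero sigma_zero a)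
  next
    case (step c y z)
    then obtain j b where jb: "b \<in> G" "y = x ^ j * b"
      by auto
    have "a * y = chi a ^ j \<cdot> (x ^ j * (a * b))"
      using basis_elem_mult[OF a jb(1), of 0 j] by (simp add: jb(2))
    then have "act (a * y) u = \<iota> (chi a) ^ j * (X ^^ j) (\<sigma> a (\<sigma> b u))"
      using a jb by (simp add: act_scl act_basis grouplike_mult sigma_compose iota_power)
    then have "act (a * y) u = \<sigma> a (act y u)"
      using a jb by (simp add: act_basis sigma_Xn)
    then show ?case
      using step.IH a
      by (simp add: distrib_left scl_mult_right act_add act_scl sigma_add sigma_mult sigma_iota)
  qed
qed

lemma act_x_mult: "act (x * h) u = X (act h u)"
proof -
  have "h \<in> hv.span (basis_elem ` basis_index)"
    by (simp add: span_basis)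
  then show ?thesis
  proof (induction rule: hv.span_induct_alt)
    case base
    then show ?case
      by (simp add: act_zero X_zero)
  next
    case (step c y z)
    then obtain j b where jb: "b \<in> G" "y = x ^ j * b"
      by auto
    have "act (x * y) u = X (act y u)"
      using act_basis[OF jb(1), of "Suc j"] act_basis[OF jb(1), of j] by (simp add: jb(2) mult.assoc)
    then show ?case
      using step.IH by (simp add: distrib_left scl_mult_right act_add act_scl X_add X_iota)
  qed
qed

lemma subalgebra_induct:
  assumes "hv.subspace K" "1 \<in> K" "\<And>a b. a \<in> K \<Longrightarrow> b \<in> K \<Longrightarrow> a * b \<in> K" "G \<subseteq> K" "x \<in> K"
  shows "h \<in> K"
  using generated_subset[of K] assms by (auto simp: is_subalgebra_def)

text \<open>The elements for which an identity of this kind holds form a subalgebra, so that it is enough to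
  check grouplike elements and \<open>x\<close>. The same argument gives \<open>act_prod\<close> and \<open>act_unit\<close>.\<close>

lemma act_mult: "act (h * h') u = act h (act h' u)"
proof -
  let ?K = "{h. \<forall>h' u. act (h * h') u = act h (act h' u)}"
  have "h \<in> ?K"
  proof (rule subalgebra_induct)
    show "hv.subspace ?K"
      by (rule hv.subspaceI)
        (auto simp: act_zero distrib_right scl_mult_left act_add act_scl)
    show "1 \<in> ?K"
      using act_grouplike[OF one_grouplike] by (simp add: sigma_one)
    show "a * b \<in> ?K" if "a \<in> ?K" "b \<in> ?K" for a b
      using that by (simp add: mult.assoc)
    show "G \<subseteq> ?K"
      by (auto simp: act_grouplike_mult act_grouplike)
    show "x \<in> ?K"
      by (simp add: act_x_mult act_x)
  qed
  then show ?thesis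
    by blast
qed

lemma bilin_act: "bilin (\<lambda>c u. \<iota> c * u) (\<lambda>h h'. act h u * act h' v)"
  by (simp add: bilinear_on_pairs_def act_add act_scl algebra_simps)

lemma act_prod: "act h (u * v) = comult_sum (\<lambda>h1 h2. act h1 u * act h2 v) h"
proof -
  let ?K = "{h. \<forall>u v. act h (u * v) = comult_sum (\<lambda>h1 h2. act h1 u * act h2 v) h}"
  note lin = comult_sum_add[OF vs_F bilin_act] comult_sum_scl[OF vs_F bilin_act]
  have "h \<in> ?K"
  proof (rule subalgebra_induct)
    show "hv.subspace ?K"
    proof (rule hv.subspaceI)
      have "comult_sum (\<lambda>h1 h2. act h1 u * act h2 v) 0 = 0" for u v
        using lin(2)[of u v 0 0] by (simp add: iota_zero)
      then show "0 \<in> ?K"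
        by (simp add: act_zero)
    qed (auto simp: act_add act_scl lin)
    show "1 \<in> ?K"
      using act_grouplike[OF one_grouplike] by (simp add: comult_sum_one[OF vs_F bilin_act] sigma_one)
    show "a * b \<in> ?K" if ab: "a \<in> ?K" "b \<in> ?K" for a b
    proof (intro CollectI allI)
      fix u v
      have "act (a * b) (u * v) = act a (comult_sum (\<lambda>b1 b2. act b1 u * act b2 v) b)"
        using ab by (simp add: act_mult)
      also have "\<dots> = comult_sum (\<lambda>b1 b2. act a (act b1 u * act b2 v)) b"
        by (rule comult_sum_additive) (simp_all add: act_add_right act_zero_right)
      also have "\<dots> = comult_sum (\<lambda>b1 b2. comult_sum (\<lambda>a1 a2. act (a1 * b1) u * act (a2 * b2) v) a) b"
        using ab by (simp add: act_mult)
      also have "\<dots> = comult_sum (\<lambda>h1 h2. act h1 u * act h2 v) (a * b)"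
        unfolding comult_sum_mult[OF vs_F bilin_act] by (rule comult_sum_swap)
      finally show "act (a * b) (u * v) = comult_sum (\<lambda>h1 h2. act h1 u * act h2 v) (a * b)" .
    qed
    show "G \<subseteq> ?K"
      by (auto simp: act_grouplike comult_sum_grouplike[OF vs_F bilin_act] sigma_mult)
    have "X (u * v) = \<sigma> g u * X v + X u * v" for u v
      by (simp add: X_def sigma_mult[OF g_grouplike] algebra_simps)
    then show "x \<in> ?K"
      by (simp add: comult_sum_skew_primitive[OF vs_F bilin_act x_skew] act_x act_grouplike[OF g_grouplike]
          act_grouplike[OF one_grouplike] sigma_one)
  qed
  then show ?thesis
    by blast
qed

lemma act_unit: "act h 1 = \<iota> (\<epsilon> h)"
proof -
  let ?K = "{h. act h 1 = \<iota> (\<epsilon> h)}"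
  have "h \<in> ?K"
  proof (rule subalgebra_induct)
    show "hv.subspace ?K"
      by (rule hv.subspaceI)
        (auto simp: act_zero act_add act_scl counit_add counit_scl iota_add iota_mult iota_zero
          hv.functionalD(3)[OF functional_counit])
    show "1 \<in> ?K"
      using act_grouplike[OF one_grouplike] by (simp add: sigma_one counit_one iota_one)
    show "a * b \<in> ?K" if "a \<in> ?K" "b \<in> ?K" for a b
    proof -
      have "act (a * b) 1 = act a (\<iota> (\<epsilon> b) * 1)"
        using that by (simp add: act_mult)
      also have "\<dots> = \<iota> (\<epsilon> (a * b))"
        unfolding act_iota_right using that by (simp add: counit_mult iota_mult mult.commute)
      finally show ?thesis
        by simp
    qed
    show "G \<subseteq> ?K"
      by (auto simp: act_grouplike sigma_unit counit_grouplike iota_one)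
    show "x \<in> ?K"
      by (simp add: act_x X_def sigma_unit g_grouplike skew_primitive_counit_antipode(1)[OF x_skew] iota_zero)
  qed
  then show ?thesis
    by blast
qed

text \<open>The coefficient of \<open>w\<^sup>j \<sigma> c t\<close> in \<open>act h t\<close>, for the index \<open>(j, c)\<close>; see \<open>act_orbit\<close>.\<close>

definition orbit_coeff :: "nat \<times> 'h \<Rightarrow> 'h \<Rightarrow> 'k" where
  "orbit_coeff p h = (\<Sum>i\<le>fst p. coeff (twist_poly q (fst p)) i * bcoord (fst p, \<S> (g ^ i) * snd p) h)"

lemma shift_index: "p \<in> basis_index \<Longrightarrow> (fst p, \<S> (g ^ i) * snd p) \<in> basis_index"
  by (auto intro!: grouplike_mult antipode_grouplike grouplike_power g_grouplike)

lemma functional_orbit_coeff: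
  assumes "p \<in> basis_index"
  shows "functional_on (orbit_coeff p)"
  by (rule hv.functionalI)
    (simp_all add: orbit_coeff_def hv.functionalD(1,2)[OF bcoord(1)[OF shift_index[OF assms]]] distrib_left
      sum.distrib sum_distrib_left mult.left_commute)

lemma act_orbit: "act h t = (\<Sum>p\<in>basis_index. \<iota> (orbit_coeff p h) * (w ^ fst p * \<sigma> (snd p) t))"
proof -
  have row: "(\<Sum>a\<in>G. \<iota> (bcoord (j, a) h) * (X ^^ j) (\<sigma> a t)) = (\<Sum>c\<in>G. \<iota> (orbit_coeff (j, c) h) * (w ^ j * \<sigma> c t))" for j
  proof -
    let ?k = "coeff (twist_poly q j)"
    have "(\<Sum>a\<in>G. \<iota> (bcoord (j, a) h) * (X ^^ j) (\<sigma> a t)) =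
        (\<Sum>a\<in>G. \<Sum>i\<le>j. \<iota> (?k i * bcoord (j, a) h) * (w ^ j * \<sigma> (g ^ i * a) t))"
      by (intro sum.cong refl)
        (simp add: Xn_eq sigma_compose grouplike_power g_grouplike sum_distrib_left iota_mult mult_ac)
    also have "\<dots> = (\<Sum>i\<le>j. \<Sum>a\<in>G. \<iota> (?k i * bcoord (j, a) h) * (w ^ j * \<sigma> (g ^ i * a) t))"
      by (rule sum.swap)
    also have "\<dots> = (\<Sum>i\<le>j. \<Sum>c\<in>G. \<iota> (?k i * bcoord (j, \<S> (g ^ i) * c) h) * (w ^ j * \<sigma> c t))"
    proof (rule sum.cong[OF refl])
      fix i
      have gi: "g ^ i \<in> G"
        by (rule grouplike_power[OF g_grouplike])
      show "(\<Sum>a\<in>G. \<iota> (?k i * bcoord (j, a) h) * (w ^ j * \<sigma> (g ^ i * a) t)) =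
          (\<Sum>c\<in>G. \<iota> (?k i * bcoord (j, \<S> (g ^ i) * c) h) * (w ^ j * \<sigma> c t))"
        by (rule sum.reindex_bij_witness[where i = "\<lambda>c. \<S> (g ^ i) * c" and j = "\<lambda>a. g ^ i * a"])
          (use gi in \<open>auto simp: mult.assoc[symmetric] grouplike_antipode intro!: grouplike_mult antipode_grouplike\<close>)
    qed
    also have "\<dots> = (\<Sum>c\<in>G. \<Sum>i\<le>j. \<iota> (?k i * bcoord (j, \<S> (g ^ i) * c) h) * (w ^ j * \<sigma> c t))"
      by (rule sum.swap)
    also have "\<dots> = (\<Sum>c\<in>G. \<iota> (orbit_coeff (j, c) h) * (w ^ j * \<sigma> c t))"
      by (simp add: orbit_coeff_def iota_sum sum_distrib_right)
    finally show ?thesis .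
  qed
  have "act h t = (\<Sum>j<m. \<Sum>a\<in>G. \<iota> (bcoord (j, a) h) * (X ^^ j) (\<sigma> a t))"
    by (simp add: act_def sum.cartesian_product case_prod_unfold)
  then show ?thesis
    by (simp add: row sum.cartesian_product case_prod_unfold)
qed

lemma orbit_coeff_vanishes: "act h t = 0 \<Longrightarrow> p \<in> basis_index \<Longrightarrow> orbit_coeff p h = 0"
proof -
  assume "act h t = 0" "p \<in> basis_index"
  moreover have "\<forall>p\<in>basis_index. orbit_coeff p h = 0" if "act h t = 0"
    using that by (intro independent) (simp flip: act_orbit)
  ultimately show ?thesis
    by blast
qed

text \<open>The action is not faithful: \<open>(g - 1) x\<^sup>m\<^sup>-\<^sup>1\<close> acts by zero because \<open>x\<^sup>m = 0\<close>. But if a Hopf ideal acts by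
  zero, then not only the functionals \<open>orbit_coeff\<close> vanish on it, but also their products under convolution.
  In a product with a functional of degree \<open>0\<close>, which is a coordinate functional of \<open>kG\<close>, only the
  terms \<open>g\<^sup>j a \<otimes> x\<^sup>j a\<close> of the comultiplication survive. Such products determine all coordinates.\<close>

lemma inner_faithful_act:
  assumes I: "hopf_ideal H I" and zero: "\<And>h u. h \<in> I \<Longrightarrow> act h u = 0"
  shows "I = {0}"
proof -
  have van: "orbit_coeff p h = 0" if "h \<in> I" "p \<in> basis_index" for h p
    using orbit_coeff_vanishes zero that by blast
  have conv: "comult_sum (\<lambda>u v. orbit_coeff p u * orbit_coeff r v) h = 0"
    if h: "h \<in> I" and pr: "p \<in> basis_index" "r \<in> basis_index" for h p r
  proof -
    obtain ps where ps: "set ps \<subseteq> (I \<times> UNIV) \<union> (UNIV \<times> I)" "heq H (comult H h) ps"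
      using I h unfolding hopf_ideal_def by blast
    have "(\<Sum>(u, v)\<leftarrow>ps. orbit_coeff p u * orbit_coeff r v) = (\<Sum>(u, v)\<leftarrow>ps. 0)"
      using ps(1) van pr by (intro arg_cong[of _ _ sum_list] map_cong refl) auto
    then show ?thesis
      using comult_sum_functionals_heq[OF functional_orbit_coeff[OF pr(1)] functional_orbit_coeff[OF pr(2)] ps(2)]
      by (simp add: case_prod_unfold)
  qed
  have oc: "orbit_coeff (j, c) (x ^ i * a) = (if i = j then \<Sum>l\<le>j. coeff (twist_poly q j) l * (if a = \<S> (g ^ l) * c then 1 else 0) else 0)"
    if "j < m" "c \<in> G" "i < m" "a \<in> G" for i j a c
  proof -
    have "bcoord (j, \<S> (g ^ l) * c) (basis_elem (i, a)) = (if (i, a) = (j, \<S> (g ^ l) * c) then 1 else 0)" for l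
      by (rule bcoord(2)) (use that shift_index[of "(j, c)" l] in auto)
    then show ?thesis
      by (simp add: orbit_coeff_def)
  qed
  have g_pow_inj: "i = 0" if "g ^ i = 1" "i < m" for i
    using chi_power[OF g_grouplike, of i] that q_primitive chi_g chi_one
    unfolding primitive_root_of_unity_def by force
  have "bcoord (j, a) h = 0" if h: "h \<in> I" and ja: "(j, a) \<in> basis_index" for h j a
  proof -
    have j: "j < m" and a: "a \<in> G"
      using ja by auto
    let ?c = "g ^ j * a"
    have gj: "g ^ j \<in> G"
      by (rule grouplike_power[OF g_grouplike])
    have c: "?c \<in> G"
      using a gj by (rule grouplike_mult[rotated])
    have idx: "(0, ?c) \<in> basis_index" "(j, ?c) \<in> basis_index"
      using c j m(1) by auto
    let ?f = "orbit_coeff (0, ?c)" and ?h = "orbit_coeff (j, ?c)"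
    note fh = functional_orbit_coeff[OF idx(1)] functional_orbit_coeff[OF idx(2)]
    note lin = functional_convolution[OF fh]
    have top: "?h (x ^ j * a) = coeff (twist_poly q j) j"
    proof -
      have eq: "a = \<S> (g ^ l) * ?c \<longleftrightarrow> l = j" if l: "l \<le> j" for l
      proof
        assume "a = \<S> (g ^ l) * ?c"
        then have "g ^ l * a = g ^ l * (\<S> (g ^ l) * ?c)"
          by (rule arg_cong)
        also have "\<dots> = ?c"
          using grouplike_antipode(2)[OF grouplike_power[OF g_grouplike], of l] by (simp add: mult.assoc[symmetric])
        finally have "g ^ l = g ^ j"
          using grouplike_cancel(2)[OF a] by blast
        then have "g ^ l * g ^ (j - l) = g ^ l * 1"
          using l by (metis le_add_diff_inverse mult_1_right power_add)
        then have "g ^ (j - l) = 1"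
          using grouplike_cancel(1)[OF grouplike_power[OF g_grouplike]] by blast
        then show "l = j"
          using g_pow_inj[of "j - l"] j l by linarith
      next
        assume "l = j"
        then show "a = \<S> (g ^ l) * ?c"
          using grouplike_antipode(1)[OF gj] by (simp add: mult.assoc[symmetric])
      qed
      have "?h (x ^ j * a) = (\<Sum>l\<le>j. coeff (twist_poly q j) l * (if a = \<S> (g ^ l) * ?c then 1 else 0))"
        using oc[OF j c j a] by simp
      also have "\<dots> = (\<Sum>l\<le>j. if l = j then coeff (twist_poly q j) l else 0)"
        by (intro sum.cong refl) (simp add: eq)
      finally show ?thesis
        by simp
    qed
    have summand: "comult_sum (\<lambda>u v. ?f u * ?h v) (basis_elem p) = (if p = (j, a) then coeff (twist_poly q j) j else 0)"
      if p: "p \<in> basis_index" for p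
    proof -
      obtain i b where ib: "p = (i, b)" "i < m" "b \<in> G"
        using p by auto
      have gb: "g ^ l * b \<in> G" for l
        using ib(3) by (intro grouplike_mult grouplike_power g_grouplike)
      have f0: "?f (x ^ l * g ^ (i - l) * b) = (if l = 0 \<and> g ^ i * b = ?c then 1 else 0)" if "l \<le> i" for l
        using oc[OF m(1) c, of l "g ^ (i - l) * b"] that ib gb by (auto simp: twist_poly_0 mult.assoc)
      have "comult_sum (\<lambda>u v. ?f u * ?h v) (x ^ i * b) =
          (\<Sum>l\<le>i. if l = 0 then if g ^ i * b = ?c then ?h (x ^ i * b) else 0 else 0)"
        unfolding comult_sum_power[OF x_skew gx fh ib(3)]
        by (intro sum.cong refl) (auto simp: f0)
      also have "\<dots> = (if g ^ i * b = ?c then ?h (x ^ i * b) else 0)"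
        by simp
      also have "\<dots> = (if p = (j, a) then coeff (twist_poly q j) j else 0)"
        using oc[OF j c ib(2,3)] top grouplike_cancel(1)[OF gj] by (auto simp: ib(1))
      finally show ?thesis
        by (simp add: ib(1))
    qed
    have "0 = comult_sum (\<lambda>u v. ?f u * ?h v) (\<Sum>p\<in>basis_index. bcoord p h \<cdot> basis_elem p)"
      using conv[OF h idx] bcoord_expansion[of h] by simp
    also have "\<dots> = (\<Sum>p\<in>basis_index. if p = (j, a) then bcoord p h * coeff (twist_poly q j) j else 0)"
      unfolding hv.functionalD(6)[OF lin]
      by (intro sum.cong refl) (auto simp: hv.functionalD(2)[OF lin] summand simp del: mem_Sigma_iff split: if_splits)
    also have "\<dots> = bcoord (j, a) h * coeff (twist_poly q j) j"
      using ja finite_basis_index by simp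
    finally show ?thesis
      using coeff_twist_poly_top[OF q_neq_0, of j] by simp
  qed
  then have "h = 0" if "h \<in> I" for h
    using that by (intro trans[OF bcoord_expansion[of h]] sum.neutral) auto
  moreover have "0 \<in> I"
    using I by (auto simp: hopf_ideal_def hv.subspace_0)
  ultimately show ?thesis
    by blast
qed

end

section \<open>Rational functions in variables permuted by a group\<close>

text \<open>An element is determined by the list of its nonzero values together with their positions, and an
  infinite type is in bijection with the lists over it.\<close>

lemma inj_poly_mapping:
  fixes f :: "'a \<Rightarrow> 'c" and h :: "'b::zero \<Rightarrow> 'c"
  assumes "infinite (UNIV :: 'c set)" "inj f" "inj h"
  shows "\<exists>e :: ('a \<Rightarrow>\<^sub>0 'b) \<Rightarrow> 'c. inj e"
proof -
  obtain L :: "'c list \<Rightarrow> 'c" where L: "inj L"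
    using lists_infinite_bij_betw_types[OF assms(1)] by (auto simp: bij_def)
  have "\<forall>p :: 'a \<Rightarrow>\<^sub>0 'b. \<exists>xs. set xs = Poly_Mapping.keys p"
    using finite_list[OF finite_keys] by blast
  then obtain ks :: "('a \<Rightarrow>\<^sub>0 'b) \<Rightarrow> 'a list" where ks: "\<And>p. set (ks p) = Poly_Mapping.keys p"
    by metis
  define e where "e p = L (map (\<lambda>a. L [f a, h (Poly_Mapping.lookup p a)]) (ks p))" for p
  have graph: "a \<in> Poly_Mapping.keys r \<and> Poly_Mapping.lookup p a = Poly_Mapping.lookup r a"
    if er: "e p = e r" and ap: "a \<in> Poly_Mapping.keys p" for p r a
  proof -
    have "map (\<lambda>a. L [f a, h (Poly_Mapping.lookup p a)]) (ks p) = map (\<lambda>a. L [f a, h (Poly_Mapping.lookup r a)]) (ks r)"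
      using er injD[OF L] unfolding e_def by blast
    from arg_cong[OF this, of set]
    have "(\<lambda>a. L [f a, h (Poly_Mapping.lookup p a)]) ` Poly_Mapping.keys p =
        (\<lambda>a. L [f a, h (Poly_Mapping.lookup r a)]) ` Poly_Mapping.keys r"
      by (simp only: set_map ks)
    then obtain b where b: "b \<in> Poly_Mapping.keys r"
      "L [f a, h (Poly_Mapping.lookup p a)] = L [f b, h (Poly_Mapping.lookup r b)]"
      using ap by blast
    from injD[OF L this(2)] have "f a = f b" "h (Poly_Mapping.lookup p a) = h (Poly_Mapping.lookup r b)"
      by simp_all
    then have "a = b" "Poly_Mapping.lookup p a = Poly_Mapping.lookup r b"
      by (auto dest: injD[OF assms(2)] injD[OF assms(3)])
    then show ?thesis
      using b(1) by simp
  qed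
  have "inj e"
  proof (rule injI, rule poly_mapping_eqI)
    fix p r a assume er: "e p = e r"
    show "Poly_Mapping.lookup p a = Poly_Mapping.lookup r a"
    proof (cases "a \<in> Poly_Mapping.keys p")
      case True
      then show ?thesis
        using graph[OF er] by blast
    next
      case False
      then have "a \<notin> Poly_Mapping.keys r"
        using graph[OF er[symmetric]] by blast
      with False show ?thesis
        by (simp add: in_keys_iff)
    qed
  qed
  then show ?thesis
    by blast
qed

lemma inj_fract:
  fixes e :: "'r::idom \<Rightarrow> 'c"
  assumes "infinite (UNIV :: 'c set)" "inj e"
  shows "\<exists>e' :: 'r fract \<Rightarrow> 'c. inj e'"
proof -
  obtain L :: "'c list \<Rightarrow> 'c" where L: "inj L"
    using lists_infinite_bij_betw_types[OF assms(1)] by (auto simp: bij_def)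
  have "\<forall>z :: 'r fract. \<exists>a b. z = Fract a b"
    by (metis Fract_cases)
  then obtain n d :: "'r fract \<Rightarrow> 'r" where nd: "\<And>z. z = Fract (n z) (d z)"
    by metis
  have "inj (\<lambda>z. L [e (n z), e (d z)])"
  proof (rule injI)
    fix y z assume "L [e (n y), e (d y)] = L [e (n z), e (d z)]"
    from injD[OF L this] have nz: "n y = n z" "d y = d z"
      by (auto dest: injD[OF assms(2)])
    then show "y = z"
      by (subst nd[of y], subst nd[of z]) (simp only: nz)
  qed
  then show ?thesis
    by blast
qed

lemma fscale_conv_mult: "fscale k p = Poly_Mapping.single 0 k * (p :: 'm::comm_monoid_add \<Rightarrow>\<^sub>0 'k::field)"
  using span_singles[of p]
proof (induction rule: fvs.span_induct_alt)
  case (step c x y)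
  then obtain \<mu> where "x = Poly_Mapping.single \<mu> 1"
    by blast
  then show ?case
    using step.IH by (simp add: fvs.scale_right_distrib fscale_single distrib_left mult_single)
qed simp

text \<open>The endomorphism of a monoid algebra that is induced by an endomorphism \<open>\<theta>\<close> of the monoid and
  a character \<open>c\<close>.\<close>

definition monoid_algebra_map ::
  "('m \<Rightarrow> 'm) \<Rightarrow> ('m \<Rightarrow> 'k) \<Rightarrow> ('m \<Rightarrow>\<^sub>0 'k::field) \<Rightarrow> ('m::comm_monoid_add \<Rightarrow>\<^sub>0 'k)" where
  "monoid_algebra_map \<theta> c = lin_ext fscale (\<lambda>\<mu>. Poly_Mapping.single (\<theta> \<mu>) (c \<mu>))"

lemma monoid_algebra_map_add:
  "monoid_algebra_map \<theta> c (p + r) = monoid_algebra_map \<theta> c p + monoid_algebra_map \<theta> c r"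
  by (simp add: monoid_algebra_map_def fvs.lin_ext_add)

lemma monoid_algebra_map_scale: "monoid_algebra_map \<theta> c (fscale k p) = fscale k (monoid_algebra_map \<theta> c p)"
  by (simp add: monoid_algebra_map_def fvs.lin_ext_scale)

lemma monoid_algebra_map_single:
  "monoid_algebra_map \<theta> c (Poly_Mapping.single \<mu> k) = Poly_Mapping.single (\<theta> \<mu>) (k * c \<mu>)"
  by (simp add: monoid_algebra_map_def fscale_single)

lemma monoid_algebra_map_mult:
  assumes "\<And>\<mu> \<nu>. \<theta> (\<mu> + \<nu>) = \<theta> \<mu> + \<theta> \<nu>" "\<And>\<mu> \<nu>. c (\<mu> + \<nu>) = c \<mu> * c \<nu>"
  shows "monoid_algebra_map \<theta> c (p * r) = monoid_algebra_map \<theta> c p * monoid_algebra_map \<theta> c r"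
proof -
  let ?T = "monoid_algebra_map \<theta> c"
  have zero: "?T 0 = 0"
    by (simp add: monoid_algebra_map_def)
  have sc: "fscale k a * b = fscale k (a * b)" "a * fscale k b = fscale k (a * b)" for k a and b :: "'a \<Rightarrow>\<^sub>0 'b"
    unfolding fscale_conv_mult[of k] by (simp_all add: mult_ac)
  have single: "?T (Poly_Mapping.single \<mu> 1 * r) = ?T (Poly_Mapping.single \<mu> 1) * ?T r" for \<mu>
    using span_singles[of r]
  proof (induction rule: fvs.span_induct_alt)
    case (step k x y)
    then obtain \<nu> where \<nu>: "x = Poly_Mapping.single \<nu> 1"
      by blast
    have "?T (Poly_Mapping.single \<mu> 1 * x) = ?T (Poly_Mapping.single \<mu> 1) * ?T x"
      by (simp add: \<nu> mult_single monoid_algebra_map_single assms)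
    then show ?case
      using step.IH by (simp add: distrib_left monoid_algebra_map_add sc monoid_algebra_map_scale)
  qed (simp add: zero)
  show ?thesis
    using span_singles[of p]
  proof (induction rule: fvs.span_induct_alt)
    case (step k x y)
    then show ?case
      using single by (auto simp: distrib_right monoid_algebra_map_add sc monoid_algebra_map_scale)
  qed (simp add: zero)
qed

lemma monoid_algebra_map_compose:
  "monoid_algebra_map \<theta> c (monoid_algebra_map \<theta>' c' p) =
    monoid_algebra_map (\<lambda>\<mu>. \<theta> (\<theta>' \<mu>)) (\<lambda>\<mu>. c' \<mu> * c (\<theta>' \<mu>)) p"
proof -
  have "Vector_Spaces.linear fscale fscale (monoid_algebra_map \<theta> c)"
    unfolding monoid_algebra_map_def by (rule fvs.linear_lin_ext)
  from lin_ext_compose[OF this, of "\<lambda>\<mu>. Poly_Mapping.single (\<theta>' \<mu>) (c' \<mu>)" p] show ?thesis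
    by (simp add: monoid_algebra_map_single flip: monoid_algebra_map_def)
qed

lemma monoid_algebra_map_id: "monoid_algebra_map (\<lambda>\<mu>. \<mu>) (\<lambda>_. 1) p = p"
  by (simp add: monoid_algebra_map_def lin_ext_singles)

text \<open>By \<open>fract_map_Fract\<close> the choice of numerator and denominator does not matter if \<open>\<phi>\<close> is
  multiplicative and vanishes only at zero.\<close>

definition fract_map :: "('r \<Rightarrow> 'r) \<Rightarrow> 'r::idom fract \<Rightarrow> 'r fract" where
  "fract_map \<phi> z = (SOME y. \<exists>a b. b \<noteq> 0 \<and> z = Fract a b \<and> y = Fract (\<phi> a) (\<phi> b))"

lemma fract_map_Fract:
  assumes mult: "\<And>a b. \<phi> (a * b) = \<phi> a * \<phi> b" and zero: "\<And>a. \<phi> a = 0 \<longleftrightarrow> a = 0" and "b \<noteq> 0"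
  shows "fract_map \<phi> (Fract a b) = Fract (\<phi> a) (\<phi> b)"
  unfolding fract_map_def
proof (rule someI2)
  show "\<exists>c d. d \<noteq> 0 \<and> Fract a b = Fract c d \<and> Fract (\<phi> a) (\<phi> b) = Fract (\<phi> c) (\<phi> d)"
    using \<open>b \<noteq> 0\<close> by blast
  fix y assume "\<exists>c d. d \<noteq> 0 \<and> Fract a b = Fract c d \<and> y = Fract (\<phi> c) (\<phi> d)"
  then obtain c d where cd: "d \<noteq> 0" "Fract a b = Fract c d" "y = Fract (\<phi> c) (\<phi> d)"
    by blast
  then have "a * d = c * b"
    using \<open>b \<noteq> 0\<close> by (simp add: eq_fract)
  then have "\<phi> a * \<phi> d = \<phi> c * \<phi> b"
    by (metis mult)
  then show "y = Fract (\<phi> a) (\<phi> b)"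
    using cd \<open>b \<noteq> 0\<close> zero by (simp add: eq_fract)
qed

context normalized_rank_one_hopf_algebra
begin

text \<open>The variables are indexed by natural numbers: variable \<open>0\<close> is \<open>w\<close>, and the other ones used
  correspond to the elements of \<open>G\<close>.\<close>

definition var :: "'h \<Rightarrow> nat" where
  "var = (SOME f. inj_on f G \<and> 0 \<notin> f ` G)"

lemma var: "inj_on var G" "a \<in> G \<Longrightarrow> var a \<noteq> 0"
proof -
  obtain f :: "'h \<Rightarrow> nat" where "inj_on f G"
    using finite_imp_inj_to_nat_seg[OF finite_grouplikes] by metis
  then have "inj_on (\<lambda>a. Suc (f a)) G \<and> 0 \<notin> (\<lambda>a. Suc (f a)) ` G"
    by (auto simp: inj_on_def)
  then have "inj_on var G \<and> 0 \<notin> var ` G"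
    unfolding var_def by (rule someI[of "\<lambda>f. inj_on f G \<and> 0 \<notin> f ` G"])
  then show "inj_on var G" "a \<in> G \<Longrightarrow> var a \<noteq> 0"
    by auto
qed

definition relabel :: "'h \<Rightarrow> nat \<Rightarrow> nat" where
  "relabel a i = (if i \<in> var ` G then var (\<S> a * inv_into G var i) else i)"

lemma relabel_var: "b \<in> G \<Longrightarrow> relabel a (var b) = var (\<S> a * b)"
  by (simp add: relabel_def inv_into_f_f[OF var(1)])

lemma relabel_zero: "relabel a 0 = 0"
proof -
  have "0 \<notin> var ` G"
    using var(2) by force
  then show ?thesis
    by (simp add: relabel_def)
qed

lemma relabel_compose:
  assumes "a \<in> G" "b \<in> G"
  shows "relabel b (relabel a i) = relabel (a * b) i"
proof (cases "i \<in> var ` G")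
  case True
  then obtain c where c: "c \<in> G" "i = var c"
    by blast
  then show ?thesis
    using assms by (simp add: relabel_var grouplike_mult antipode_grouplike antipode_mult mult.assoc)
qed (simp add: relabel_def)

lemma relabel_one: "relabel 1 i = i"
  by (auto simp: relabel_def f_inv_into_f)

lemma inj_relabel: "a \<in> G \<Longrightarrow> inj (relabel a)"
  by (rule inj_on_inverseI[where g = "relabel (\<S> a)"])
    (simp add: relabel_compose antipode_grouplike grouplike_antipode relabel_one)

definition monomial_map :: "'h \<Rightarrow> (nat \<Rightarrow>\<^sub>0 nat) \<Rightarrow> (nat \<Rightarrow>\<^sub>0 nat)" where
  "monomial_map a = Poly_Mapping.map_key (relabel a)"

lemma lookup_monomial_map: "a \<in> G \<Longrightarrow> Poly_Mapping.lookup (monomial_map a \<mu>) i = Poly_Mapping.lookup \<mu> (relabel a i)"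
  by (simp add: monomial_map_def Poly_Mapping.map_key.rep_eq inj_relabel)

definition poly_map :: "'h \<Rightarrow> ((nat \<Rightarrow>\<^sub>0 nat) \<Rightarrow>\<^sub>0 'k) \<Rightarrow> ((nat \<Rightarrow>\<^sub>0 nat) \<Rightarrow>\<^sub>0 'k)" where
  "poly_map a = monoid_algebra_map (monomial_map a) (\<lambda>\<mu>. chi a ^ Poly_Mapping.lookup \<mu> 0)"

lemma poly_map_add: "poly_map a (p + r) = poly_map a p + poly_map a r"
  by (simp add: poly_map_def monoid_algebra_map_add)

lemma poly_map_mult: "a \<in> G \<Longrightarrow> poly_map a (p * r) = poly_map a p * poly_map a r"
  unfolding poly_map_def
  by (rule monoid_algebra_map_mult)
    (auto intro!: poly_mapping_eqI simp: lookup_monomial_map lookup_add power_add)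

lemma poly_map_single: "poly_map a (Poly_Mapping.single \<mu> k) = Poly_Mapping.single (monomial_map a \<mu>) (k * chi a ^ Poly_Mapping.lookup \<mu> 0)"
  by (simp add: poly_map_def monoid_algebra_map_single)

lemma poly_map_compose:
  assumes "a \<in> G" "b \<in> G"
  shows "poly_map a (poly_map b p) = poly_map (a * b) p"
proof -
  have "monomial_map a (monomial_map b \<mu>) = monomial_map (a * b) \<mu>" for \<mu>
    using assms by (intro poly_mapping_eqI) (simp add: lookup_monomial_map grouplike_mult relabel_compose)
  moreover have "chi b ^ Poly_Mapping.lookup \<mu> 0 * chi a ^ Poly_Mapping.lookup (monomial_map b \<mu>) 0
      = chi (a * b) ^ Poly_Mapping.lookup \<mu> 0" for \<mu>
    using assms by (simp add: lookup_monomial_map relabel_zero chi_mult power_mult_distrib mult.commute)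
  ultimately show ?thesis
    by (simp add: poly_map_def monoid_algebra_map_compose)
qed

lemma poly_map_one: "poly_map 1 p = p"
proof -
  have "monomial_map 1 = (\<lambda>\<mu>. \<mu>)"
    by (intro ext poly_mapping_eqI) (simp add: lookup_monomial_map one_grouplike relabel_one)
  then show ?thesis
    using monoid_algebra_map_id[of p] by (simp add: poly_map_def chi_one)
qed

lemma poly_map_eq_0_iff: "a \<in> G \<Longrightarrow> poly_map a p = 0 \<longleftrightarrow> p = 0"
proof
  assume a: "a \<in> G" and "poly_map a p = 0"
  then have "poly_map (\<S> a * a) p = poly_map (\<S> a) 0"
    by (simp add: poly_map_compose[symmetric] antipode_grouplike)
  then show "p = 0"
    using a by (simp add: grouplike_antipode poly_map_one) (simp add: poly_map_def monoid_algebra_map_def)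
qed (simp add: poly_map_def monoid_algebra_map_def)

definition field_map :: "'h \<Rightarrow> ((nat \<Rightarrow>\<^sub>0 nat) \<Rightarrow>\<^sub>0 'k) fract \<Rightarrow> ((nat \<Rightarrow>\<^sub>0 nat) \<Rightarrow>\<^sub>0 'k) fract" where
  "field_map a = fract_map (poly_map a)"

lemma field_map_Fract: "a \<in> G \<Longrightarrow> r \<noteq> 0 \<Longrightarrow> field_map a (Fract p r) = Fract (poly_map a p) (poly_map a r)"
  unfolding field_map_def by (rule fract_map_Fract) (simp_all add: poly_map_mult poly_map_eq_0_iff)

definition embed :: "((nat \<Rightarrow>\<^sub>0 nat) \<Rightarrow>\<^sub>0 'k) \<Rightarrow> ((nat \<Rightarrow>\<^sub>0 nat) \<Rightarrow>\<^sub>0 'k) fract" where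
  "embed p = Fract p 1"

lemma embed_simps:
  "embed (p + r) = embed p + embed r" "embed (p * r) = embed p * embed r" "embed 1 = 1" "embed 0 = 0"
  "embed p = embed r \<longleftrightarrow> p = r"
  by (simp_all add: embed_def eq_fract One_fract_def Zero_fract_def)

lemma embed_power: "embed (p ^ n) = embed p ^ n"
  by (induction n) (simp_all add: embed_simps)

lemma embed_sum: "embed (sum f A) = (\<Sum>i\<in>A. embed (f i))"
  by (induction A rule: infinite_finite_induct) (simp_all add: embed_simps)

lemma poly_map_unit: "a \<in> G \<Longrightarrow> poly_map a 1 = 1"
proof -
  assume a: "a \<in> G"
  have "monomial_map a 0 = 0"
    using a by (intro poly_mapping_eqI) (simp add: lookup_monomial_map)
  then show ?thesis
    using poly_map_single[of a 0 1] by simp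
qed

lemma field_map_embed: "a \<in> G \<Longrightarrow> field_map a (embed p) = embed (poly_map a p)"
  by (simp add: embed_def field_map_Fract poly_map_unit)

definition scalar :: "'k \<Rightarrow> ((nat \<Rightarrow>\<^sub>0 nat) \<Rightarrow>\<^sub>0 'k) fract" where
  "scalar c = embed (Poly_Mapping.single 0 c)"

definition w_elem :: "((nat \<Rightarrow>\<^sub>0 nat) \<Rightarrow>\<^sub>0 'k) fract" where
  "w_elem = embed (Poly_Mapping.single (Poly_Mapping.single 0 1) 1)"

definition t_elem :: "((nat \<Rightarrow>\<^sub>0 nat) \<Rightarrow>\<^sub>0 'k) fract" where
  "t_elem = embed (Poly_Mapping.single (Poly_Mapping.single (var 1) 1) 1)"

lemma single_power: "Poly_Mapping.single \<mu> (1::'k) ^ n = Poly_Mapping.single (of_nat n * \<mu>) 1" for \<mu> :: "nat \<Rightarrow>\<^sub>0 nat"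
  by (induction n) (simp_all add: mult_single algebra_simps)

text \<open>The elements \<open>w\<^sup>j \<sigma> a t\<close> are the distinct monomials \<open>w\<^sup>j t\<^sub>a\<close>.\<close>

lemma twisted_field_action:
  assumes "g ^ m = 1"
  shows "twisted_field_action H g x q scalar field_map w_elem t_elem"
proof unfold_locales
  show "g ^ m = 1" by fact
  show "scalar (c + d) = scalar c + scalar d" for c d
    by (simp add: scalar_def single_add embed_simps)
  show "scalar (c * d) = scalar c * scalar d" for c d
    by (simp add: scalar_def mult_single embed_simps(2)[symmetric])
  show "scalar 1 = 1"
    by (simp add: scalar_def embed_simps)
  show "field_map a (u + v) = field_map a u + field_map a v" if "a \<in> G" for a u v
    using that poly_map_eq_0_iff
    by (cases u; cases v) (simp add: field_map_Fract poly_map_add poly_map_mult)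
  show "field_map a (u * v) = field_map a u * field_map a v" if "a \<in> G" for a u v
    using that by (cases u; cases v) (simp add: field_map_Fract poly_map_mult)
  have m0: "monomial_map a 0 = 0" if "a \<in> G" for a
    using that by (intro poly_mapping_eqI) (simp add: lookup_monomial_map)
  show "field_map a (scalar c) = scalar c" if "a \<in> G" for a c
    using that by (simp add: scalar_def field_map_embed poly_map_single m0)
  show "field_map 1 u = u" for u
    by (cases u) (simp add: field_map_Fract one_grouplike poly_map_one)
  show "field_map (a * b) u = field_map a (field_map b u)" if "a \<in> G" "b \<in> G" for a b u
    using that poly_map_eq_0_iff[of b]
    by (cases u) (simp add: field_map_Fract grouplike_mult poly_map_compose)
  show "field_map a w_elem = scalar (chi a) * w_elem" if "a \<in> G" for a
  proof -
    have "monomial_map a (Poly_Mapping.single 0 1) = Poly_Mapping.single (0::nat) (1::nat)"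
      using that inj_eq[OF inj_relabel[OF that]] relabel_zero[of a]
      by (intro poly_mapping_eqI) (simp add: lookup_monomial_map lookup_single when_def, metis)
    then show ?thesis
      using that by (simp add: w_elem_def scalar_def field_map_embed poly_map_single mult_single embed_simps(2)[symmetric])
  qed
  have sigma_t: "field_map a t_elem = embed (Poly_Mapping.single (Poly_Mapping.single (var a) 1) 1)" if "a \<in> G" for a
  proof -
    have "relabel a (var a) = var 1"
      using that by (simp add: relabel_var grouplike_antipode)
    then have "monomial_map a (Poly_Mapping.single (var 1) 1) = Poly_Mapping.single (var a) (1::nat)"
      using that inj_eq[OF inj_relabel[OF that]]
      by (intro poly_mapping_eqI) (simp add: lookup_monomial_map lookup_single when_def, metis)
    then show ?thesis
      using that var(2)[OF one_grouplike] by (simp add: t_elem_def field_map_embed poly_map_single lookup_single when_def)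
  qed
  show "\<forall>p\<in>basis_index. k p = 0"
    if sum0: "(\<Sum>p\<in>basis_index. scalar (k p) * (w_elem ^ fst p * field_map (snd p) t_elem)) = 0" for k
  proof
    fix r assume r: "r \<in> basis_index"
    let ?\<mu> = "\<lambda>p. of_nat (fst p) * Poly_Mapping.single 0 1 + Poly_Mapping.single (var (snd p)) 1 :: nat \<Rightarrow>\<^sub>0 nat"
    have lk: "Poly_Mapping.lookup (?\<mu> p) i = (if i = 0 then fst p else 0) + (if i = var (snd p) then 1 else 0)" for p i
    proof -
      have "of_nat n * Poly_Mapping.single (0::nat) (1::nat) = Poly_Mapping.single 0 n" for n
        by (induction n) (simp_all add: single_add[symmetric] algebra_simps)
      then show ?thesis
        by (simp add: lookup_add lookup_single when_def)
    qed
    have inj: "?\<mu> p = ?\<mu> r \<longleftrightarrow> p = r" if p: "p \<in> basis_index" for p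
    proof
      assume eq: "?\<mu> p = ?\<mu> r"
      have nz: "var (snd p) \<noteq> 0" "var (snd r) \<noteq> 0"
        using p r var(2) by auto
      have lk_eq: "(if i = 0 then fst p else 0) + (if i = var (snd p) then 1 else 0) =
          (if i = 0 then fst r else 0) + (if i = var (snd r) then 1 else 0)" for i
        using arg_cong[OF eq, of "\<lambda>\<nu>. Poly_Mapping.lookup \<nu> i"] unfolding lk .
      have "fst p = fst r"
        using lk_eq[of 0] nz by simp
      moreover have "var (snd p) = var (snd r)"
        using lk_eq[of "var (snd p)"] nz by (simp split: if_splits)
      then have "snd p = snd r"
        using inj_onD[OF var(1)] p r by auto
      ultimately show "p = r"
        by (simp add: prod_eq_iff)
    qed simp
    have "scalar (k p) * (w_elem ^ fst p * field_map (snd p) t_elem) = embed (Poly_Mapping.single (?\<mu> p) (k p))"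
      if "p \<in> basis_index" for p
      using that sigma_t
      by (auto simp: scalar_def w_elem_def embed_power[symmetric] embed_simps(2)[symmetric] single_power mult_single)
    then have "embed (\<Sum>p\<in>basis_index. Poly_Mapping.single (?\<mu> p) (k p)) = embed 0"
      unfolding embed_sum embed_simps(4) using sum0 by (metis (mono_tags, lifting) sum.cong)
    then have "(\<Sum>p\<in>basis_index. Poly_Mapping.single (?\<mu> p) (k p)) = 0"
      by (simp only: embed_simps(5))
    then have "0 = Poly_Mapping.lookup (\<Sum>p\<in>basis_index. Poly_Mapping.single (?\<mu> p) (k p)) (?\<mu> r)"
      by simp
    also have "\<dots> = (\<Sum>p\<in>basis_index. if p = r then k p else 0)"
      unfolding lookup_sum by (intro sum.cong refl) (use inj in \<open>auto simp: lookup_single when_def simp del: mem_Sigma_iff\<close>)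
    also have "\<dots> = k r"
      using r finite_basis_index by simp
    finally show "k r = 0"
      by simp
  qed
qed

end

text \<open>The field structure and the action are transported along \<open>e\<close> to the set \<open>range e\<close>.\<close>

lemma (in twisted_field_action) galois_theoretical_transport:
  fixes e :: "'f \<Rightarrow> 'l"
  assumes e: "inj e"
  shows "galois_theoretical TYPE('l) H"
proof -
  define e' where "e' = Hilbert_Choice.inv e"
  have e'e [simp]: "e' (e u) = u" for u
    by (simp add: e'_def inv_f_f[OF e])
  define L :: "'l ring" where "L = \<lparr>carrier = range e, mult = (\<lambda>a b. e (e' a * e' b)), one = e 1,
      ring.zero = e 0, ring.add = (\<lambda>a b. e (e' a + e' b))\<rparr>"
  have [simp]: "carrier L = range e" "a \<otimes>\<^bsub>L\<^esub> b = e (e' a * e' b)" "\<one>\<^bsub>L\<^esub> = e 1" "\<zero>\<^bsub>L\<^esub> = e 0"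
    "a \<oplus>\<^bsub>L\<^esub> b = e (e' a + e' b)" for a b
    by (simp_all add: L_def)
  have e_eq [simp]: "e u = e v \<longleftrightarrow> u = v" for u v
    using e by (simp add: inj_eq)
  have ring: "cring L"
  proof (rule cringI)
    show "abelian_group L"
    proof (rule abelian_groupI)
      fix a assume "a \<in> carrier L"
      then obtain u where "a = e u"
        by auto
      then show "\<exists>b\<in>carrier L. b \<oplus>\<^bsub>L\<^esub> a = \<zero>\<^bsub>L\<^esub>"
        by (intro bexI[of _ "e (- u)"]) auto
    qed (auto simp: algebra_simps)
    show "Group.comm_monoid L"
      by (rule comm_monoidI) (auto simp: algebra_simps)
  qed (auto simp: algebra_simps)
  have field: "field L"
  proof (rule cring.cring_fieldI2[OF ring])
    fix a assume "a \<in> carrier L" "a \<noteq> \<zero>\<^bsub>L\<^esub>"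
    then obtain u where "a = e u" "u \<noteq> 0"
      by auto
    then show "\<exists>b\<in>carrier L. a \<otimes>\<^bsub>L\<^esub> b = \<one>\<^bsub>L\<^esub>"
      by (intro bexI[of _ "e (inverse u)"]) auto
  qed simp
  define \<iota>L where "\<iota>L c = e (\<iota> c)" for c
  define actL where "actL h a = e (act h (e' a))" for h a
  have foldr_sum: "foldr (\<lambda>(h1, h2) r. (actL h1 (e u) \<otimes>\<^bsub>L\<^esub> actL h2 (e v)) \<oplus>\<^bsub>L\<^esub> r) ps \<zero>\<^bsub>L\<^esub>
      = e (\<Sum>(h1, h2)\<leftarrow>ps. act h1 u * act h2 v)" for ps u v
    by (induction ps) (auto simp: actL_def)
  have "module_algebra H L \<iota>L actL"
    unfolding module_algebra_def k_algebra_def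
    using cring.axioms(1)[OF ring]
  proof (intro conjI allI ballI)
    fix h a b assume ab: "a \<in> carrier L" "b \<in> carrier L"
    then obtain u v where uv: "a = e u" "b = e v"
      by auto
    have "actL h (a \<otimes>\<^bsub>L\<^esub> b) = e (comult_sum (\<lambda>h1 h2. act h1 u * act h2 v) h)"
      by (simp add: actL_def uv act_prod)
    then show "actL h (a \<otimes>\<^bsub>L\<^esub> b) = foldr (\<lambda>(h1, h2) r. (actL h1 a \<otimes>\<^bsub>L\<^esub> actL h2 b) \<oplus>\<^bsub>L\<^esub> r) (comult H h) \<zero>\<^bsub>L\<^esub>"
      unfolding uv foldr_sum by (simp add: comult_sum_def)
  qed (auto simp: \<iota>L_def actL_def iota_one iota_add iota_mult mult.commute act_add act_scl act_add_right
      act_iota_right act_mult act_unit act_grouplike[OF one_grouplike] sigma_one)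
  moreover have "inner_faithful H L actL"
    unfolding inner_faithful_def
  proof (intro allI impI)
    fix I assume I: "hopf_ideal H I \<and> I \<noteq> {0}"
    then obtain h u where "h \<in> I" "act h u \<noteq> 0"
      using inner_faithful_act[of I] by blast
    then show "\<exists>h\<in>I. \<exists>a\<in>carrier L. actL h a \<noteq> \<zero>\<^bsub>L\<^esub>"
      by (intro bexI[of _ h] bexI[of _ "e u"]) (auto simp: actL_def)
  qed
  ultimately show ?thesis
    unfolding galois_theoretical_def using field by blast
qed

text \<open>A rational function field over an infinite field in countably many variables has the same
  cardinality as the field of scalars.\<close>

lemma (in normalized_rank_one_hopf_algebra) order_imp_galois_theoretical:
  assumes "g ^ m = 1"
  shows "galois_theoretical TYPE('k + 'l) H"
proof -
  have inf: "infinite (UNIV :: 'k set)"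
    by (rule infinite_UNIV_char_0)
  obtain e1 :: "(nat \<Rightarrow>\<^sub>0 nat) \<Rightarrow> 'k" where e1: "inj e1"
    using inj_poly_mapping[OF inf inj_of_nat inj_of_nat] by blast
  obtain e2 :: "((nat \<Rightarrow>\<^sub>0 nat) \<Rightarrow>\<^sub>0 'k) \<Rightarrow> 'k" where e2: "inj e2"
    using inj_poly_mapping[OF inf e1 inj_on_id2] by blast
  obtain e3 :: "((nat \<Rightarrow>\<^sub>0 nat) \<Rightarrow>\<^sub>0 'k) fract \<Rightarrow> 'k" where e3: "inj e3"
    using inj_fract[OF inf e2] by blast
  interpret T: twisted_field_action H g x q scalar field_map w_elem t_elem
    by (rule twisted_field_action[OF assms])
  have "inj (\<lambda>z. Inl (e3 z) :: 'k + 'l)"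
    using e3 by (auto simp: inj_def)
  then show ?thesis
    by (rule T.galois_theoretical_transport)
qed

section \<open>Galois-theoretical Hopf algebras of rank one\<close>

theorem theorem1p2:
  fixes H :: "('k::{alg_closed_field, field_char_0}, 'h::ring_1) hopf" and g x :: 'h
  assumes "hopf_algebra H"
    and "finite_dim H"
    and "pointed H"
    and "has_rank H 1"
    and "g \<in> grouplike_center H"
    and "skew_primitive H g 1 x"
    and "generated_subalgebra H (grouplikes H \<union> {x}) = UNIV"
  shows "galois_theoretical TYPE('k + 'l) H \<longleftrightarrow>
         is_taft_algebra H (generated_hopf_subalgebra H {g, x})"
proof -
  interpret hopf_algebra H
    by (rule assms(1))
  interpret R: rank_one_hopf_algebra H g x
    by unfold_locales (rule assms)+
  obtain c q where cq: "g * (x + c \<cdot> (g - 1)) = q \<cdot> ((x + c \<cdot> (g - 1)) * g)"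
    using R.normalize_x by blast
  let ?y = "x + c \<cdot> (g - 1)"
  interpret S: rank_one_hopf_algebra H g ?y
    by (rule R.rank_one_shift)
  interpret N: normalized_rank_one_hopf_algebra H g ?y q
    by unfold_locales (rule cq)
  have taft: "is_taft_algebra H (generated_hopf_subalgebra H {g, x}) \<longleftrightarrow> g ^ N.m = 1"
    unfolding R.generated_hopf_subalgebra_eq R.generated_subalgebra_shift[of c, symmetric]
    using N.taft_imp_order N.order_imp_taft by blast
  show ?thesis
    unfolding taft
  proof
    assume "galois_theoretical TYPE('k + 'l) H"
    then obtain L :: "('k + 'l) ring" and \<iota> act
      where L: "field L" "module_algebra H L \<iota> act" "inner_faithful H L act"
      unfolding galois_theoretical_def by blast
    show "g ^ N.m = 1"
      by (rule N.inner_faithful_imp_order[OF _ L]) (rule alg_closed_imp_poly_has_root)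
  next
    assume "g ^ N.m = 1"
    then show "galois_theoretical TYPE('k + 'l) H"
      by (rule N.order_imp_galois_theoretical)
  qed
qed

end
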